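(* Let $c_1>c_2>0$, let $Y$ denote the analytification of the algebraic variety $$\{(x_1,x_2,z,y_1,y_2)\in\Lambda^2\times\mathbb P_\Lambda\times(\Lambda^* )^2\mid x_1z=1+y_1,\ x_2=(1+y_2)z\}$$ over the Novikov field $\Lambda=\mathbb C((T^{\mathbb R}))$, and let $B=\mathbb R^3$. Let $F:Y\to\mathbb R^5$, $j:B\to\mathbb R^5$, $\Delta\subset B$, and $A(q_1,q_2),A'(q_1,q_2)\in\mathbb R^3$ be as defined in the context. Then $F$ restricts to an affinoid torus fibration over $\mathfrak B_0=F(Y)\setminus\hat\Delta$, where the singular locus is $$\hat\Delta=\{(A'(0,q_2),0,q_2)\mid q_2\in\mathbb R\}\cup\{(A(q_1,0),q_1,0)\mid q_1\in\mathbb R\}.$$ Moreover, $j(\Delta)=\hat\Delta$ and $$j(B)=\{(u_1,u_2,v,q_1,q_2)\in F(Y)\mid u_2>0\}.$$ In other words, setting $\mathscr Y=\{|x_2|<1\}=\{\mathsf v(x_2)>0\}\subset Y$, one has $j(B)=F(\mathscr Y)$.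
   Context: **Novikov field.** $\Lambda=\mathbb C((T^{\mathbb R}))=\{\sum_{i\ge0}a_iT^{\lambda_i}\mid a_i\in\mathbb C,\ \lambda_i\in\mathbb R,\ \lambda_i\to+\infty\}$, with valuation $\mathsf v:\Lambda\to\mathbb R\cup\{+\infty\}$ (the smallest exponent with nonzero coefficient) and norm $|x|=e^{-\mathsf v(x)}$. $\mathbb P_\Lambda=\Lambda\cup\{\infty\}$ is the projective line, $\mathsf v(\infty)=-\infty$. The equations of $Y$ are read homogeneously in $z$: near $z=\infty$, with $w=1/z$, they are $x_1=(1+y_1)w$, $1+y_2=x_2w$. **Smooth and singular points.** The tropicalization map is $\mathfrak{trop}:(\Lambda^* )^n\to\mathbb R^n$, $(y_i)\mapsto(\mathsf v(y_i))$, where $(\Lambda^* )^n$ means the analytification of the algebraic torus. For a proper continuous map $f$ from an $n$-dimensional analytic space over $\Lambda$ to an $n$-dimensional topological manifold or CW complex, a point $p$ of the base is *smooth* if it has a neighborhood $U$ such that $f^{-1}(U)\to U$ is isomorphic to $\mathfrak{trop}^{-1}(V)\to V$ for some $V\subset\mathbb R^n$, covering a homeomorphism $U\cong V$; otherwise it is *singular*. The singular locus is the set of singular points; $f$ is an *affinoid torus fibration* if all points of its base are smooth. Here $n=3$ and $F$ is regarded as a map onto its image $F(Y)\subset\mathbb R^5$. **The function $\psi$.** Let $X'=\{(u_1,v_1,u_2,v_2)\in\mathbb C^4\mid u_1v_1-c_1=u_2v_2-c_2\}$, $z=u_iv_i-c_i$, and $X=X'\setminus\{z=0\}\subset\mathbb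 C^4\times\mathbb C^*$, with $\omega$ the restriction of the standard form $\omega_0=\sum_{k=1,2}\frac i2(du_k\wedge d\bar u_k+dv_k\wedge d\bar v_k)+\frac i2\frac{dz\wedge d\bar z}{|z|^2}$ on $\mathbb C^4\times\mathbb C^*$. For $q=(q_1,q_2,q_3)\in\mathbb R^3$ let $L_q\subset X$ be given by $\frac12(|u_i|^2-|v_i|^2)=q_i$ ($i=1,2$), $\log|z|=q_3$; it is the fiber product over $\mathbb C_z$ of $L_i=\{(u_i,v_i)\in\mathbb C^2\mid\frac12(|u_i|^2-|v_i|^2)=q_i,\ |u_iv_i-c_i|=e^{q_3}\}$, and a disk class in $(X',L_q)$ is written $(\beta_1,\beta_2)$ with $\beta_i$ a disk class in $(\mathbb C^2,L_i)$. If $q_3<\log c_i$ ($L_i$ of Chekanov type), let $\hat\beta_i$ be the preferred Maslov-index-2 class, that of disks disjoint from $\{u_iv_i=0\}$; if $q_3>\log c_i$ ($L_i$ of Clifford type), let $\beta_{i+}$ be the Maslov-index-2 class with $\beta_{i+}\cdot\{v_i=0\}=1$. Write $E(\beta)=\frac1{2\pi}\int_\beta\omega$. Then $\psi$ is the function, smooth on $\mathbb R^3\setminus\Delta$ (with $\Delta$ as below) and continuous on $\mathbb R^3$, equal to $E((\hat\beta_1,\hat\beta_2))$ if $q_3<\log c_2$, to $E((\hat\beta_1,\beta_{2+}))+\min\{0,q_2\}$ if $\log c_2<q_3<\log c_1$, and to $E((\beta_{1+},\beta_{2+}))+\min\{0,q_1\}+\min\{0,q_2\}$ if $q_3>\log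 c_1$. For fixed $q_1,q_2$, the function $q_3\mapsto\psi(q_1,q_2,q_3)$ is an increasing diffeomorphism from $\mathbb R$ to $(0,+\infty)$. Write $\psi^{(i)}=\psi^{(i)}(q_1,q_2)=\psi(q_1,q_2,\log c_i)$ for $i=1,2$ and $m=m(q_1,q_2)=\min\{0,q_1\}+\min\{0,q_2\}$. **The points $A,A'$.** $A(q_1,q_2)=(-\psi^{(1)}+m,\psi^{(2)},\psi^{(2)})$ and $A'(q_1,q_2)=(-\psi^{(1)}+m,\psi^{(2)},\psi^{(1)})$. **The locus $\Delta$.** $\Delta=\Delta_1\cup\Delta_2$ with $\Delta_1=\{0\}\times\mathbb R\times\{\log c_1\}$, $\Delta_2=\mathbb R\times\{0\}\times\{\log c_2\}$. **The map $j$.** $j(q)=(\theta_1(q),\theta_2(q),\vartheta(q),q_1,q_2)$ for $q=(q_1,q_2,q_3)\in\mathbb R^3$, with $\theta_1=\min\{-\psi(q),-\psi^{(1)}\}+\min\{0,q_1\}+\min\{0,q_2\}$, $\theta_2=\min\{\psi(q),\psi^{(2)}\}$, $\vartheta=\mathrm{median}\{\psi(q),\psi^{(1)},\psi^{(2)}\}$. **The map $F$.** $F(x_1,x_2,z,y_1,y_2)=(F_1,F_2,G,\mathsf v(y_1),\mathsf v(y_2))$ where, with $\psi^{(i)}$ evaluated at $(\mathsf v(y_1),\mathsf v(y_2))$, $F_1=\min\{\mathsf v(x_1),-\psi^{(1)}+\min\{0,\mathsf v(y_1)\}+\min\{0,\mathsf v(y_2)\}\}$, $F_2=\min\{\mathsf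 v(x_2),\psi^{(2)}\}$, $G=\mathrm{median}\{\mathsf v(z)+\min\{0,\mathsf v(y_2)\},\psi^{(1)},\psi^{(2)}\}$.
   Formalization: The energy E in ψ omits the term (i/2)dz∧dz̄/|z|² of ω, whose integral diverges on disks in X' crossing z=0; ψ is assumed only continuous, and strictly increasing in q₃ onto (0,∞), since it is not smooth at qᵢ=0, q₃>log cᵢ. *)

theory Defs
  imports
    "HOL-Complex_Analysis.Winding_Numbers"
    "HOL-Library.Poly_Mapping"
    "HOL-Algebra.QuotRing"
begin

section \<open>The Novikov field\<close>

text \<open>A series \<open>\<Sum>\<^sub>i a\<^sub>i T^(\<lambda>\<^sub>i)\<close> with \<open>\<lambda>\<^sub>i \<longlonglongrightarrow> \<infinity>\<close> is its coefficient function, which has only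
  finitely many nonzero values below every bound.\<close>

typedef novikov = "{f :: real \<Rightarrow> complex. \<forall>M. finite {a. a \<le> M \<and> f a \<noteq> 0}}"
  morphisms nov_coeff Abs_novikov
  by (rule exI[of _ "\<lambda>_. 0"]) simp

lemma nov_finite: "finite {a. a \<le> M \<and> nov_coeff x a \<noteq> 0}"
  using nov_coeff[of x] by simp

lemma nov_eqI: "(\<And>a. nov_coeff x a = nov_coeff y a) \<Longrightarrow> x = y"
  by (metis nov_coeff_inject ext)

lemma nov_bounded_below: obtains L where "\<And>a. nov_coeff x a \<noteq> 0 \<Longrightarrow> L \<le> a"
proof -
  let ?S = "insert 0 {a. a \<le> 0 \<and> nov_coeff x a \<noteq> 0}"
  have fin: "finite ?S" using nov_finite[of 0 x] by simp
  have "Min ?S \<le> a" if "nov_coeff x a \<noteq> 0" for a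
  proof (cases "a \<le> 0")
    case True
    then show ?thesis using that fin by (intro Min_le) auto
  next
    case False
    moreover have "Min ?S \<le> 0" using fin by (intro Min_le) auto
    ultimately show ?thesis by linarith
  qed
  then show ?thesis using that by blast
qed

instantiation novikov :: "{zero, one, plus, uminus, minus, times}"
begin

definition zero_novikov :: novikov where "0 = Abs_novikov (\<lambda>_. 0)"
definition one_novikov :: novikov where "1 = Abs_novikov (\<lambda>a. if a = 0 then 1 else 0)"
definition plus_novikov :: "novikov \<Rightarrow> novikov \<Rightarrow> novikov"
  where "x + y = Abs_novikov (\<lambda>a. nov_coeff x a + nov_coeff y a)"
definition uminus_novikov :: "novikov \<Rightarrow> novikov"
  where "- x = Abs_novikov (\<lambda>a. - nov_coeff x a)"
definition minus_novikov :: "novikov \<Rightarrow> novikov \<Rightarrow> novikov"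
  where "x - y = x + (- y :: novikov)"
definition times_novikov :: "novikov \<Rightarrow> novikov \<Rightarrow> novikov"
  where "x * y = Abs_novikov (\<lambda>m.
    \<Sum>a | nov_coeff x a \<noteq> 0 \<and> nov_coeff y (m - a) \<noteq> 0. nov_coeff x a * nov_coeff y (m - a))"

instance ..

end

lemma nov_coeff_zero [simp]: "nov_coeff 0 a = 0"
  by (simp add: zero_novikov_def Abs_novikov_inverse)

lemma nov_coeff_one: "nov_coeff 1 a = (if a = 0 then 1 else 0)"
proof -
  have "finite {a::real. a \<le> M \<and> a = 0}" for M by (rule finite_subset[of _ "{0}"]) auto
  then show ?thesis by (simp add: one_novikov_def Abs_novikov_inverse)
qed

lemma nov_coeff_plus [simp]: "nov_coeff (x + y) a = nov_coeff x a + nov_coeff y a"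
proof -
  have "finite {a. a \<le> M \<and> nov_coeff x a + nov_coeff y a \<noteq> 0}" for M
    by (rule finite_subset[OF _ finite_UnI[OF nov_finite[of M x] nov_finite[of M y]]]) auto
  then show ?thesis by (simp add: plus_novikov_def Abs_novikov_inverse)
qed

lemma nov_coeff_uminus [simp]: "nov_coeff (- x) a = - nov_coeff x a"
  using nov_finite[of _ x] by (simp add: uminus_novikov_def Abs_novikov_inverse)

lemma nov_coeff_minus [simp]: "nov_coeff (x - y) a = nov_coeff x a - nov_coeff y a"
  by (simp add: minus_novikov_def)

lemma nov_conv_finite: "finite {a. nov_coeff x a \<noteq> 0 \<and> nov_coeff y (m - a) \<noteq> 0}"
proof -
  obtain L where "\<And>a. nov_coeff y a \<noteq> 0 \<Longrightarrow> L \<le> a" using nov_bounded_below by blast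
  then show ?thesis
    by (intro finite_subset[OF _ nov_finite[of "m - L" x]]) fastforce
qed

lemma nov_coeff_times:
  "nov_coeff (x * y) m =
    (\<Sum>a | nov_coeff x a \<noteq> 0 \<and> nov_coeff y (m - a) \<noteq> 0. nov_coeff x a * nov_coeff y (m - a))"
proof -
  let ?f = "\<lambda>m. \<Sum>a | nov_coeff x a \<noteq> 0 \<and> nov_coeff y (m - a) \<noteq> 0.
    nov_coeff x a * nov_coeff y (m - a)"
  obtain L where L: "\<And>a. nov_coeff x a \<noteq> 0 \<Longrightarrow> L \<le> a" using nov_bounded_below by blast
  obtain K where K: "\<And>a. nov_coeff y a \<noteq> 0 \<Longrightarrow> K \<le> a" using nov_bounded_below by blast
  have "finite {m. m \<le> M \<and> ?f m \<noteq> 0}" for M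
  proof (rule finite_subset)
    let ?A = "{a. a \<le> M - K \<and> nov_coeff x a \<noteq> 0}"
    let ?B = "{b. b \<le> M - L \<and> nov_coeff y b \<noteq> 0}"
    show "{m. m \<le> M \<and> ?f m \<noteq> 0} \<subseteq> (\<lambda>(a, b). a + b) ` (?A \<times> ?B)"
    proof
      fix m assume "m \<in> {m. m \<le> M \<and> ?f m \<noteq> 0}"
      then have m: "m \<le> M" "?f m \<noteq> 0" by auto
      then obtain a where a: "nov_coeff x a \<noteq> 0" "nov_coeff y (m - a) \<noteq> 0"
        by (metis (mono_tags, lifting) mem_Collect_eq sum.neutral mult_eq_0_iff)
      have "L \<le> a" "K \<le> m - a" using L K a by auto
      with a m have "(a, m - a) \<in> ?A \<times> ?B" by auto
      then show "m \<in> (\<lambda>(a, b). a + b) ` (?A \<times> ?B)" by force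
    qed
    show "finite ((\<lambda>(a, b). a + b) ` (?A \<times> ?B))"
      using nov_finite by blast
  qed
  then show ?thesis by (simp add: times_novikov_def Abs_novikov_inverse)
qed

lemma nov_coeff_times_left:
  assumes "finite A" "{a. nov_coeff x a \<noteq> 0 \<and> nov_coeff y (m - a) \<noteq> 0} \<subseteq> A"
  shows "nov_coeff (x * y) m = (\<Sum>a\<in>A. nov_coeff x a * nov_coeff y (m - a))"
  unfolding nov_coeff_times using assms by (intro sum.mono_neutral_left) auto

lemma nov_times_commute: "(x::novikov) * y = y * x"
proof (rule nov_eqI)
  fix m
  show "nov_coeff (x * y) m = nov_coeff (y * x) m"
    unfolding nov_coeff_times
    by (rule sum.reindex_bij_witness[of _ "\<lambda>a. m - a" "\<lambda>a. m - a"]) auto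
qed

lemma nov_coeff_times_right:
  assumes "finite A" "{a. nov_coeff x (m - a) \<noteq> 0 \<and> nov_coeff y a \<noteq> 0} \<subseteq> A"
  shows "nov_coeff (x * y) m = (\<Sum>a\<in>A. nov_coeff x (m - a) * nov_coeff y a)"
  using assms by (subst nov_times_commute, subst nov_coeff_times_left[of A]) (auto simp: mult.commute)

lemma nov_times_supp:
  assumes "nov_coeff (x * y) m \<noteq> 0"
  obtains a where "nov_coeff x a \<noteq> 0" "nov_coeff y (m - a) \<noteq> 0"
  using assms unfolding nov_coeff_times
  by (metis (mono_tags, lifting) mem_Collect_eq sum.neutral mult_eq_0_iff)

lemma nov_times_assoc: "(x * y) * z = x * (y * (z::novikov))"
proof (rule nov_eqI)
  fix m
  obtain L1 where L1: "\<And>a. nov_coeff x a \<noteq> 0 \<Longrightarrow> L1 \<le> a" using nov_bounded_below by blast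
  obtain L2 where L2: "\<And>a. nov_coeff y a \<noteq> 0 \<Longrightarrow> L2 \<le> a" using nov_bounded_below by blast
  obtain L3 where L3: "\<And>a. nov_coeff z a \<noteq> 0 \<Longrightarrow> L3 \<le> a" using nov_bounded_below by blast
  define A where "A = {a. a \<le> m - L2 - L3 \<and> nov_coeff x a \<noteq> 0}"
  define C where "C = {a. a \<le> m - L1 - L2 \<and> nov_coeff z a \<noteq> 0}"
  have fin: "finite A" "finite C" unfolding A_def C_def by (rule nov_finite)+
  have xy: "L1 + L2 \<le> a" if nz: "nov_coeff (x * y) a \<noteq> 0" for a
  proof -
    obtain b where "nov_coeff x b \<noteq> 0" "nov_coeff y (a - b) \<noteq> 0"
      using nz by (rule nov_times_supp)
    then show ?thesis using L1[of b] L2[of "a - b"] by linarith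
  qed
  have yz: "L2 + L3 \<le> a" if nz: "nov_coeff (y * z) a \<noteq> 0" for a
  proof -
    obtain b where "nov_coeff y b \<noteq> 0" "nov_coeff z (a - b) \<noteq> 0"
      using nz by (rule nov_times_supp)
    then show ?thesis using L2[of b] L3[of "a - b"] by linarith
  qed
  have "nov_coeff ((x * y) * z) m = (\<Sum>c\<in>C. nov_coeff (x * y) (m - c) * nov_coeff z c)"
  proof (rule nov_coeff_times_right[OF fin(2)], safe)
    fix c assume "nov_coeff (x * y) (m - c) \<noteq> 0" "nov_coeff z c \<noteq> 0"
    then show "c \<in> C" using xy[of "m - c"] by (auto simp: C_def)
  qed
  also have "\<dots> = (\<Sum>c\<in>C. (\<Sum>a\<in>A. nov_coeff x a * nov_coeff y (m - c - a)) * nov_coeff z c)"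
  proof (rule sum.cong[OF refl])
    fix c assume "c \<in> C"
    then have "L3 \<le> c" using L3 by (auto simp: C_def)
    have "nov_coeff (x * y) (m - c) = (\<Sum>a\<in>A. nov_coeff x a * nov_coeff y (m - c - a))"
    proof (rule nov_coeff_times_left[OF fin(1)], safe)
      fix a assume "nov_coeff x a \<noteq> 0" "nov_coeff y (m - c - a) \<noteq> 0"
      then show "a \<in> A" using L2[of "m - c - a"] \<open>L3 \<le> c\<close> by (auto simp: A_def)
    qed
    then show "nov_coeff (x * y) (m - c) * nov_coeff z c =
      (\<Sum>a\<in>A. nov_coeff x a * nov_coeff y (m - c - a)) * nov_coeff z c" by simp
  qed
  also have "\<dots> = (\<Sum>a\<in>A. nov_coeff x a * (\<Sum>c\<in>C. nov_coeff y (m - a - c) * nov_coeff z c))"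
    unfolding sum_distrib_left sum_distrib_right
    by (subst sum.swap) (simp add: mult.assoc algebra_simps)
  also have "\<dots> = (\<Sum>a\<in>A. nov_coeff x a * nov_coeff (y * z) (m - a))"
  proof (rule sum.cong[OF refl])
    fix a assume "a \<in> A"
    then have "L1 \<le> a" using L1 by (auto simp: A_def)
    have "nov_coeff (y * z) (m - a) = (\<Sum>c\<in>C. nov_coeff y (m - a - c) * nov_coeff z c)"
    proof (rule nov_coeff_times_right[OF fin(2)], safe)
      fix c assume "nov_coeff y (m - a - c) \<noteq> 0" "nov_coeff z c \<noteq> 0"
      then show "c \<in> C" using L2[of "m - a - c"] \<open>L1 \<le> a\<close> by (auto simp: C_def)
    qed
    then show "nov_coeff x a * (\<Sum>c\<in>C. nov_coeff y (m - a - c) * nov_coeff z c) =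
      nov_coeff x a * nov_coeff (y * z) (m - a)" by simp
  qed
  also have "\<dots> = nov_coeff (x * (y * z)) m"
  proof (rule nov_coeff_times_left[OF fin(1), symmetric], safe)
    fix a assume "nov_coeff x a \<noteq> 0" "nov_coeff (y * z) (m - a) \<noteq> 0"
    then show "a \<in> A" using yz[of "m - a"] by (auto simp: A_def)
  qed
  finally show "nov_coeff ((x * y) * z) m = nov_coeff (x * (y * z)) m" .
qed

instance novikov :: comm_ring_1
proof
  fix x y z :: novikov
  show "x * y * z = x * (y * z)" by (rule nov_times_assoc)
  show "x * y = y * x" by (rule nov_times_commute)
  show "1 * x = x"
  proof (rule nov_eqI)
    fix m
    have "nov_coeff (1 * x) m = (\<Sum>a\<in>{0}. nov_coeff 1 a * nov_coeff x (m - a))"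
      by (rule nov_coeff_times_left) (auto simp: nov_coeff_one split: if_splits)
    then show "nov_coeff (1 * x) m = nov_coeff x m" by (simp add: nov_coeff_one)
  qed
  show "x + y + z = x + (y + z)" "x + y = y + x" "0 + x = x" "- x + x = 0" "x - y = x + - y"
    by (rule nov_eqI, simp)+
  have "nov_coeff 1 0 \<noteq> nov_coeff 0 0" unfolding nov_coeff_one by simp
  then show "(0::novikov) \<noteq> 1" by metis
  show "(x + y) * z = x * z + y * z"
  proof (rule nov_eqI)
    fix m
    let ?A = "{a. nov_coeff x a \<noteq> 0 \<and> nov_coeff z (m - a) \<noteq> 0} \<union>
              {a. nov_coeff y a \<noteq> 0 \<and> nov_coeff z (m - a) \<noteq> 0}"
    have fin: "finite ?A" by (intro finite_UnI nov_conv_finite)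
    have "nov_coeff ((x + y) * z) m = (\<Sum>a\<in>?A. nov_coeff (x + y) a * nov_coeff z (m - a))"
      by (rule nov_coeff_times_left[OF fin]) auto
    moreover have "nov_coeff (x * z) m = (\<Sum>a\<in>?A. nov_coeff x a * nov_coeff z (m - a))"
      by (rule nov_coeff_times_left[OF fin]) auto
    moreover have "nov_coeff (y * z) m = (\<Sum>a\<in>?A. nov_coeff y a * nov_coeff z (m - a))"
      by (rule nov_coeff_times_left[OF fin]) auto
    ultimately show "nov_coeff ((x + y) * z) m = nov_coeff (x * z + y * z) m"
      by (simp add: sum.distrib distrib_right)
  qed
qed

lemma nov_least_exponent:
  assumes "x \<noteq> 0"
  obtains l where "nov_coeff x l \<noteq> 0" "\<And>a. nov_coeff x a \<noteq> 0 \<Longrightarrow> l \<le> a"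
proof -
  obtain b where b: "nov_coeff x b \<noteq> 0" using assms by (metis nov_eqI nov_coeff_zero)
  let ?S = "{a. a \<le> b \<and> nov_coeff x a \<noteq> 0}"
  have S: "finite ?S" "?S \<noteq> {}" using nov_finite b by auto
  have "Min ?S \<le> a" if "nov_coeff x a \<noteq> 0" for a
  proof (cases "a \<le> b")
    case True then show ?thesis using that S by (intro Min_le) auto
  next
    case False
    moreover have "Min ?S \<le> b" using S b by (intro Min_le) auto
    ultimately show ?thesis by linarith
  qed
  moreover have "nov_coeff x (Min ?S) \<noteq> 0" using Min_in[OF S] by simp
  ultimately show ?thesis using that by blast
qed

definition nov_monom :: "complex \<Rightarrow> real \<Rightarrow> novikov"
  where "nov_monom c l = Abs_novikov (\<lambda>a. if a = l then c else 0)"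

lemma nov_coeff_monom: "nov_coeff (nov_monom c l) a = (if a = l then c else 0)"
proof -
  have "finite {a. a \<le> M \<and> (if a = l then c else 0) \<noteq> 0}" for M
    by (rule finite_subset[of _ "{l}"]) auto
  then show ?thesis by (simp add: nov_monom_def Abs_novikov_inverse)
qed

lemma nov_coeff_monom_times: "nov_coeff (nov_monom c l * x) m = c * nov_coeff x (m - l)"
proof -
  have "nov_coeff (nov_monom c l * x) m =
      (\<Sum>a\<in>{l}. nov_coeff (nov_monom c l) a * nov_coeff x (m - a))"
    by (rule nov_coeff_times_left) (auto simp: nov_coeff_monom split: if_splits)
  then show ?thesis by (simp add: nov_coeff_monom)
qed

lemma nov_power_supp:
  assumes "\<And>a. nov_coeff u a \<noteq> 0 \<Longrightarrow> d \<le> a"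
  shows "nov_coeff (u ^ k) a \<noteq> 0 \<Longrightarrow> of_nat k * d \<le> a"
proof (induction k arbitrary: a)
  case 0
  then show ?case by (simp add: nov_coeff_one split: if_splits)
next
  case (Suc k)
  from Suc.prems obtain b where "nov_coeff u b \<noteq> 0" "nov_coeff (u ^ k) (a - b) \<noteq> 0"
    unfolding power_Suc by (rule nov_times_supp)
  then have "d \<le> b" "of_nat k * d \<le> a - b" using assms Suc.IH by auto
  then show ?case by (simp add: algebra_simps)
qed

text \<open>\<open>1 - u\<close> with \<open>u\<close> of positive valuation is inverted by the geometric series.\<close>

lemma nov_geometric:
  assumes d: "d > 0" and u: "\<And>a. nov_coeff u a \<noteq> 0 \<Longrightarrow> d \<le> a"
  shows "\<exists>y. (1 - u) * y = 1"
proof -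
  define s where "s N = (\<Sum>k\<le>N. u ^ k)" for N :: nat
  define N where "N a = nat \<lceil>a / d\<rceil>" for a
  have N: "a < of_nat (Suc k) * d" if "N a \<le> k" for a k
  proof -
    have "a / d \<le> of_nat (N a)" unfolding N_def by linarith
    also have "\<dots> < of_nat (Suc k)" using that by simp
    finally show ?thesis using d by (simp add: field_simps)
  qed
  have coeff_sum: "nov_coeff (\<Sum>k\<in>K. f k) a = (\<Sum>k\<in>K. nov_coeff (f k) a)"
    for K :: "nat set" and f a
    by (induction K rule: infinite_finite_induct) auto
  have stable: "nov_coeff (s n) a = nov_coeff (s (N a)) a" if "N a \<le> n" for n a
    using that
  proof (induction n rule: dec_induct)
    case (step n)
    have "nov_coeff (u ^ Suc n) a = 0"
      using nov_power_supp[of u d "Suc n" a, OF u] N[OF step.hyps(1)] by force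
    then show ?case using step.IH by (simp add: s_def)
  qed simp
  define f where "f a = nov_coeff (s (N a)) a" for a
  have N_mono: "N a \<le> N b" if "a \<le> b" for a b
    unfolding N_def using that d by (intro nat_mono ceiling_mono divide_right_mono) auto
  have agree: "f a = nov_coeff (s (N M)) a" if "a \<le> M" for a M
    unfolding f_def using stable[OF N_mono[OF that]] by simp
  have "finite {a. a \<le> M \<and> f a \<noteq> 0}" for M
    by (rule finite_subset[OF _ nov_finite[of M "s (N M)"]]) (auto simp: agree)
  then have y: "nov_coeff (Abs_novikov f) = f" by (simp add: Abs_novikov_inverse)
  have "(1 - u) * Abs_novikov f = 1"
  proof (rule nov_eqI)
    fix m
    have nonneg: "0 \<le> a" if "nov_coeff (1 - u) a \<noteq> 0" for a
      using that u[of a] d by (auto simp: nov_coeff_one split: if_splits)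
    have same: "f (m - a) = nov_coeff (s (N m)) (m - a)" if "nov_coeff (1 - u) a \<noteq> 0" for a
      using agree[of "m - a" m] nonneg[OF that] by simp
    have "nov_coeff ((1 - u) * Abs_novikov f) m = nov_coeff ((1 - u) * s (N m)) m"
      unfolding nov_coeff_times y
      by (rule sum.cong) (auto simp: same simp del: nov_coeff_minus)
    also have "(1 - u) * s (N m) = 1 - u ^ Suc (N m)"
      unfolding s_def lessThan_Suc_atMost[symmetric] by (rule one_diff_power_eq[symmetric])
    also have "nov_coeff (1 - u ^ Suc (N m)) m = nov_coeff 1 m"
      using nov_power_supp[of u d "Suc (N m)" m, OF u] N[of m "N m"] by force
    finally show "nov_coeff ((1 - u) * Abs_novikov f) m = nov_coeff 1 m" .
  qed
  then show ?thesis by blast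
qed

lemma nov_unit:
  assumes "x \<noteq> 0"
  shows "\<exists>y. x * y = (1::novikov)"
proof -
  obtain l where l: "nov_coeff x l \<noteq> 0" "\<And>a. nov_coeff x a \<noteq> 0 \<Longrightarrow> l \<le> a"
    using nov_least_exponent[OF assms] by blast
  define t where "t = nov_monom (inverse (nov_coeff x l)) (- l)"
  define u where "u = 1 - t * x"
  have cu: "nov_coeff u a = (if a = 0 then 1 else 0) - nov_coeff x (a + l) / nov_coeff x l" for a
    unfolding u_def nov_coeff_minus t_def nov_coeff_monom_times nov_coeff_one
    by (simp add: divide_inverse mult.commute)
  have pos: "0 < a" if "nov_coeff u a \<noteq> 0" for a
  proof -
    have "a \<noteq> 0" using that l(1) by (auto simp: cu)
    then have "nov_coeff x (a + l) \<noteq> 0" using that by (auto simp: cu)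
    then show ?thesis using l(2) \<open>a \<noteq> 0\<close> by force
  qed
  have "\<exists>d>0. \<forall>a. nov_coeff u a \<noteq> 0 \<longrightarrow> d \<le> a"
  proof (cases "u = 0")
    case True
    then show ?thesis by (intro exI[of _ 1]) simp
  next
    case False
    then show ?thesis using nov_least_exponent pos by metis
  qed
  then obtain y where "(1 - u) * y = 1" using nov_geometric by metis
  then have "x * (t * y) = 1" by (simp add: u_def algebra_simps)
  then show ?thesis by blast
qed

instantiation novikov :: inverse
begin

definition inverse_novikov :: "novikov \<Rightarrow> novikov"
  where "inverse x = (if x = (0 :: novikov) then 0 else (THE y. x * y = 1))"
definition divide_novikov :: "novikov \<Rightarrow> novikov \<Rightarrow> novikov"
  where "x div y = x * inverse (y :: novikov)"

instance ..

end

instance novikov :: field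
proof
  fix x y :: novikov
  show "x \<noteq> 0 \<Longrightarrow> inverse x * x = 1"
  proof -
    assume nz: "x \<noteq> 0"
    obtain y where y: "x * y = 1" using nov_unit[OF nz] by blast
    have "(THE y. x * y = 1) = y"
    proof (rule the_equality, rule y)
      fix w assume "x * w = 1"
      have "w = w * (x * y)" using y by simp
      also have "\<dots> = (x * w) * y" by (simp only: ac_simps)
      also have "\<dots> = y" using \<open>x * w = 1\<close> by simp
      finally show "w = y" .
    qed
    then show "inverse x * x = 1" using y nz by (simp add: inverse_novikov_def mult.commute)
  qed
  show "inverse (0::novikov) = 0" by (simp add: inverse_novikov_def)
  show "x div y = x * inverse y" by (rule divide_novikov_def)
qed

definition nov_val :: "novikov \<Rightarrow> ereal"
  where "nov_val x = (if x = 0 then \<infinity> else ereal (LEAST a. nov_coeff x a \<noteq> 0))"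

definition nov_norm :: "novikov \<Rightarrow> real"
  where "nov_norm x = (if x = 0 then 0 else exp (- real_of_ereal (nov_val x)))"


section \<open>Berkovich analytic spaces over the Novikov field\<close>

text \<open>Coordinate rings are monoid algebras \<open>\<Lambda>['m]\<close>: polynomials for \<open>'m = 'v \<Rightarrow>\<^sub>0 nat\<close>, Laurent
  polynomials for \<open>'m = 'v \<Rightarrow>\<^sub>0 int\<close>.  A point of an analytification is a multiplicative seminorm
  on such a ring that extends the norm of \<open>\<Lambda>\<close>; the Berkovich topology is the topology of pointwise
  convergence, that is, the one induced from the function space.\<close>

type_synonym 'm nov_alg = "'m \<Rightarrow>\<^sub>0 novikov"
type_synonym 'm berk_pt = "'m nov_alg \<Rightarrow> real"

definition const :: "novikov \<Rightarrow> 'm::comm_monoid_add nov_alg"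
  where "const c = Poly_Mapping.single 0 c"

definition mult_seminorm :: "'m::comm_monoid_add berk_pt \<Rightarrow> bool"
  where "mult_seminorm p \<longleftrightarrow>
    (\<forall>f. 0 \<le> p f) \<and>
    (\<forall>f g. p (f + g) \<le> max (p f) (p g)) \<and>
    (\<forall>f g. p (f * g) = p f * p g) \<and>
    (\<forall>c. p (const c) = nov_norm c)"

text \<open>The valuation \<open>\<v>(f) = - log |f|\<close> of a function at a point.\<close>

definition pt_val :: "'m berk_pt \<Rightarrow> 'm nov_alg \<Rightarrow> ereal"
  where "pt_val p f = (if p f = 0 then \<infinity> else ereal (- ln (p f)))"

text \<open>The rational functions from which the structure sheaf is built are fractions, given as pairs
  (numerator, denominator) in a set \<open>Q\<close>: all pairs in the affine case, pairs of forms of equal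
  degree in the projective case.  The completed residue field \<open>\<H>(p)\<close> is the Cauchy completion of
  the field of fractions whose denominator does not vanish at \<open>p\<close>.\<close>

type_synonym 'm nov_frac = "'m nov_alg \<times> 'm nov_alg"

definition frac_add :: "'m::comm_monoid_add nov_frac \<Rightarrow> 'm nov_frac \<Rightarrow> 'm nov_frac"
  where "frac_add a b = (fst a * snd b + fst b * snd a, snd a * snd b)"

definition frac_mult :: "'m::comm_monoid_add nov_frac \<Rightarrow> 'm nov_frac \<Rightarrow> 'm nov_frac"
  where "frac_mult a b = (fst a * fst b, snd a * snd b)"

definition frac_norm :: "'m berk_pt \<Rightarrow> 'm nov_frac \<Rightarrow> real"
  where "frac_norm p a = p (fst a) / p (snd a)"

definition frac_dist :: "'m::comm_monoid_add berk_pt \<Rightarrow> 'm nov_frac \<Rightarrow> 'm nov_frac \<Rightarrow> real"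
  where "frac_dist p a b = frac_norm p (fst a * snd b - fst b * snd a, snd a * snd b)"

definition frac_cauchy :: "'m::comm_monoid_add nov_frac set \<Rightarrow> 'm berk_pt \<Rightarrow> (nat \<Rightarrow> 'm nov_frac) set"
  where "frac_cauchy Q p = {s. (\<forall>n. s n \<in> Q \<and> p (snd (s n)) \<noteq> 0) \<and>
    (\<forall>e>0. \<exists>N. \<forall>m\<ge>N. \<forall>n\<ge>N. frac_dist p (s m) (s n) < e)}"

definition frac_equiv :: "'m::comm_monoid_add nov_frac set \<Rightarrow> 'm berk_pt \<Rightarrow> (nat \<Rightarrow> 'm nov_frac) rel"
  where "frac_equiv Q p = {(s, t). s \<in> frac_cauchy Q p \<and> t \<in> frac_cauchy Q p \<and>
    (\<lambda>n. frac_dist p (s n) (t n)) \<longlonglongrightarrow> 0}"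

definition residue_field ::
    "'m::comm_monoid_add nov_frac set \<Rightarrow> 'm berk_pt \<Rightarrow> (nat \<Rightarrow> 'm nov_frac) set ring"
  where "residue_field Q p = \<lparr>
    carrier = frac_cauchy Q p // frac_equiv Q p,
    mult = (\<lambda>a b. \<Union>s\<in>a. \<Union>t\<in>b. frac_equiv Q p `` {\<lambda>n. frac_mult (s n) (t n)}),
    one = frac_equiv Q p `` {\<lambda>_. (1, 1)},
    zero = frac_equiv Q p `` {\<lambda>_. (0, 1)},
    add = (\<lambda>a b. \<Union>s\<in>a. \<Union>t\<in>b. frac_equiv Q p `` {\<lambda>n. frac_add (s n) (t n)})\<rparr>"

definition residue_norm :: "'m berk_pt \<Rightarrow> (nat \<Rightarrow> 'm nov_frac) set \<Rightarrow> real"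
  where "residue_norm p a = (THE r. \<forall>s\<in>a. (\<lambda>n. frac_norm p (s n)) \<longlonglongrightarrow> r)"

text \<open>The value at \<open>p\<close> of a fraction, as an element of \<open>\<H>(p)\<close>.\<close>

definition residue_frac ::
    "'m::comm_monoid_add nov_frac set \<Rightarrow> 'm berk_pt \<Rightarrow> 'm nov_frac \<Rightarrow> (nat \<Rightarrow> 'm nov_frac) set"
  where "residue_frac Q p a = frac_equiv Q p `` {\<lambda>_. a}"

text \<open>Berkovich's description of the structure sheaf of a reduced space: an analytic function on an
  open set \<open>U\<close> assigns to each \<open>x \<in> U\<close> an element of \<open>\<H>(x)\<close> and is locally a uniform limit of
  fractions without poles.\<close>

definition analytic_fun ::
    "'m::comm_monoid_add nov_frac set \<Rightarrow> 'm berk_pt set \<Rightarrow> ('m berk_pt \<Rightarrow> (nat \<Rightarrow> 'm nov_frac) set) \<Rightarrow> bool"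
  where "analytic_fun Q U f \<longleftrightarrow>
    (\<forall>x\<in>U. f x \<in> carrier (residue_field Q x)) \<and>
    (\<forall>x\<in>U. \<exists>N. openin (top_of_set U) N \<and> x \<in> N \<and>
      (\<forall>e>0. \<exists>a\<in>Q. \<forall>y\<in>N. y (snd a) \<noteq> 0 \<and>
        residue_norm y (f y \<ominus>\<^bsub>residue_field Q y\<^esub> residue_frac Q y a) < e))"

text \<open>Isomorphism of the open pieces \<open>W\<close> and \<open>W'\<close> of two reduced spaces: a homeomorphism \<open>\<phi>\<close> together
  with isometric \<open>\<Lambda>\<close>-isomorphisms \<open>\<H>(\<phi> x) \<cong> \<H>(x)\<close> through which it identifies the two structure
  sheaves.\<close>

definition analytic_iso ::
    "'m::comm_monoid_add nov_frac set \<Rightarrow> 'm berk_pt set \<Rightarrow>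
     'k::comm_monoid_add nov_frac set \<Rightarrow> 'k berk_pt set \<Rightarrow> ('m berk_pt \<Rightarrow> 'k berk_pt) \<Rightarrow> bool"
  where "analytic_iso Q W R W' \<phi> \<longleftrightarrow>
    homeomorphic_map (top_of_set W) (top_of_set W') \<phi> \<and>
    (\<exists>\<tau>.
      (\<forall>x\<in>W. \<tau> x \<in> ring_iso (residue_field R (\<phi> x)) (residue_field Q x) \<and>
        (\<forall>a\<in>carrier (residue_field R (\<phi> x)). residue_norm x (\<tau> x a) = residue_norm (\<phi> x) a) \<and>
        (\<forall>c. \<tau> x (residue_frac R (\<phi> x) (const c, 1)) = residue_frac Q x (const c, 1))) \<and>
      (\<forall>U f. openin (top_of_set W') U \<and> (\<forall>y\<in>U. f y \<in> carrier (residue_field R y)) \<longrightarrow>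
        (analytic_fun R U f \<longleftrightarrow> analytic_fun Q {x\<in>W. \<phi> x \<in> U} (\<lambda>x. \<tau> x (f (\<phi> x))))))"


section \<open>Affinoid torus fibrations\<close>

type_synonym 'n torus_mon = "'n \<Rightarrow>\<^sub>0 int"

definition torus_an :: "'n torus_mon berk_pt set"
  where "torus_an = {p. mult_seminorm p}"

definition trop :: "'n::finite torus_mon berk_pt \<Rightarrow> real ^ 'n"
  where "trop p = (\<chi> i. real_of_ereal (pt_val p (Poly_Mapping.single (Poly_Mapping.single i 1) 1)))"

text \<open>Here \<open>f\<close> is a map from the space with points \<open>Y\<close> and fractions \<open>Q\<close> to the base \<open>B\<close>.\<close>

definition smooth_point ::
    "'n::finite itself \<Rightarrow> 'm::comm_monoid_add nov_frac set \<Rightarrow> 'm berk_pt set \<Rightarrow>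
     ('m berk_pt \<Rightarrow> 'b::topological_space) \<Rightarrow> 'b set \<Rightarrow> 'b \<Rightarrow> bool"
  where "smooth_point _ Q Y f B b \<longleftrightarrow> b \<in> B \<and>
    (\<exists>U (V :: (real ^ 'n) set) h \<phi>.
      openin (top_of_set B) U \<and> b \<in> U \<and> open V \<and>
      homeomorphic_map (top_of_set U) (top_of_set V) h \<and>
      analytic_iso Q {x\<in>Y. f x \<in> U} UNIV {p\<in>torus_an. trop p \<in> V} \<phi> \<and>
      (\<forall>x\<in>Y. f x \<in> U \<longrightarrow> trop (\<phi> x) = h (f x)))"

definition singular_locus ::
    "'n::finite itself \<Rightarrow> 'm::comm_monoid_add nov_frac set \<Rightarrow> 'm berk_pt set \<Rightarrow>
     ('m berk_pt \<Rightarrow> 'b::topological_space) \<Rightarrow> 'b set \<Rightarrow> 'b set"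
  where "singular_locus n Q Y f B = {b\<in>B. \<not> smooth_point n Q Y f B b}"

definition proper_continuous :: "'a::topological_space set \<Rightarrow> ('a \<Rightarrow> 'b::topological_space) \<Rightarrow> 'b set \<Rightarrow> bool"
  where "proper_continuous Y f B \<longleftrightarrow>
    continuous_map (top_of_set Y) (top_of_set B) f \<and> proper_map (top_of_set Y) (top_of_set B) f"

definition affinoid_torus_fibration ::
    "'n::finite itself \<Rightarrow> 'm::comm_monoid_add nov_frac set \<Rightarrow> 'm berk_pt set \<Rightarrow>
     ('m berk_pt \<Rightarrow> 'b::topological_space) \<Rightarrow> 'b set \<Rightarrow> bool"
  where "affinoid_torus_fibration n Q Y f B \<longleftrightarrow>
    proper_continuous Y f B \<and> (\<forall>b\<in>B. smooth_point n Q Y f B b)"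


section \<open>The variety \<open>Y\<close>\<close>

text \<open>The line \<open>\<P>\<^sub>\<Lambda>\<close> has homogeneous coordinates \<open>z = Z0 / Z1\<close>, with \<open>z = \<infinity>\<close> given by \<open>Z1 = 0\<close>.\<close>

datatype yvar = X1 | X2 | Z0 | Z1 | Y1 | Y2

type_synonym y_mon = "yvar \<Rightarrow>\<^sub>0 nat"

definition var :: "yvar \<Rightarrow> y_mon nov_alg"
  where "var v = Poly_Mapping.single (Poly_Mapping.single v 1) 1"

text \<open>The component of degree \<open>d\<close> in \<open>(Z0, Z1)\<close>.\<close>

definition zpart :: "nat \<Rightarrow> y_mon nov_alg \<Rightarrow> y_mon nov_alg"
  where "zpart d f = (\<Sum>m | m \<in> Poly_Mapping.keys f \<and>
      Poly_Mapping.lookup m Z0 + Poly_Mapping.lookup m Z1 = d.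
    Poly_Mapping.single m (Poly_Mapping.lookup f m))"

definition y_fracs :: "y_mon nov_frac set"
  where "y_fracs = {(g, h). \<exists>d. zpart d g = g \<and> zpart d h = h}"

text \<open>A point of the analytic projective line is a class of multiplicative seminorms on
  \<open>\<Lambda>[Z0, Z1]\<close>, not both \<open>|Z0|\<close>, \<open>|Z1|\<close> vanishing, where two seminorms are equivalent if for some
  \<open>C > 0\<close> they differ by the factor \<open>C ^ d\<close> on the forms of degree \<open>d\<close>, for all \<open>d\<close>; likewise over
  \<open>\<Lambda>[X1, X2, Y1, Y2]\<close>.  Each class contains exactly one seminorm with \<open>max |Z0| |Z1| = 1\<close> for
  which \<open>|f|\<close> is the maximum of the norms of the homogeneous components of \<open>f\<close>; this
  representative depends continuously on the class, and we take it as the point.\<close>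

definition Yan :: "y_mon berk_pt set"
  where "Yan = {p. mult_seminorm p \<and>
    (\<forall>f. p f = (SUP d. p (zpart d f))) \<and> max (p (var Z0)) (p (var Z1)) = 1 \<and>
    p (var Y1) \<noteq> 0 \<and> p (var Y2) \<noteq> 0 \<and>
    p (var X1 * var Z0 - (1 + var Y1) * var Z1) = 0 \<and>
    p (var X2 * var Z1 - (1 + var Y2) * var Z0) = 0}"

text \<open>\<open>\<v>(z) = - \<infinity>\<close> at \<open>z = \<infinity>\<close>, where the second term is \<open>\<infinity>\<close> and the first is \<open>0\<close>.\<close>

definition z_val :: "y_mon berk_pt \<Rightarrow> ereal"
  where "z_val p = pt_val p (var Z0) - pt_val p (var Z1)"

definition y_val :: "y_mon berk_pt \<Rightarrow> yvar \<Rightarrow> real"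
  where "y_val p v = real_of_ereal (pt_val p (var v))"


section \<open>The function \<open>\<psi>\<close>\<close>

text \<open>Disks are maps of the closed unit disk that are \<open>C\<^sup>1\<close> up to the boundary.\<close>

definition C1_disk :: "(complex \<Rightarrow> complex) \<Rightarrow> bool"
  where "C1_disk f \<longleftrightarrow> (\<exists>f1 f2. continuous_on (cball 0 1) f1 \<and> continuous_on (cball 0 1) f2 \<and>
    (\<forall>z\<in>cball 0 1. (f has_derivative (\<lambda>h. Re h *\<^sub>R f1 z + Im h *\<^sub>R f2 z)) (at z within cball 0 1)))"

definition bdry :: "(complex \<Rightarrow> 'a) \<Rightarrow> real \<Rightarrow> 'a"
  where "bdry f t = f (cis (2 * pi * t))"

text \<open>The torus \<open>L\<^sub>i\<close> in \<open>\<complex>\<^sup>2\<close>, with \<open>q = q\<^sub>i\<close> and \<open>r = q\<^sub>3\<close>, and its tangent spaces.\<close>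

definition L_torus :: "real \<Rightarrow> real \<Rightarrow> real \<Rightarrow> (complex \<times> complex) set"
  where "L_torus c q r = {(u, v). ((cmod u)\<^sup>2 - (cmod v)\<^sup>2) / 2 = q \<and>
    cmod (u * v - complex_of_real c) = exp r}"

definition L_tangent :: "real \<Rightarrow> complex \<times> complex \<Rightarrow> (complex \<times> complex) set"
  where "L_tangent c = (\<lambda>(u, v). {(a, b). Re (cnj u * a - cnj v * b) = 0 \<and>
    Re (cnj (u * v - complex_of_real c) * (v * a + u * b)) = 0})"

text \<open>The Maslov index is the degree of \<open>det\<^sup>2 / |det\<^sup>2|\<close> along the loop of tangent Lagrangian planes;
  the value does not depend on the bases of the planes.\<close>

definition has_maslov_index :: "real \<Rightarrow> (complex \<Rightarrow> complex) \<Rightarrow> (complex \<Rightarrow> complex) \<Rightarrow> int \<Rightarrow> bool"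
  where "has_maslov_index c u v k \<longleftrightarrow> (\<exists>a1 b1 a2 b2 :: real \<Rightarrow> complex.
    (\<forall>t\<in>{0..1}. (a1 t, b1 t) \<in> L_tangent c (bdry u t, bdry v t) \<and>
       (a2 t, b2 t) \<in> L_tangent c (bdry u t, bdry v t) \<and> a1 t * b2 t - a2 t * b1 t \<noteq> 0) \<and>
    winding_number (\<lambda>t. (a1 t * b2 t - a2 t * b1 t)\<^sup>2 / complex_of_real (cmod ((a1 t * b2 t - a2 t * b1 t)\<^sup>2))) 0
      = of_int k)"

definition disk_in_C2 :: "real \<Rightarrow> real \<Rightarrow> real \<Rightarrow> (complex \<Rightarrow> complex) \<Rightarrow> (complex \<Rightarrow> complex) \<Rightarrow> bool"
  where "disk_in_C2 c q r u v \<longleftrightarrow> C1_disk u \<and> C1_disk v \<and>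
    (\<forall>z\<in>sphere 0 1. (u z, v z) \<in> L_torus c q r)"

text \<open>The disks representing \<open>\<beta>\<close>-hat (Chekanov type) and \<open>\<beta>\<^sub>+\<close> (Clifford type).  Since the boundary
  does not meet \<open>{v = 0}\<close>, the intersection number with this line is the winding number of \<open>v\<close>
  along the boundary.\<close>

definition beta_hat_disk :: "real \<Rightarrow> real \<Rightarrow> real \<Rightarrow> (complex \<Rightarrow> complex) \<Rightarrow> (complex \<Rightarrow> complex) \<Rightarrow> bool"
  where "beta_hat_disk c q r u v \<longleftrightarrow> disk_in_C2 c q r u v \<and> has_maslov_index c u v 2 \<and>
    (\<forall>z\<in>cball 0 1. u z * v z \<noteq> 0)"

definition beta_plus_disk :: "real \<Rightarrow> real \<Rightarrow> real \<Rightarrow> (complex \<Rightarrow> complex) \<Rightarrow> (complex \<Rightarrow> complex) \<Rightarrow> bool"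
  where "beta_plus_disk c q r u v \<longleftrightarrow> disk_in_C2 c q r u v \<and> has_maslov_index c u v 2 \<and>
    winding_number (bdry v) 0 = 1"

text \<open>\<open>\<integral> f\<^sup>* (\<i>/2 d\<zeta> \<and> d\<zeta>\<^sup>*)\<close> over the unit disk: the integrand is the Jacobian of \<open>f\<close>.\<close>

definition disk_area :: "(complex \<Rightarrow> complex) \<Rightarrow> real"
  where "disk_area f = integral (ball 0 1) (\<lambda>z.
    Im (cnj (frechet_derivative f (at z) 1) * frechet_derivative f (at z) \<i>))"

text \<open>The symplectic form entering \<open>E\<close> is the restriction to \<open>X'\<close> of the standard form of \<open>\<complex>\<^sup>4\<close>.
  The summand \<open>\<i>/2 dz \<and> dz\<^sup>* / |z|\<^sup>2\<close> of the form on \<open>X\<close> is not integrable on disks in \<open>X'\<close> that cross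
  \<open>{z = 0}\<close>, as all disks in the classes below do (its integral is infinite), so it has to be left
  out of the energy of classes in \<open>(X', L\<^sub>q)\<close>.\<close>

definition disk_energy ::
    "(complex \<Rightarrow> complex) \<Rightarrow> (complex \<Rightarrow> complex) \<Rightarrow> (complex \<Rightarrow> complex) \<Rightarrow> (complex \<Rightarrow> complex) \<Rightarrow> real"
  where "disk_energy u1 v1 u2 v2 =
    (disk_area u1 + disk_area v1 + disk_area u2 + disk_area v2) / (2 * pi)"

text \<open>\<open>\<psi>\<close> is determined by the energies, which do not depend on the disk chosen in a class, and by
  continuity across the walls \<open>q\<^sub>3 = log c\<^sub>i\<close>.  (It is not differentiable where \<open>q\<^sub>i = 0\<close> and
  \<open>q\<^sub>3 > log c\<^sub>i\<close>, because of the terms \<open>min 0 q\<^sub>i\<close>.)  The disks \<open>(u1, v1, u2, v2)\<close> below lie in \<open>X'\<close> and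
  have their boundary on \<open>L\<^sub>q\<close>.\<close>

definition is_psi :: "real \<Rightarrow> real \<Rightarrow> (real \<times> real \<times> real \<Rightarrow> real) \<Rightarrow> bool"
  where "is_psi c1 c2 \<psi> \<longleftrightarrow> continuous_on UNIV \<psi> \<and>
    (\<forall>q1 q2 q3 u1 v1 u2 v2.
      (\<forall>z\<in>cball 0 1. u1 z * v1 z - complex_of_real c1 = u2 z * v2 z - complex_of_real c2) \<longrightarrow>
      (q3 < ln c2 \<and> beta_hat_disk c1 q1 q3 u1 v1 \<and> beta_hat_disk c2 q2 q3 u2 v2 \<longrightarrow>
         \<psi> (q1, q2, q3) = disk_energy u1 v1 u2 v2) \<and>
      (ln c2 < q3 \<and> q3 < ln c1 \<and> beta_hat_disk c1 q1 q3 u1 v1 \<and> beta_plus_disk c2 q2 q3 u2 v2 \<longrightarrow>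
         \<psi> (q1, q2, q3) = disk_energy u1 v1 u2 v2 + min 0 q2) \<and>
      (ln c1 < q3 \<and> beta_plus_disk c1 q1 q3 u1 v1 \<and> beta_plus_disk c2 q2 q3 u2 v2 \<longrightarrow>
         \<psi> (q1, q2, q3) = disk_energy u1 v1 u2 v2 + min 0 q1 + min 0 q2))"


section \<open>The maps \<open>F\<close> and \<open>j\<close> and the loci\<close>

type_synonym real3 = "real \<times> real \<times> real"
type_synonym real5 = "real \<times> real \<times> real \<times> real \<times> real"

definition median :: "'a::linorder \<Rightarrow> 'a \<Rightarrow> 'a \<Rightarrow> 'a"
  where "median a b c = max (min a b) (min (max a b) c)"

text \<open>\<open>psi_at \<psi> c\<^sub>i q\<^sub>1 q\<^sub>2\<close> is the number written \<open>\<psi>\<close> with upper index \<open>(i)\<close>.\<close>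

definition psi_at :: "(real3 \<Rightarrow> real) \<Rightarrow> real \<Rightarrow> real \<Rightarrow> real \<Rightarrow> real"
  where "psi_at \<psi> c q1 q2 = \<psi> (q1, q2, ln c)"

definition F_map :: "real \<Rightarrow> real \<Rightarrow> (real3 \<Rightarrow> real) \<Rightarrow> y_mon berk_pt \<Rightarrow> real5"
  where "F_map c1 c2 \<psi> p = (let
      q1 = y_val p Y1; q2 = y_val p Y2;
      \<psi>1 = psi_at \<psi> c1 q1 q2; \<psi>2 = psi_at \<psi> c2 q1 q2
    in (real_of_ereal (min (pt_val p (var X1)) (ereal (- \<psi>1 + min 0 q1 + min 0 q2))),
        real_of_ereal (min (pt_val p (var X2)) (ereal \<psi>2)),
        real_of_ereal (median (z_val p + ereal (min 0 q2)) (ereal \<psi>1) (ereal \<psi>2)),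
        q1, q2))"

definition j_map :: "real \<Rightarrow> real \<Rightarrow> (real3 \<Rightarrow> real) \<Rightarrow> real3 \<Rightarrow> real5"
  where "j_map c1 c2 \<psi> = (\<lambda>(q1, q2, q3). let
      \<psi>1 = psi_at \<psi> c1 q1 q2; \<psi>2 = psi_at \<psi> c2 q1 q2; s = \<psi> (q1, q2, q3)
    in (min (- s) (- \<psi>1) + min 0 q1 + min 0 q2, min s \<psi>2, median s \<psi>1 \<psi>2, q1, q2))"

definition Delta :: "real \<Rightarrow> real \<Rightarrow> real3 set"
  where "Delta c1 c2 = ({0} \<times> UNIV \<times> {ln c1}) \<union> (UNIV \<times> {0} \<times> {ln c2})"

definition A_pt :: "real \<Rightarrow> real \<Rightarrow> (real3 \<Rightarrow> real) \<Rightarrow> real \<Rightarrow> real \<Rightarrow> real3"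
  where "A_pt c1 c2 \<psi> q1 q2 =
    (- psi_at \<psi> c1 q1 q2 + (min 0 q1 + min 0 q2), psi_at \<psi> c2 q1 q2, psi_at \<psi> c2 q1 q2)"

definition A'_pt :: "real \<Rightarrow> real \<Rightarrow> (real3 \<Rightarrow> real) \<Rightarrow> real \<Rightarrow> real \<Rightarrow> real3"
  where "A'_pt c1 c2 \<psi> q1 q2 =
    (- psi_at \<psi> c1 q1 q2 + (min 0 q1 + min 0 q2), psi_at \<psi> c2 q1 q2, psi_at \<psi> c1 q1 q2)"

definition Delta_hat :: "real \<Rightarrow> real \<Rightarrow> (real3 \<Rightarrow> real) \<Rightarrow> real5 set"
  where "Delta_hat c1 c2 \<psi> =
    {(a, b, c, 0, q2) | a b c q2. (a, b, c) = A'_pt c1 c2 \<psi> 0 q2} \<union>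
    {(a, b, c, q1, 0) | a b c q1. (a, b, c) = A_pt c1 c2 \<psi> q1 0}"

end

theory Submission
  imports Defs "HOL-Analysis.Urysohn" "HOL-Computational_Algebra.Fundamental_Theorem_Algebra"
begin

text \<open>The base is parametrized by \<open>(q\<^sub>1, q\<^sub>2, s) \<in> \<real>\<^sup>3\<close>.  Between the walls, where \<open>s\<close> is the value of
  \<open>\<psi>(q\<^sub>1, q\<^sub>2, q\<^sub>3)\<close> at \<open>q\<^sub>3 = log c\<^sub>2\<close> or at \<open>q\<^sub>3 = log c\<^sub>1\<close>, \<open>s\<close> is the valuation of \<open>z\<close> plus \<open>min 0 q\<^sub>2\<close>; beyond
  them it is read off from the valuations of \<open>x\<^sub>2\<close> and \<open>x\<^sub>1\<close>.  In these coordinates \<open>j\<close> maps \<open>q\<close> to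
  \<open>(q\<^sub>1, q\<^sub>2, \<psi> q)\<close>, and \<open>\<psi>\<close> matters only through its continuity, monotonicity and range.  Over the
  complement of the two lines, \<open>Y\<close> is covered by parts of three tori with coordinates \<open>(z, y\<^sub>1, y\<^sub>2)\<close>,
  \<open>(x\<^sub>1, y\<^sub>1, y\<^sub>2)\<close> and \<open>(x\<^sub>2, y\<^sub>1, y\<^sub>2)\<close>, on which \<open>F\<close> is the tropicalization up to a homeomorphism of the base.

  At a point of the two lines there is no chart: the affine line \<open>z = 0\<close>, \<open>y\<^sub>1 = - 1\<close> with fixed
  \<open>y\<^sub>2\<close> (or \<open>z = \<infinity>\<close>, \<open>y\<^sub>2 = - 1\<close> with fixed \<open>y\<^sub>1\<close>) has a closed disk in the fiber.  An analytic function
  whose norm is constant and nonzero on this disk keeps its norm on slightly larger disks, but \<open>F\<close> is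
  not constant there.\<close>


text \<open>What separates the two lines from the rest is the norm of 1 + y_i. If q_i is nonzero,
  the ultrametric inequality gives |1 + y_i| = max 1 |y_i|, so for given q the valuation of x_i is
  determined by that of z, and one torus coordinate besides y_1, y_2 is enough to know
  \<open>F\<close>. Only over q_i = 0 can 1 + y_i be smaller, and the bounds built into
  \<open>F\<close> conceal this except at the wall belonging to i. \<open>F(Y)\<close> is
  homeomorphic to three-space along the lines as well, so their singularity cannot be seen in the
  base and has to come from the structure sheaf. Near a point where it does not vanish, an analytic
  function has the same norm as one quotient of two forms. On the affine line, numerator and
  denominator have reductions over the residue field \<complex>. Constant norm in every residue disk
  of the closed unit disk forces equal multiplicities of each complex root; as \<complex> is
  algebraically closed, the degrees agree too, and these control the norm at radii above 1.\<close>

abbreviation lookup :: "('a \<Rightarrow>\<^sub>0 'b::zero) \<Rightarrow> 'a \<Rightarrow> 'b" where "lookup \<equiv> Poly_Mapping.lookup"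
abbreviation keys :: "('a \<Rightarrow>\<^sub>0 'b::zero) \<Rightarrow> 'a set" where "keys \<equiv> Poly_Mapping.keys"
abbreviation single :: "'a \<Rightarrow> 'b \<Rightarrow> ('a \<Rightarrow>\<^sub>0 'b::zero)" where "single \<equiv> Poly_Mapping.single"


section \<open>The norm of the Novikov field\<close>

lemma nov_norm_zero [simp]: "nov_norm 0 = 0"
  by (simp add: nov_norm_def)

lemma nov_norm_eq:
  assumes "nov_coeff x l \<noteq> 0" "\<And>a. nov_coeff x a \<noteq> 0 \<Longrightarrow> l \<le> a"
  shows "nov_norm x = exp (- l)"
proof -
  have "x \<noteq> 0" using assms(1) by auto
  moreover have "(LEAST a. nov_coeff x a \<noteq> 0) = l"
    using assms by (intro Least_equality) auto
  ultimately show ?thesis by (simp add: nov_norm_def nov_val_def)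
qed

lemma nov_norm_nonzeroE:
  assumes "x \<noteq> 0"
  obtains l where "nov_coeff x l \<noteq> 0" "\<And>a. nov_coeff x a \<noteq> 0 \<Longrightarrow> l \<le> a" "nov_norm x = exp (- l)"
  using nov_least_exponent[OF assms] nov_norm_eq by metis

lemma nov_norm_nonneg [simp]: "0 \<le> nov_norm x"
  by (simp add: nov_norm_def)

text \<open>Turns a bound on the norm into a condition on the support, from which the ultrametric
  inequality is immediate. For \<open>x = 0\<close> the support is empty and both sides
  hold.\<close>

lemma nov_norm_le_iff: "nov_norm x \<le> exp (- l) \<longleftrightarrow> (\<forall>a. nov_coeff x a \<noteq> 0 \<longrightarrow> l \<le> a)"
proof (cases "x = 0")
  case False
  obtain k where k: "nov_coeff x k \<noteq> 0" "\<And>a. nov_coeff x a \<noteq> 0 \<Longrightarrow> k \<le> a" "nov_norm x = exp (- k)"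
    using nov_norm_nonzeroE[OF False] by blast
  show ?thesis
    unfolding k(3) using k(1,2) by (auto intro: order_trans)
qed auto

lemma nov_norm_monom: "nov_norm (nov_monom c l) = (if c = 0 then 0 else exp (- l))"
proof (cases "c = 0")
  case True
  then have "nov_monom c l = 0" by (intro nov_eqI) (simp add: nov_coeff_monom)
  then show ?thesis using True by simp
next
  case False
  then show ?thesis
    by (auto intro!: nov_norm_eq simp: nov_coeff_monom split: if_splits)
qed

lemma nov_monom_zero_one: "nov_monom 1 0 = 1"
  by (rule nov_eqI) (simp add: nov_coeff_monom nov_coeff_one)

lemma nov_monom_minus: "nov_monom (- c) l = - nov_monom c l"
  by (rule nov_eqI) (simp add: nov_coeff_monom)

lemma nov_norm_add: "nov_norm (x + y) \<le> max (nov_norm x) (nov_norm y)"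
proof (cases "nov_norm x = 0 \<and> nov_norm y = 0")
  case True
  then have "x = 0" "y = 0" by (auto simp: nov_norm_def split: if_splits)
  then show ?thesis by simp
next
  case False
  then have "max (nov_norm x) (nov_norm y) > 0"
    by (metis less_max_iff_disj nov_norm_nonneg order_less_le)
  then obtain l where l: "max (nov_norm x) (nov_norm y) = exp (- l)"
    by (metis exp_ln minus_minus)
  then have "nov_norm x \<le> exp (- l)" "nov_norm y \<le> exp (- l)" by (metis max.cobounded1, metis max.cobounded2)
  then show ?thesis unfolding l unfolding nov_norm_le_iff by (metis add_0 nov_coeff_plus)
qed

text \<open>Leading terms do not cancel: exponents of \<open>x\<close> and \<open>y\<close> that sum
  to \<open>k + l\<close> must be the two least ones, so the coefficient there is a product of two
  nonzero complex numbers.\<close>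

lemma nov_norm_mult: "nov_norm (x * y) = nov_norm x * nov_norm y"
proof (cases "x = 0 \<or> y = 0")
  case False
  obtain k where k: "nov_coeff x k \<noteq> 0" "\<And>a. nov_coeff x a \<noteq> 0 \<Longrightarrow> k \<le> a" "nov_norm x = exp (- k)"
    using nov_norm_nonzeroE False by blast
  obtain l where l: "nov_coeff y l \<noteq> 0" "\<And>a. nov_coeff y a \<noteq> 0 \<Longrightarrow> l \<le> a" "nov_norm y = exp (- l)"
    using nov_norm_nonzeroE False by blast
  have "nov_coeff (x * y) (k + l) = (\<Sum>a\<in>{k}. nov_coeff x a * nov_coeff y (k + l - a))"
    by (rule nov_coeff_times_left) (use k l in force)+
  then have "nov_coeff (x * y) (k + l) \<noteq> 0" using k l by simp
  moreover have "k + l \<le> a" if nz: "nov_coeff (x * y) a \<noteq> 0" for a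
  proof -
    obtain b where "nov_coeff x b \<noteq> 0" "nov_coeff y (a - b) \<noteq> 0"
      using nz by (rule nov_times_supp)
    then show ?thesis using k(2)[of b] l(2)[of "a - b"] by linarith
  qed
  ultimately have "nov_norm (x * y) = exp (- (k + l))" by (rule nov_norm_eq)
  then show ?thesis by (simp add: k(3) l(3) exp_add[symmetric])
qed auto

lemma nov_norm_one [simp]: "nov_norm 1 = 1"
  using nov_norm_monom[of 1 0] by (simp add: nov_monom_zero_one)

lemma nov_norm_minus_one [simp]: "nov_norm (- 1) = 1"
  using nov_norm_monom[of "- 1" 0] by (simp add: nov_monom_minus nov_monom_zero_one)

lemma nov_norm_eq_0_iff [simp]: "nov_norm x = 0 \<longleftrightarrow> x = 0"
  by (simp add: nov_norm_def)


section \<open>Multiplicative seminorms\<close>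

lemma const_0 [simp]: "const 0 = 0"
  and const_1 [simp]: "const 1 = 1"
  and const_add: "const (a + b) = const a + const b"
  and const_mult: "const (a * b) = const a * const b"
  and const_uminus: "const (- a) = - const a"
  by (simp_all add: const_def single_add mult_single single_uminus)

context
  fixes p :: "'m::comm_monoid_add berk_pt"
  assumes p: "mult_seminorm p"
begin

lemma ms_nonneg [simp]: "0 \<le> p f" using p by (simp add: mult_seminorm_def)
lemma ms_add: "p (f + g) \<le> max (p f) (p g)" using p by (simp add: mult_seminorm_def)
lemma ms_mult: "p (f * g) = p f * p g" using p by (simp add: mult_seminorm_def)
lemma ms_const: "p (const c) = nov_norm c" using p by (simp add: mult_seminorm_def)
lemma ms_0 [simp]: "p 0 = 0" using ms_const[of 0] by simp
lemma ms_1 [simp]: "p 1 = 1" using ms_const[of 1] by simp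

lemma ms_uminus [simp]: "p (- f) = p f"
proof -
  have "- f = const (- 1) * f" by (simp add: const_uminus)
  then show ?thesis by (simp only: ms_mult ms_const nov_norm_minus_one mult_1)
qed

lemma ms_diff: "p (f - g) \<le> max (p f) (p g)"
  using ms_add[of f "- g"] by simp

lemma ms_power: "p (f ^ n) = p f ^ n"
  by (induction n) (simp_all add: ms_mult)

lemma ms_add_less: "p f < B \<Longrightarrow> p g < B \<Longrightarrow> p (f + g) < B"
  using ms_add[of f g] by linarith

lemma ms_sum_le: "0 \<le> B \<Longrightarrow> (\<And>i. i \<in> I \<Longrightarrow> p (f i) \<le> B) \<Longrightarrow> p (\<Sum>i\<in>I. f i) \<le> B"
proof (induction I rule: infinite_finite_induct)
  case (insert i I)
  then show ?case using ms_add[of "f i" "\<Sum>i\<in>I. f i"] by (simp add: max.coboundedI1)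
                    (metis (no_types, lifting) insertCI max.bounded_iff order_trans)
qed simp_all

lemma ms_sum_less: "0 < B \<Longrightarrow> (\<And>i. i \<in> I \<Longrightarrow> p (f i) < B) \<Longrightarrow> p (\<Sum>i\<in>I. f i) < B"
  by (induction I rule: infinite_finite_induct) (simp_all add: ms_add_less)

text \<open>A strictly dominant summand survives: writing \<open>f = (f + g) - g\<close>, a drop in
  the norm of \<open>f + g\<close> would bound \<open>f\<close> by something smaller than
  itself.\<close>

lemma ms_add_eq: assumes "p g < p f" shows "p (f + g) = p f" "p (g + f) = p f"
proof -
  have "p f \<le> max (p (f + g)) (p g)" using ms_diff[of "f + g" g] by simp
  moreover have "p (f + g) \<le> p f" using ms_add[of f g] assms by simp
  ultimately show "p (f + g) = p f" using assms by linarith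
  then show "p (g + f) = p f" by (simp add: add.commute)
qed

text \<open>Used to read the equations of \<open>Y\<close>, which hold at a point as vanishing of a
  difference, as equations between norms.\<close>

lemma ms_eq_of_diff: "p (f - g) = 0 \<Longrightarrow> p f = p g"
  using ms_add[of "f - g" g] ms_add[of "g - f" f] ms_uminus[of "f - g"] ms_nonneg[of f] ms_nonneg[of g]
  by (simp add: max_def split: if_splits)

text \<open>Cancellation against 1 is possible only for norm exactly 1. Applied to \<open>Y1\<close>
  and \<open>Y2\<close>, this is why trouble can occur only over q_1 = 0 or q_2 = 0.\<close>

lemma ms_one_plus: "p (1 + f) \<le> max 1 (p f)" "p f \<noteq> 1 \<Longrightarrow> p (1 + f) = max 1 (p f)"
proof -
  show "p (1 + f) \<le> max 1 (p f)" using ms_add[of 1 f] by simp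
  show "p (1 + f) = max 1 (p f)" if "p f \<noteq> 1"
    using that ms_add_eq[of f 1] ms_add_eq[of 1 f] by (cases "p f < 1") auto
qed

end


section \<open>Evaluation homomorphisms\<close>

text \<open>Two instances occur: \<open>const\<close>, which makes \<open>heval\<close> a change of
  coordinates between monoid algebras, and the identity, which makes it evaluation with values in
  the Novikov field.\<close>

definition nov_hom :: "(novikov \<Rightarrow> 'r::comm_ring_1) \<Rightarrow> bool"
  where "nov_hom \<iota> \<longleftrightarrow> (\<forall>a b. \<iota> (a + b) = \<iota> a + \<iota> b) \<and> (\<forall>a b. \<iota> (a * b) = \<iota> a * \<iota> b) \<and> \<iota> 1 = 1"

definition heval :: "(novikov \<Rightarrow> 'r::comm_ring_1) \<Rightarrow> ('m \<Rightarrow> 'r) \<Rightarrow> ('m \<Rightarrow>\<^sub>0 novikov) \<Rightarrow> 'r"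
  where "heval \<iota> \<xi> f = (\<Sum>m\<in>keys f. \<iota> (lookup f m) * \<xi> m)"

lemma nov_hom_const: "nov_hom const"
  by (simp add: nov_hom_def const_add const_mult)

lemma nov_hom_id: "nov_hom (\<lambda>x. x)"
  by (simp add: nov_hom_def)

lemma nov_alg_sum_single:
  "(f :: 'm nov_alg) = (\<Sum>m\<in>keys f. single m (lookup f m))"
  by (rule poly_mapping_eqI)
     (auto simp: lookup_sum lookup_single when_def in_keys_iff sum.delta')

context
  fixes \<iota> :: "novikov \<Rightarrow> 'r::comm_ring_1"
  assumes \<iota>: "nov_hom \<iota>"
begin

lemma nov_hom_0: "\<iota> 0 = 0"
  using \<iota> unfolding nov_hom_def by (metis add_cancel_right_left)

lemma heval_superset:
  assumes "finite K" "keys f \<subseteq> K"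
  shows "heval \<iota> \<xi> f = (\<Sum>m\<in>K. \<iota> (lookup f m) * \<xi> m)"
  unfolding heval_def using assms
  by (intro sum.mono_neutral_left) (auto simp: in_keys_iff nov_hom_0)

lemma heval_add: "heval \<iota> \<xi> (f + g) = heval \<iota> \<xi> f + heval \<iota> \<xi> g"
proof -
  let ?K = "keys f \<union> keys g"
  show ?thesis
    using \<iota> by (simp add: heval_superset[of ?K] keys_add lookup_add nov_hom_def distrib_right sum.distrib)
qed

lemma heval_single: "heval \<iota> \<xi> (single m c) = \<iota> c * \<xi> m"
  by (subst heval_superset[of "{m}"]) auto

lemma heval_0 [simp]: "heval \<iota> \<xi> 0 = 0"
  by (simp add: heval_def)

lemma heval_sum: "heval \<iota> \<xi> (\<Sum>i\<in>I. f i) = (\<Sum>i\<in>I. heval \<iota> \<xi> (f i))"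
  by (induction I rule: infinite_finite_induct) (simp_all add: heval_add)

lemma heval_uminus: "heval \<iota> \<xi> (- f) = - heval \<iota> \<xi> f"
  using heval_add[of \<xi> "- f" f] by (simp add: eq_neg_iff_add_eq_0)

lemma heval_diff: "heval \<iota> \<xi> (f - g) = heval \<iota> \<xi> f - heval \<iota> \<xi> g"
  using heval_add[of \<xi> f "- g"] by (simp add: heval_uminus)

text \<open>The weights of the two factors and of the product may differ and need to be compatible
  only on the supports. Clearing denominators requires this generality, because there the weight
  depends on a bound for the exponents, and these bounds add up under multiplication.\<close>

lemma heval_mult_graded:
  fixes f g :: "'m::comm_monoid_add nov_alg"
  assumes "\<And>a b. a \<in> keys f \<Longrightarrow> b \<in> keys g \<Longrightarrow> \<xi> (a + b) = \<xi>1 a * \<xi>2 b"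
  shows "heval \<iota> \<xi> (f * g) = heval \<iota> \<xi>1 f * heval \<iota> \<xi>2 g"
proof -
  let ?l = lookup and ?K = keys
  have "f * g = (\<Sum>a\<in>?K f. \<Sum>b\<in>?K g. single (a + b) (?l f a * ?l g b))"
    using arg_cong2[OF nov_alg_sum_single[of f] nov_alg_sum_single[of g], of "(*)"]
    by (simp add: sum_product mult_single)
  also have "heval \<iota> \<xi> \<dots> = (\<Sum>a\<in>?K f. \<Sum>b\<in>?K g. (\<iota> (?l f a) * \<xi>1 a) * (\<iota> (?l g b) * \<xi>2 b))"
    unfolding heval_sum using assms \<iota>
    by (intro sum.cong refl) (simp add: heval_single nov_hom_def mult_ac)
  finally show ?thesis by (simp add: heval_def sum_product)
qed

lemma heval_mult:
  fixes f g :: "'m::comm_monoid_add nov_alg"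
  assumes "\<And>a b. \<xi> (a + b) = \<xi> a * \<xi> b"
  shows "heval \<iota> \<xi> (f * g) = heval \<iota> \<xi> f * heval \<iota> \<xi> g"
  by (rule heval_mult_graded) (rule assms)

lemma heval_const:
  fixes \<xi> :: "'m::comm_monoid_add \<Rightarrow> 'r"
  shows "heval \<iota> \<xi> (const c) = \<iota> c * \<xi> 0"
  by (simp add: const_def heval_single)

end

lemma mult_seminorm_heval_norm:
  fixes \<xi> :: "'m::comm_monoid_add \<Rightarrow> novikov"
  assumes "\<And>a b. \<xi> (a + b) = \<xi> a * \<xi> b" "\<xi> 0 = 1"
  shows "mult_seminorm (\<lambda>f. nov_norm (heval (\<lambda>x. x) \<xi> f))"
  using assms
  by (simp add: mult_seminorm_def heval_add heval_mult heval_const nov_hom_id nov_norm_add nov_norm_mult)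

lemma mult_seminorm_heval:
  fixes \<xi> :: "'m::comm_monoid_add \<Rightarrow> 'k::comm_monoid_add nov_alg"
  assumes "mult_seminorm q" "\<And>a b. \<xi> (a + b) = \<xi> a * \<xi> b" "\<xi> 0 = 1"
  shows "mult_seminorm (\<lambda>f. q (heval const \<xi> f))"
  using assms(2,3) ms_add[OF assms(1)]
  by (simp add: mult_seminorm_def heval_add heval_mult heval_const nov_hom_const
      ms_nonneg[OF assms(1)] ms_mult[OF assms(1)] ms_const[OF assms(1)])


section \<open>Graded Gauss norms\<close>

text \<open>The degree function is a parameter because two gradings are used: the degree in
  \<open>(Z0, Z1)\<close> on the coordinate ring of \<open>Y\<close>, and the ordinary degree of
  polynomials in one variable.\<close>

definition gpart :: "('m \<Rightarrow> nat) \<Rightarrow> nat \<Rightarrow> ('m \<Rightarrow>\<^sub>0 novikov) \<Rightarrow> ('m \<Rightarrow>\<^sub>0 novikov)"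
  where "gpart deg d f = (\<Sum>m | m \<in> keys f \<and> deg m = d.
    single m (lookup f m))"

lemma lookup_gpart:
  "lookup (gpart deg d f) m = (if deg m = d then lookup f m else 0)"
proof -
  have "lookup (gpart deg d f) m =
      (\<Sum>k | k \<in> keys f \<and> deg k = d. if k = m then lookup f m else 0)"
    unfolding gpart_def lookup_sum by (rule sum.cong) (auto simp: lookup_single when_def)
  then show ?thesis by (auto simp: in_keys_iff)
qed

lemma gpart_add: "gpart deg d (f + g) = gpart deg d f + gpart deg d g"
  by (rule poly_mapping_eqI) (simp add: lookup_gpart lookup_add)

lemma gpart_0 [simp]: "gpart deg d 0 = 0"
  by (rule poly_mapping_eqI) (simp add: lookup_gpart)

lemma gpart_uminus: "gpart deg d (- f) = - gpart deg d f"
  by (rule poly_mapping_eqI) (simp add: lookup_gpart)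

lemma gpart_diff: "gpart deg d (f - g) = gpart deg d f - gpart deg d g"
  by (rule poly_mapping_eqI) (simp add: lookup_gpart lookup_minus)

lemma gpart_sum: "gpart deg d (\<Sum>i\<in>I. f i) = (\<Sum>i\<in>I. gpart deg d (f i))"
  by (induction I rule: infinite_finite_induct) (simp_all add: gpart_add)

lemma gpart_gpart: "gpart deg d (gpart deg e f) = (if d = e then gpart deg e f else 0)"
  by (rule poly_mapping_eqI) (simp add: lookup_gpart)

lemma gpart_single: "gpart deg d (single m c) = (if deg m = d then single m c else 0)"
  by (rule poly_mapping_eqI) (auto simp: lookup_gpart lookup_single when_def)

definition gdegs :: "('m \<Rightarrow> nat) \<Rightarrow> ('m \<Rightarrow>\<^sub>0 novikov) \<Rightarrow> nat set"
  where "gdegs deg f = deg ` keys f"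

lemma finite_gdegs [simp]: "finite (gdegs deg f)"
  by (simp add: gdegs_def)

lemma gpart_eq_0: "d \<notin> gdegs deg f \<Longrightarrow> gpart deg d f = 0"
  by (rule poly_mapping_eqI) (auto simp: lookup_gpart gdegs_def in_keys_iff)

lemma gpart_sum_eq:
  assumes "finite D" "gdegs deg f \<subseteq> D"
  shows "(\<Sum>d\<in>D. gpart deg d f) = f"
proof (rule poly_mapping_eqI)
  fix m
  have "deg m \<in> D \<or> lookup f m = 0"
    using assms by (auto simp: gdegs_def in_keys_iff)
  then show "lookup (\<Sum>d\<in>D. gpart deg d f) m = lookup f m"
    using assms(1) by (auto simp: lookup_sum lookup_gpart)
qed

lemma gpart_mult_gpart:
  fixes deg :: "'m::comm_monoid_add \<Rightarrow> nat"
  assumes "\<And>a b. deg (a + b) = deg a + deg b"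
  shows "gpart deg d (gpart deg i f * gpart deg j g) = (if d = i + j then gpart deg i f * gpart deg j g else 0)"
proof -
  have "gpart deg i f * gpart deg j g =
      (\<Sum>a | a \<in> keys f \<and> deg a = i. \<Sum>b | b \<in> keys g \<and> deg b = j.
        single (a + b) (lookup f a * lookup g b))"
    unfolding gpart_def by (simp add: sum_product mult_single)
  then show ?thesis
    by (simp add: gpart_sum gpart_single assms)
qed

lemma gpart_mult_homog:
  fixes deg :: "'m::comm_monoid_add \<Rightarrow> nat"
  assumes "\<And>a b. deg (a + b) = deg a + deg b" "gpart deg i f = f" "gpart deg j g = g"
  shows "gpart deg (i + j) (f * g) = f * g"
  using gpart_mult_gpart[of deg "i + j" i f j g] assms by simp

lemma gpart_mult:
  fixes deg :: "'m::comm_monoid_add \<Rightarrow> nat"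
  assumes "\<And>a b. deg (a + b) = deg a + deg b"
  shows "gpart deg d (f * g) = (\<Sum>i\<le>d. gpart deg i f * gpart deg (d - i) g)"
proof -
  obtain n where n: "gdegs deg f \<subseteq> {..n}" "gdegs deg g \<subseteq> {..n}"
    using finite_nat_iff_bounded_le[of "gdegs deg f \<union> gdegs deg g"] by auto
  let ?N = "{..max n d}"
  have N: "gdegs deg f \<subseteq> ?N" "gdegs deg g \<subseteq> ?N" using n by force+
  have "f * g = (\<Sum>i\<in>?N. \<Sum>j\<in>?N. gpart deg i f * gpart deg j g)"
    using gpart_sum_eq[OF _ N(1)] gpart_sum_eq[OF _ N(2)] by (simp flip: sum_product)
  then have "gpart deg d (f * g) = (\<Sum>i\<in>?N. \<Sum>j\<in>?N. if d = i + j then gpart deg i f * gpart deg j g else 0)"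
    by (simp add: gpart_sum gpart_mult_gpart[OF assms])
  also have "\<dots> = (\<Sum>i\<in>?N. if i \<le> d then gpart deg i f * gpart deg (d - i) g else 0)"
  proof (rule sum.cong[OF refl])
    fix i assume "i \<in> ?N"
    have "(\<Sum>j\<in>?N. if d = i + j then gpart deg i f * gpart deg j g else 0) =
       (\<Sum>j\<in>?N. if j = d - i then (if i \<le> d then gpart deg i f * gpart deg (d - i) g else 0) else 0)"
      by (rule sum.cong) auto
    also have "\<dots> = (if i \<le> d then gpart deg i f * gpart deg (d - i) g else 0)"
      by (auto simp: sum.delta le_max_iff_disj)
    finally show "(\<Sum>j\<in>?N. if d = i + j then gpart deg i f * gpart deg j g else 0) =
      (if i \<le> d then gpart deg i f * gpart deg (d - i) g else 0)" .
  qed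
  also have "\<dots> = (\<Sum>i\<le>d. gpart deg i f * gpart deg (d - i) g)"
    by (rule sum.mono_neutral_cong_right) auto
  finally show ?thesis .
qed

text \<open>For the degree in \<open>(Z0, Z1)\<close> this rescales a seminorm within its projective
  class and replaces it by the maximum over homogeneous components. For polynomials in one variable,
  with \<open>q\<close> the norm of the value at 1, it is the classical Gauss norm of radius
  \<open>c\<close>.\<close>

definition gauss :: "('m::comm_monoid_add \<Rightarrow> nat) \<Rightarrow> 'm berk_pt \<Rightarrow> real \<Rightarrow> 'm berk_pt"
  where "gauss deg q c f = (SUP d. c ^ d * q (gpart deg d f))"

context
  fixes deg :: "'m::comm_monoid_add \<Rightarrow> nat" and q :: "'m berk_pt" and c :: real
  assumes deg_add: "\<And>a b. deg (a + b) = deg a + deg b"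
    and q: "mult_seminorm q" and c: "c > 0"
begin

lemma gauss_finite_range: "finite (range (\<lambda>d. c ^ d * q (gpart deg d f)))"
proof (rule finite_subset)
  show "range (\<lambda>d. c ^ d * q (gpart deg d f)) \<subseteq> insert 0 ((\<lambda>d. c ^ d * q (gpart deg d f)) ` gdegs deg f)"
    using gpart_eq_0[of _ deg f] ms_0[OF q] by force
qed simp

lemma gauss_ge: "c ^ d * q (gpart deg d f) \<le> gauss deg q c f"
  unfolding gauss_def using gauss_finite_range
  by (intro cSUP_upper) (auto simp: bdd_above_finite)

lemma gauss_le: "(\<And>d. c ^ d * q (gpart deg d f) \<le> B) \<Longrightarrow> gauss deg q c f \<le> B"
  unfolding gauss_def by (rule cSUP_least) auto

lemma gauss_attained: obtains d where "gauss deg q c f = c ^ d * q (gpart deg d f)"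
proof -
  have "gauss deg q c f \<in> range (\<lambda>d. c ^ d * q (gpart deg d f))"
    unfolding gauss_def using gauss_finite_range
    by (metis (no_types, lifting) UNIV_not_empty cSup_eq_Max Max_in image_is_empty)
  then show ?thesis using that by blast
qed

lemma gauss_nonneg: "0 \<le> gauss deg q c f"
  using gauss_attained[of f] ms_nonneg[OF q] c by (metis mult_nonneg_nonneg less_imp_le zero_le_power)

lemma gauss_homog: "gpart deg d f = f \<Longrightarrow> gauss deg q c f = c ^ d * q f"
proof (rule antisym)
  assume f: "gpart deg d f = f"
  show "gauss deg q c f \<le> c ^ d * q f"
  proof (rule gauss_le)
    fix e show "c ^ e * q (gpart deg e f) \<le> c ^ d * q f"
      using gpart_gpart[of deg e d f] f c ms_nonneg[OF q, of f] by (auto simp: ms_0[OF q])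
  qed
  show "c ^ d * q f \<le> gauss deg q c f" using gauss_ge[of d f] f by simp
qed

text \<open>A positive value is attained only in degrees where \<open>f\<close> has a component,
  hence in finitely many, and a greatest one exists. For value 0 every large degree would attain
  it.\<close>

lemma gauss_last_attained:
  assumes "gauss deg q c f > 0"
  obtains d where "gauss deg q c f = c ^ d * q (gpart deg d f)"
    "\<And>e. d < e \<Longrightarrow> c ^ e * q (gpart deg e f) < gauss deg q c f"
proof -
  let ?D = "{d. c ^ d * q (gpart deg d f) = gauss deg q c f}"
  have fin: "finite ?D"
    using assms gpart_eq_0[of _ deg f] ms_0[OF q]
    by (intro finite_subset[OF _ finite_gdegs[of deg f]]) force
  have ne: "?D \<noteq> {}" using gauss_attained[of f] by (metis (mono_tags) empty_iff mem_Collect_eq)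
  show ?thesis
  proof (rule that[of "Max ?D"])
    show "gauss deg q c f = c ^ Max ?D * q (gpart deg (Max ?D) f)"
      using Max_in[OF fin ne] by simp
    fix e assume "Max ?D < e"
    then have "e \<notin> ?D" using Max_ge[OF fin] by (meson leD)
    then show "c ^ e * q (gpart deg e f) < gauss deg q c f" using gauss_ge[of e f] by simp
  qed
qed

text \<open>The Gauss lemma: among the products of components of \<open>f\<close> and \<open>g\<close>, that of the last components
  of maximal norm dominates all others of the same degree.\<close>

lemma gauss_mult: "gauss deg q c (f * g) = gauss deg q c f * gauss deg q c g"
proof (rule antisym)
  let ?G = "gauss deg q c" and ?N = "\<lambda>f d. c ^ d * q (gpart deg d f)"
  have split: "c ^ d * q (gpart deg i f * gpart deg (d - i) g) = ?N f i * ?N g (d - i)"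
    if "i \<le> d" for i d using that
    by (simp add: ms_mult[OF q] power_add[symmetric] mult_ac)
  show "?G (f * g) \<le> ?G f * ?G g"
  proof (rule gauss_le)
    fix d
    have "q (gpart deg d (f * g)) \<le> ?G f * ?G g / c ^ d"
      unfolding gpart_mult[OF deg_add]
    proof (rule ms_sum_le[OF q])
      show "0 \<le> ?G f * ?G g / c ^ d" using gauss_nonneg c by simp
      fix i assume "i \<in> {..d}"
      then have "c ^ d * q (gpart deg i f * gpart deg (d - i) g) = ?N f i * ?N g (d - i)"
        using split by simp
      also have "\<dots> \<le> ?G f * ?G g"
        using gauss_ge gauss_nonneg c ms_nonneg[OF q] by (intro mult_mono) auto
      finally show "q (gpart deg i f * gpart deg (d - i) g) \<le> ?G f * ?G g / c ^ d"
        using c by (simp add: pos_le_divide_eq mult.commute)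
    qed
    then show "?N (f * g) d \<le> ?G f * ?G g"
      using c by (simp add: pos_le_divide_eq mult.commute)
  qed
  show "?G f * ?G g \<le> ?G (f * g)"
  proof (cases "?G f = 0 \<or> ?G g = 0")
    case True
    then show ?thesis using gauss_nonneg by auto
  next
    case False
    then have pos: "?G f > 0" "?G g > 0" using gauss_nonneg[of f] gauss_nonneg[of g] by linarith+
    obtain i where i: "?G f = ?N f i" "\<And>e. i < e \<Longrightarrow> ?N f e < ?G f"
      using gauss_last_attained[OF pos(1)] by blast
    obtain j where j: "?G g = ?N g j" "\<And>e. j < e \<Longrightarrow> ?N g e < ?G g"
      using gauss_last_attained[OF pos(2)] by blast
    let ?d = "i + j"
    let ?t = "\<lambda>k. gpart deg k f * gpart deg (?d - k) g"
    have top: "c ^ ?d * q (?t i) = ?G f * ?G g" using split[of i ?d] i j by simp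
    have rest: "q (\<Sum>k\<in>{..?d} - {i}. ?t k) < q (?t i)"
    proof (rule ms_sum_less[OF q])
      show "0 < q (?t i)" using top pos c
        by (metis mult_pos_pos zero_less_mult_pos zero_less_power)
      fix k assume k: "k \<in> {..?d} - {i}"
      have "?N f k * ?N g (?d - k) < ?G f * ?G g"
      \<comment> \<open>Off the pair \<open>(i, j)\<close> either \<open>k > i\<close> or
        \<open>?d - k > j\<close>, so one of the two factors is strictly below its maximum.\<close>
      proof (cases "i < k")
        case True
        have "?N f k * ?N g (?d - k) \<le> ?N f k * ?G g"
          using gauss_ge c ms_nonneg[OF q] by (intro mult_left_mono) auto
        also have "\<dots> < ?G f * ?G g" using i(2)[OF True] pos by simp
        finally show ?thesis .
      next
        case False
        then have "j < ?d - k" using k by auto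
        have "?N f k * ?N g (?d - k) \<le> ?G f * ?N g (?d - k)"
          using gauss_ge c ms_nonneg[OF q] by (intro mult_right_mono) auto
        also have "\<dots> < ?G f * ?G g" using j(2)[OF \<open>j < ?d - k\<close>] pos by simp
        finally show ?thesis .
      qed
      then have "c ^ ?d * q (?t k) < c ^ ?d * q (?t i)" using split[of k ?d] k top by simp
      then show "q (?t k) < q (?t i)" using c by simp
    qed
    have "gpart deg ?d (f * g) = ?t i + (\<Sum>k\<in>{..?d} - {i}. ?t k)"
      unfolding gpart_mult[OF deg_add] by (rule sum.remove) auto
    then have "q (gpart deg ?d (f * g)) = q (?t i)" using ms_add_eq(1)[OF q rest] by simp
    then show ?thesis using gauss_ge[of ?d "f * g"] top by simp
  qed
qed

lemma mult_seminorm_gauss: "mult_seminorm (gauss deg q c)"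
  unfolding mult_seminorm_def
proof (intro conjI allI)
  fix f g
  show "0 \<le> gauss deg q c f" by (rule gauss_nonneg)
  show "gauss deg q c (f * g) = gauss deg q c f * gauss deg q c g" by (rule gauss_mult)
  show "gauss deg q c (f + g) \<le> max (gauss deg q c f) (gauss deg q c g)"
  proof (rule gauss_le)
    fix d
    have "q (gpart deg d (f + g)) \<le> max (q (gpart deg d f)) (q (gpart deg d g))"
      unfolding gpart_add by (rule ms_add[OF q])
    then have "c ^ d * q (gpart deg d (f + g)) \<le> c ^ d * max (q (gpart deg d f)) (q (gpart deg d g))"
      using c by simp
    also have "\<dots> = max (c ^ d * q (gpart deg d f)) (c ^ d * q (gpart deg d g))"
      using c by (simp add: max_mult_distrib_left)
    also have "\<dots> \<le> max (gauss deg q c f) (gauss deg q c g)"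
      using gauss_ge by (intro max.mono)
    finally show "c ^ d * q (gpart deg d (f + g)) \<le> max (gauss deg q c f) (gauss deg q c g)" .
  qed
next
  fix x
  have "deg 0 = 0" using deg_add[of 0 0] by simp
  then have "gpart deg 0 (const x) = const x" unfolding const_def by (simp add: gpart_single)
  from gauss_homog[OF this] show "gauss deg q c (const x) = nov_norm x" by (simp add: ms_const[OF q])
qed

end


section \<open>Completed residue fields\<close>

definition frac_neg :: "'m::comm_monoid_add nov_frac \<Rightarrow> 'm nov_frac"
  where "frac_neg a = (- fst a, snd a)"

text \<open>Keeps termwise operations on Cauchy sequences inside the admissible fractions. Fractions
  of forms of equal degree qualify because cross-multiplication adds the degrees in numerator and
  denominator alike.\<close>

definition frac_closed :: "'m::comm_monoid_add nov_frac set \<Rightarrow> bool"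
  where "frac_closed Q \<longleftrightarrow> (0, 1) \<in> Q \<and> (1, 1) \<in> Q \<and> (\<forall>a\<in>Q. frac_neg a \<in> Q) \<and>
    (\<forall>a\<in>Q. \<forall>b\<in>Q. frac_add a b \<in> Q \<and> frac_mult a b \<in> Q)"

lemma frac_closed_UNIV: "frac_closed UNIV"
  by (simp add: frac_closed_def)

lemma frac_dist_eq_norm: "frac_dist p a b = frac_norm p (frac_add a (frac_neg b))"
  by (simp add: frac_dist_def frac_norm_def frac_add_def frac_neg_def)

abbreviation residue_dist :: "'m::comm_monoid_add nov_frac set \<Rightarrow> 'm berk_pt \<Rightarrow> (nat \<Rightarrow> 'm nov_frac) set \<Rightarrow> 'm nov_frac \<Rightarrow> real"
  where "residue_dist Q p A a \<equiv> residue_norm p (A \<ominus>\<^bsub>residue_field Q p\<^esub> residue_frac Q p a)"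

lemma tendsto_0_squeeze:
  fixes f g :: "nat \<Rightarrow> real"
  assumes "g \<longlonglongrightarrow> 0" "\<And>n. 0 \<le> f n" "\<And>n. f n \<le> g n"
  shows "f \<longlonglongrightarrow> 0"
  by (rule tendsto_sandwich[OF _ _ tendsto_const assms(1)]) (simp_all add: assms(2,3))

section \<open>Ultrametric estimates for fractions\<close>

context
  fixes p :: "'m::comm_monoid_add berk_pt"
  assumes p: "mult_seminorm p"
begin

lemma frac_norm_nonneg: "0 \<le> frac_norm p a"
  using ms_nonneg[OF p] by (simp add: frac_norm_def)

lemma frac_dist_nonneg: "0 \<le> frac_dist p a b"
  by (simp add: frac_dist_eq_norm frac_norm_nonneg)

lemma frac_dist_self: "frac_dist p a a = 0"
  by (simp add: frac_dist_def frac_norm_def ms_0[OF p])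

lemma frac_dist_commute: "frac_dist p a b = frac_dist p b a"
  using ms_uminus[OF p, of "fst a * snd b - fst b * snd a"]
  by (simp add: frac_dist_def frac_norm_def mult.commute)

lemma frac_dist_eq_0: "fst a * snd b = fst b * snd a \<Longrightarrow> frac_dist p a b = 0"
  by (simp add: frac_dist_def frac_norm_def ms_0[OF p])

lemma frac_dist_triangle:
  assumes "p (snd b) \<noteq> 0"
  shows "frac_dist p a c \<le> max (frac_dist p a b) (frac_dist p b c)"
proof (cases "p (snd a) = 0 \<or> p (snd c) = 0")
  case True
  \<comment> \<open>Division by 0 yields 0, so a vanishing outer denominator makes the left side
    0.\<close>
  then have "frac_dist p a c = 0" by (auto simp: frac_dist_def frac_norm_def ms_mult[OF p])
  then show ?thesis using frac_dist_nonneg by (simp add: le_max_iff_disj)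
next
  case False
  let ?a = "p (snd a)" and ?b = "p (snd b)" and ?c = "p (snd c)"
  let ?x = "fst a * snd b - fst b * snd a" and ?y = "fst b * snd c - fst c * snd b"
  let ?z = "fst a * snd c - fst c * snd a"
  have pos: "?a > 0" "?b > 0" "?c > 0"
    using False assms ms_nonneg[OF p] by (auto simp: less_le)
  have "snd b * ?z = snd c * ?x + snd a * ?y" by (simp add: algebra_simps)
  then have "?b * p ?z \<le> max (?c * p ?x) (?a * p ?y)"
    using ms_add[OF p, of "snd c * ?x" "snd a * ?y"] by (metis ms_mult[OF p])
  then have "?b * p ?z / (?a * ?b * ?c) \<le> max (?c * p ?x) (?a * p ?y) / (?a * ?b * ?c)"
    using pos by (intro divide_right_mono) auto
  also have "\<dots> = max (?c * p ?x / (?a * ?b * ?c)) (?a * p ?y / (?a * ?b * ?c))"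
    using pos by (simp add: max_divide_distrib_right)
  finally show ?thesis
    using pos by (simp add: frac_dist_def frac_norm_def ms_mult[OF p] field_simps)
qed

lemma frac_dist_add:
  assumes "p (snd a) \<noteq> 0" "p (snd b) \<noteq> 0" "p (snd a') \<noteq> 0" "p (snd b') \<noteq> 0"
  shows "frac_dist p (frac_add a b) (frac_add a' b') \<le> max (frac_dist p a a') (frac_dist p b b')"
proof -
  let ?a = "p (snd a)" and ?b = "p (snd b)" and ?a' = "p (snd a')" and ?b' = "p (snd b')"
  let ?x = "fst a * snd a' - fst a' * snd a" and ?y = "fst b * snd b' - fst b' * snd b"
  let ?z = "(fst a * snd b + fst b * snd a) * (snd a' * snd b') - (fst a' * snd b' + fst b' * snd a') * (snd a * snd b)"
  let ?D = "?a * ?b * (?a' * ?b')"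
  have pos: "?a > 0" "?b > 0" "?a' > 0" "?b' > 0"
    using assms ms_nonneg[OF p] by (auto simp: less_le)
  have "?z = (snd b * snd b') * ?x + (snd a * snd a') * ?y" by (simp add: algebra_simps)
  then have "p ?z \<le> max (?b * ?b' * p ?x) (?a * ?a' * p ?y)"
    using ms_add[OF p, of "(snd b * snd b') * ?x" "(snd a * snd a') * ?y"] by (metis ms_mult[OF p])
  then have "p ?z / ?D \<le> max (?b * ?b' * p ?x) (?a * ?a' * p ?y) / ?D"
    using pos by (intro divide_right_mono) auto
  also have "\<dots> = max (?b * ?b' * p ?x / ?D) (?a * ?a' * p ?y / ?D)"
    using pos by (simp add: max_divide_distrib_right)
  finally show ?thesis
    using pos by (simp add: frac_dist_def frac_norm_def frac_add_def ms_mult[OF p] field_simps)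
qed

text \<open>This is \<open>a b - a' b' = (a - a') b + a' (b - b')\<close> with denominators cleared,
  followed by the ultrametric inequality.\<close>

lemma frac_dist_mult:
  assumes "p (snd a) \<noteq> 0" "p (snd b) \<noteq> 0" "p (snd a') \<noteq> 0" "p (snd b') \<noteq> 0"
  shows "frac_dist p (frac_mult a b) (frac_mult a' b') \<le>
    max (frac_dist p a a' * frac_norm p b) (frac_norm p a' * frac_dist p b b')"
proof -
  let ?a = "p (snd a)" and ?b = "p (snd b)" and ?a' = "p (snd a')" and ?b' = "p (snd b')"
  let ?x = "fst a * snd a' - fst a' * snd a" and ?y = "fst b * snd b' - fst b' * snd b"
  let ?z = "(fst a * fst b) * (snd a' * snd b') - (fst a' * fst b') * (snd a * snd b)"
  let ?D = "?a * ?b * (?a' * ?b')"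
  have pos: "?a > 0" "?b > 0" "?a' > 0" "?b' > 0"
    using assms ms_nonneg[OF p] by (auto simp: less_le)
  have "?z = (fst b * snd b') * ?x + (fst a' * snd a) * ?y" by (simp add: algebra_simps)
  then have "p ?z \<le> max (p (fst b) * ?b' * p ?x) (p (fst a') * ?a * p ?y)"
    using ms_add[OF p, of "(fst b * snd b') * ?x" "(fst a' * snd a) * ?y"] by (metis ms_mult[OF p])
  then have "p ?z / ?D \<le> max (p (fst b) * ?b' * p ?x) (p (fst a') * ?a * p ?y) / ?D"
    using pos by (intro divide_right_mono) auto
  also have "\<dots> = max (p (fst b) * ?b' * p ?x / ?D) (p (fst a') * ?a * p ?y / ?D)"
    using pos by (simp add: max_divide_distrib_right)
  finally show ?thesis
    using pos by (simp add: frac_dist_def frac_norm_def frac_mult_def ms_mult[OF p] field_simps)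
qed

lemma frac_norm_le_dist:
  assumes "p (snd a) \<noteq> 0" "p (snd b) \<noteq> 0"
  shows "frac_norm p a \<le> max (frac_norm p b) (frac_dist p a b)"
proof -
  have "frac_dist p a (0, 1) \<le> max (frac_dist p a b) (frac_dist p b (0, 1))"
    by (rule frac_dist_triangle) (rule assms)
  then show ?thesis by (simp add: frac_dist_def frac_norm_def max.commute)
qed

lemma frac_norm_diff_le_dist:
  assumes "p (snd a) \<noteq> 0" "p (snd b) \<noteq> 0"
  shows "\<bar>frac_norm p a - frac_norm p b\<bar> \<le> frac_dist p a b"
  using frac_norm_le_dist[of a b] frac_norm_le_dist[of b a] assms frac_dist_commute[of a b]
    frac_norm_nonneg[of a] frac_norm_nonneg[of b] frac_dist_nonneg[of a b] by linarith

end

section \<open>Cauchy sequences of fractions and the operations on their classes\<close>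

context
  fixes p :: "'m::comm_monoid_add berk_pt" and Q :: "'m nov_frac set"
  assumes p: "mult_seminorm p" and Q: "frac_closed Q"
begin

abbreviation (input) "cls s \<equiv> frac_equiv Q p `` {s}"

lemma frac_cauchyD: "s \<in> frac_cauchy Q p \<Longrightarrow> s n \<in> Q" "s \<in> frac_cauchy Q p \<Longrightarrow> p (snd (s n)) \<noteq> 0"
  by (auto simp: frac_cauchy_def)

lemma frac_cauchy_const:
  assumes "a \<in> Q" "p (snd a) \<noteq> 0"
  shows "(\<lambda>_. a) \<in> frac_cauchy Q p"
  using assms by (simp add: frac_cauchy_def frac_dist_self[OF p])

lemma frac_cauchy_norm_convergent:
  assumes s: "s \<in> frac_cauchy Q p"
  shows "convergent (\<lambda>n. frac_norm p (s n))"
proof -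
  have "Cauchy (\<lambda>n. frac_norm p (s n))"
  proof (rule CauchyI)
    fix e :: real assume "e > 0"
    then obtain N where N: "\<forall>m\<ge>N. \<forall>n\<ge>N. frac_dist p (s m) (s n) < e"
      using s by (auto simp: frac_cauchy_def)
    have "norm (frac_norm p (s m) - frac_norm p (s n)) < e" if "m \<ge> N" "n \<ge> N" for m n
      using N[rule_format, of m n] that frac_norm_diff_le_dist[OF p frac_cauchyD(2)[OF s] frac_cauchyD(2)[OF s], of m n]
      by simp
    then show "\<exists>M. \<forall>m\<ge>M. \<forall>n\<ge>M. norm (frac_norm p (s m) - frac_norm p (s n)) < e" by blast
  qed
  then show ?thesis by (rule real_Cauchy_convergent)
qed

lemma frac_cauchy_bounded:
  assumes s: "s \<in> frac_cauchy Q p"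
  obtains B where "B > 0" "\<And>n. frac_norm p (s n) \<le> B"
proof -
  have "Bseq (\<lambda>n. frac_norm p (s n))"
    using frac_cauchy_norm_convergent[OF s] by (rule convergent_imp_Bseq)
  then obtain B where "B > 0" "\<And>n. \<bar>frac_norm p (s n)\<bar> \<le> B" unfolding Bseq_def real_norm_def by blast
  then show ?thesis using that[of B] by (meson abs_ge_self order_trans)
qed

lemma frac_cauchy_add:
  assumes s: "s \<in> frac_cauchy Q p" and t: "t \<in> frac_cauchy Q p"
  shows "(\<lambda>n. frac_add (s n) (t n)) \<in> frac_cauchy Q p"
  unfolding frac_cauchy_def
proof (intro CollectI conjI allI impI)
  fix n
  show "frac_add (s n) (t n) \<in> Q"
    using Q frac_cauchyD(1)[OF s] frac_cauchyD(1)[OF t] by (simp add: frac_closed_def)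
  show "p (snd (frac_add (s n) (t n))) \<noteq> 0"
    using frac_cauchyD(2)[OF s] frac_cauchyD(2)[OF t] by (simp add: frac_add_def ms_mult[OF p])
next
  fix e :: real assume "e > 0"
  then obtain N M where N: "\<forall>m\<ge>N. \<forall>n\<ge>N. frac_dist p (s m) (s n) < e"
    and M: "\<forall>m\<ge>M. \<forall>n\<ge>M. frac_dist p (t m) (t n) < e"
    using s t unfolding frac_cauchy_def by blast
  have "frac_dist p (frac_add (s m) (t m)) (frac_add (s n) (t n)) < e"
    if "m \<ge> max N M" "n \<ge> max N M" for m n
    using frac_dist_add[OF p frac_cauchyD(2)[OF s] frac_cauchyD(2)[OF t] frac_cauchyD(2)[OF s] frac_cauchyD(2)[OF t], of m m n n]
      N[rule_format, of m n] M[rule_format, of m n] that by simp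
  then show "\<exists>N. \<forall>m\<ge>N. \<forall>n\<ge>N. frac_dist p (frac_add (s m) (t m)) (frac_add (s n) (t n)) < e"
    by blast
qed

lemma frac_cauchy_mult:
  assumes s: "s \<in> frac_cauchy Q p" and t: "t \<in> frac_cauchy Q p"
  shows "(\<lambda>n. frac_mult (s n) (t n)) \<in> frac_cauchy Q p"
  unfolding frac_cauchy_def
proof (intro CollectI conjI allI impI)
  fix n
  show "frac_mult (s n) (t n) \<in> Q"
    using Q frac_cauchyD(1)[OF s] frac_cauchyD(1)[OF t] by (simp add: frac_closed_def)
  show "p (snd (frac_mult (s n) (t n))) \<noteq> 0"
    using frac_cauchyD(2)[OF s] frac_cauchyD(2)[OF t] by (simp add: frac_mult_def ms_mult[OF p])
next
  fix e :: real assume e: "e > 0"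
  obtain B where B: "B > 0" "\<And>n. frac_norm p (s n) \<le> B" using frac_cauchy_bounded[OF s] by blast
  obtain C where C: "C > 0" "\<And>n. frac_norm p (t n) \<le> C" using frac_cauchy_bounded[OF t] by blast
  have "e / C > 0" "e / B > 0" using e B C by auto
  then obtain N M where N: "\<forall>m\<ge>N. \<forall>n\<ge>N. frac_dist p (s m) (s n) < e / C"
    and M: "\<forall>m\<ge>M. \<forall>n\<ge>M. frac_dist p (t m) (t n) < e / B"
    using s t unfolding frac_cauchy_def by blast
  have "frac_dist p (frac_mult (s m) (t m)) (frac_mult (s n) (t n)) < e"
    if mn: "m \<ge> max N M" "n \<ge> max N M" for m n
  proof -
    have "frac_dist p (s m) (s n) * frac_norm p (t m) \<le> frac_dist p (s m) (s n) * C"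
      using C frac_dist_nonneg[OF p] by (intro mult_left_mono) auto
    also have "\<dots> < e" using N mn C by (simp add: pos_less_divide_eq)
    finally have 1: "frac_dist p (s m) (s n) * frac_norm p (t m) < e" .
    have "frac_norm p (s n) * frac_dist p (t m) (t n) \<le> B * frac_dist p (t m) (t n)"
      using B frac_dist_nonneg[OF p] by (intro mult_right_mono) auto
    also have "\<dots> < e" using M mn B by (simp add: pos_less_divide_eq mult.commute)
    finally have 2: "frac_norm p (s n) * frac_dist p (t m) (t n) < e" .
    show ?thesis
      using frac_dist_mult[OF p frac_cauchyD(2)[OF s] frac_cauchyD(2)[OF t] frac_cauchyD(2)[OF s] frac_cauchyD(2)[OF t], of m m n n] 1 2
      by linarith
  qed
  then show "\<exists>N. \<forall>m\<ge>N. \<forall>n\<ge>N. frac_dist p (frac_mult (s m) (t m)) (frac_mult (s n) (t n)) < e"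
    by blast
qed

lemma frac_cauchy_neg:
  assumes s: "s \<in> frac_cauchy Q p"
  shows "(\<lambda>n. frac_neg (s n)) \<in> frac_cauchy Q p"
proof -
  have "frac_dist p (frac_neg a) (frac_neg b) = frac_dist p a b" for a b
    using ms_uminus[OF p, of "fst a * snd b - fst b * snd a"]
    by (simp add: frac_dist_def frac_norm_def frac_neg_def)
  then show ?thesis using s Q by (simp add: frac_cauchy_def frac_closed_def) (simp add: frac_neg_def)
qed

lemma equiv_frac_equiv: "equiv (frac_cauchy Q p) (frac_equiv Q p)"
proof (rule equivI)
  show "frac_equiv Q p \<subseteq> frac_cauchy Q p \<times> frac_cauchy Q p"
    unfolding frac_equiv_def by blast
  show "refl_on (frac_cauchy Q p) (frac_equiv Q p)"
    by (rule refl_onI) (simp add: frac_equiv_def frac_dist_self[OF p])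
  show "sym (frac_equiv Q p)"
  proof (rule symI)
    fix s t assume "(s, t) \<in> frac_equiv Q p"
    moreover have "(\<lambda>n. frac_dist p (t n) (s n)) = (\<lambda>n. frac_dist p (s n) (t n))"
      by (intro ext frac_dist_commute[OF p])
    ultimately show "(t, s) \<in> frac_equiv Q p" by (simp add: frac_equiv_def)
  qed
  show "trans (frac_equiv Q p)"
  proof (rule transI)
    fix s t u assume "(s, t) \<in> frac_equiv Q p" "(t, u) \<in> frac_equiv Q p"
    then have *: "s \<in> frac_cauchy Q p" "t \<in> frac_cauchy Q p" "u \<in> frac_cauchy Q p"
      "(\<lambda>n. frac_dist p (s n) (t n)) \<longlonglongrightarrow> 0" "(\<lambda>n. frac_dist p (t n) (u n)) \<longlonglongrightarrow> 0"
      by (auto simp: frac_equiv_def)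
    have "(\<lambda>n. frac_dist p (s n) (u n)) \<longlonglongrightarrow> 0"
    proof (rule tendsto_0_squeeze)
      show "(\<lambda>n. max (frac_dist p (s n) (t n)) (frac_dist p (t n) (u n))) \<longlonglongrightarrow> 0"
        using tendsto_max[OF *(4,5)] by simp
    qed (rule frac_dist_nonneg[OF p], rule frac_dist_triangle[OF p frac_cauchyD(2)[OF *(2)]])
    then show "(s, u) \<in> frac_equiv Q p" using * by (auto simp: frac_equiv_def)
  qed
qed

lemma cls_eq_iff:
  "s \<in> frac_cauchy Q p \<Longrightarrow> t \<in> frac_cauchy Q p \<Longrightarrow>
    cls s = cls t \<longleftrightarrow> (\<lambda>n. frac_dist p (s n) (t n)) \<longlonglongrightarrow> 0"
  by (subst eq_equiv_class_iff[OF equiv_frac_equiv]) (simp_all add: frac_equiv_def)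

lemma cls_eqI:
  assumes "s \<in> frac_cauchy Q p" "t \<in> frac_cauchy Q p"
    "\<And>n. fst (s n) * snd (t n) = fst (t n) * snd (s n)"
  shows "cls s = cls t"
  using assms frac_dist_eq_0[OF p] by (simp add: cls_eq_iff)

lemma cls_self: "s \<in> frac_cauchy Q p \<Longrightarrow> s \<in> cls s"
  using equiv_class_self[OF equiv_frac_equiv] .

lemma cls_memD:
  assumes "t \<in> cls s"
  shows "s \<in> frac_cauchy Q p" "t \<in> frac_cauchy Q p" "(\<lambda>n. frac_dist p (s n) (t n)) \<longlonglongrightarrow> 0"
  using assms by (auto simp: frac_equiv_def)

lemma cls_in_carrier [simp]: "s \<in> frac_cauchy Q p \<Longrightarrow> cls s \<in> carrier (residue_field Q p)"
  by (simp add: residue_field_def quotientI)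

lemma residue_field_carrierE:
  assumes "x \<in> carrier (residue_field Q p)"
  obtains s where "s \<in> frac_cauchy Q p" "x = cls s"
  using assms that unfolding residue_field_def by (auto elim!: quotientE simp del: Image_singleton)

text \<open>The double union in the definition collapses: addition does not increase distances, so
  every choice of representatives gives the same class.\<close>

lemma residue_add:
  assumes s: "s \<in> frac_cauchy Q p" and t: "t \<in> frac_cauchy Q p"
  shows "cls s \<oplus>\<^bsub>residue_field Q p\<^esub> cls t = cls (\<lambda>n. frac_add (s n) (t n))"
proof -
  have "cls (\<lambda>n. frac_add (s' n) (t' n)) = cls (\<lambda>n. frac_add (s n) (t n))"
    if s': "s' \<in> cls s" and t': "t' \<in> cls t" for s' t'
  proof -
    note S = cls_memD[OF s'] and T = cls_memD[OF t']
    have "(\<lambda>n. frac_dist p (frac_add (s n) (t n)) (frac_add (s' n) (t' n))) \<longlonglongrightarrow> 0"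
    proof (rule tendsto_0_squeeze)
      show "(\<lambda>n. max (frac_dist p (s n) (s' n)) (frac_dist p (t n) (t' n))) \<longlonglongrightarrow> 0"
        using tendsto_max[OF S(3) T(3)] by simp
    qed (rule frac_dist_nonneg[OF p],
         rule frac_dist_add[OF p frac_cauchyD(2)[OF S(1)] frac_cauchyD(2)[OF T(1)] frac_cauchyD(2)[OF S(2)] frac_cauchyD(2)[OF T(2)]])
    then show ?thesis using S T by (simp add: cls_eq_iff frac_cauchy_add frac_dist_commute[OF p])
  qed
  then have "(\<Union>t'\<in>cls t. cls (\<lambda>n. frac_add (s' n) (t' n))) = cls (\<lambda>n. frac_add (s n) (t n))"
    if "s' \<in> cls s" for s'
    using that by (intro UN_constant_eq[OF cls_self[OF t]]) blast
  then have "(\<Union>s'\<in>cls s. \<Union>t'\<in>cls t. cls (\<lambda>n. frac_add (s' n) (t' n))) = cls (\<lambda>n. frac_add (s n) (t n))"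
    by (intro UN_constant_eq[OF cls_self[OF s]]) blast
  then show ?thesis by (simp add: residue_field_def)
qed

text \<open>As for sums, but multiplication is Lipschitz only on bounded sets, so bounds on the
  norms along the two Cauchy sequences enter.\<close>

lemma residue_mult:
  assumes s: "s \<in> frac_cauchy Q p" and t: "t \<in> frac_cauchy Q p"
  shows "cls s \<otimes>\<^bsub>residue_field Q p\<^esub> cls t = cls (\<lambda>n. frac_mult (s n) (t n))"
proof -
  have "cls (\<lambda>n. frac_mult (s' n) (t' n)) = cls (\<lambda>n. frac_mult (s n) (t n))"
    if s': "s' \<in> cls s" and t': "t' \<in> cls t" for s' t'
  proof -
    note S = cls_memD[OF s'] and T = cls_memD[OF t']
    obtain B where B: "B > 0" "\<And>n. frac_norm p (s' n) \<le> B" using frac_cauchy_bounded[OF S(2)] by blast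
    obtain C where C: "C > 0" "\<And>n. frac_norm p (t n) \<le> C" using frac_cauchy_bounded[OF T(1)] by blast
    let ?m = "\<lambda>n. max (frac_dist p (s n) (s' n) * C) (B * frac_dist p (t n) (t' n))"
    have "?m \<longlonglongrightarrow> max (0 * C) (B * 0)" by (intro tendsto_max tendsto_mult S T tendsto_const)
    then have lim: "?m \<longlonglongrightarrow> 0" by simp
    have "frac_dist p (frac_mult (s n) (t n)) (frac_mult (s' n) (t' n)) \<le> ?m n" for n
    proof -
      have "frac_dist p (s n) (s' n) * frac_norm p (t n) \<le> frac_dist p (s n) (s' n) * C"
        using C frac_dist_nonneg[OF p] by (intro mult_left_mono) auto
      moreover have "frac_norm p (s' n) * frac_dist p (t n) (t' n) \<le> B * frac_dist p (t n) (t' n)"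
        using B frac_dist_nonneg[OF p] by (intro mult_right_mono) auto
      ultimately show ?thesis
        using frac_dist_mult[OF p frac_cauchyD(2)[OF S(1)] frac_cauchyD(2)[OF T(1)] frac_cauchyD(2)[OF S(2)] frac_cauchyD(2)[OF T(2)], of n n n n]
        by linarith
    qed
    then have "(\<lambda>n. frac_dist p (frac_mult (s n) (t n)) (frac_mult (s' n) (t' n))) \<longlonglongrightarrow> 0"
      by (intro tendsto_0_squeeze[OF lim] frac_dist_nonneg[OF p])
    then show ?thesis using S T by (simp add: cls_eq_iff frac_cauchy_mult frac_dist_commute[OF p])
  qed
  then have "(\<Union>t'\<in>cls t. cls (\<lambda>n. frac_mult (s' n) (t' n))) = cls (\<lambda>n. frac_mult (s n) (t n))"
    if "s' \<in> cls s" for s'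
    using that by (intro UN_constant_eq[OF cls_self[OF t]]) blast
  then have "(\<Union>s'\<in>cls s. \<Union>t'\<in>cls t. cls (\<lambda>n. frac_mult (s' n) (t' n))) = cls (\<lambda>n. frac_mult (s n) (t n))"
    by (intro UN_constant_eq[OF cls_self[OF s]]) blast
  then show ?thesis by (simp add: residue_field_def)
qed

lemma frac_cauchy_0: "(\<lambda>_. (0, 1)) \<in> frac_cauchy Q p"
  and frac_cauchy_1: "(\<lambda>_. (1, 1)) \<in> frac_cauchy Q p"
  using Q by (auto intro!: frac_cauchy_const simp: frac_closed_def ms_1[OF p])

lemma residue_zero: "\<zero>\<^bsub>residue_field Q p\<^esub> = cls (\<lambda>_. (0, 1))"
  and residue_one: "\<one>\<^bsub>residue_field Q p\<^esub> = cls (\<lambda>_. (1, 1))"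
  by (simp_all add: residue_field_def)

lemma abelian_group_residue_field: "abelian_group (residue_field Q p)"
proof (rule abelian_groupI)
  let ?R = "residue_field Q p"
  show "\<zero>\<^bsub>?R\<^esub> \<in> carrier ?R" by (simp add: residue_zero frac_cauchy_0)
  fix x y z assume "x \<in> carrier ?R" "y \<in> carrier ?R"
  then obtain s t where s: "s \<in> frac_cauchy Q p" "x = cls s" and t: "t \<in> frac_cauchy Q p" "y = cls t"
    by (metis residue_field_carrierE)
  show "x \<oplus>\<^bsub>?R\<^esub> y \<in> carrier ?R" by (simp add: s t residue_add frac_cauchy_add)
  show "x \<oplus>\<^bsub>?R\<^esub> y = y \<oplus>\<^bsub>?R\<^esub> x"
    unfolding s(2) t(2) residue_add[OF s(1) t(1)] residue_add[OF t(1) s(1)]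
    by (intro cls_eqI frac_cauchy_add s(1) t(1)) (simp add: frac_add_def algebra_simps)
  show "\<zero>\<^bsub>?R\<^esub> \<oplus>\<^bsub>?R\<^esub> x = x"
    unfolding s(2) residue_zero residue_add[OF frac_cauchy_0 s(1)]
    by (intro cls_eqI frac_cauchy_add frac_cauchy_0 s(1)) (simp add: frac_add_def algebra_simps)
  show "\<exists>y\<in>carrier ?R. y \<oplus>\<^bsub>?R\<^esub> x = \<zero>\<^bsub>?R\<^esub>"
  proof (rule bexI[of _ "cls (\<lambda>n. frac_neg (s n))"])
    show "cls (\<lambda>n. frac_neg (s n)) \<oplus>\<^bsub>?R\<^esub> x = \<zero>\<^bsub>?R\<^esub>"
      unfolding s(2) residue_zero residue_add[OF frac_cauchy_neg[OF s(1)] s(1)]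
      by (intro cls_eqI frac_cauchy_add frac_cauchy_0 frac_cauchy_neg s(1)) (simp add: frac_add_def frac_neg_def algebra_simps)
    show "cls (\<lambda>n. frac_neg (s n)) \<in> carrier ?R" by (simp add: s frac_cauchy_neg)
  qed
  assume "z \<in> carrier ?R"
  then obtain u where u: "u \<in> frac_cauchy Q p" "z = cls u" by (metis residue_field_carrierE)
  show "x \<oplus>\<^bsub>?R\<^esub> y \<oplus>\<^bsub>?R\<^esub> z = x \<oplus>\<^bsub>?R\<^esub> (y \<oplus>\<^bsub>?R\<^esub> z)"
    unfolding s(2) t(2) u(2) residue_add[OF s(1) t(1)] residue_add[OF t(1) u(1)]
      residue_add[OF frac_cauchy_add[OF s(1) t(1)] u(1)] residue_add[OF s(1) frac_cauchy_add[OF t(1) u(1)]]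
    by (intro cls_eqI frac_cauchy_add s(1) t(1) u(1)) (simp add: frac_add_def algebra_simps)
qed

lemma residue_diff:
  assumes s: "s \<in> frac_cauchy Q p" and t: "t \<in> frac_cauchy Q p"
  shows "cls s \<ominus>\<^bsub>residue_field Q p\<^esub> cls t = cls (\<lambda>n. frac_add (s n) (frac_neg (t n)))"
proof -
  have "cls (\<lambda>n. frac_neg (t n)) \<oplus>\<^bsub>residue_field Q p\<^esub> cls t = \<zero>\<^bsub>residue_field Q p\<^esub>"
    unfolding residue_zero residue_add[OF frac_cauchy_neg[OF t(1)] t(1)]
    by (intro cls_eqI frac_cauchy_add frac_cauchy_0 frac_cauchy_neg t) (simp add: frac_add_def frac_neg_def algebra_simps)
  then have "\<ominus>\<^bsub>residue_field Q p\<^esub> cls t = cls (\<lambda>n. frac_neg (t n))"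
    by (intro abelian_group.minus_equality[OF abelian_group_residue_field])
       (simp_all add: t frac_cauchy_neg)
  then show ?thesis by (simp add: a_minus_def residue_add s frac_cauchy_neg t)
qed

text \<open>Justifies the description operator in \<open>residue_norm\<close>: the norm is
  1-Lipschitz for \<open>frac_dist\<close>, so equivalent sequences have norms with a common
  limit.\<close>

lemma residue_norm_lim:
  assumes s: "s \<in> frac_cauchy Q p"
  shows "(\<lambda>n. frac_norm p (s n)) \<longlonglongrightarrow> residue_norm p (cls s)"
proof -
  obtain r where r: "(\<lambda>n. frac_norm p (s n)) \<longlonglongrightarrow> r"
    using frac_cauchy_norm_convergent[OF s] by (auto simp: convergent_def)
  have "\<forall>t\<in>cls s. (\<lambda>n. frac_norm p (t n)) \<longlonglongrightarrow> r"
  proof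
    fix t assume t: "t \<in> cls s"
    note T = cls_memD[OF t]
    have "(\<lambda>n. frac_norm p (t n) - frac_norm p (s n)) \<longlonglongrightarrow> 0"
      by (rule Lim_null_comparison[OF _ T(3)])
         (use frac_norm_diff_le_dist[OF p frac_cauchyD(2)[OF T(1)] frac_cauchyD(2)[OF T(2)]]
          in \<open>auto simp: abs_minus_commute\<close>)
    from tendsto_add[OF this r] show "(\<lambda>n. frac_norm p (t n)) \<longlonglongrightarrow> r" by simp
  qed
  then have "residue_norm p (cls s) = r"
    unfolding residue_norm_def using cls_self[OF s] LIMSEQ_unique r by (intro the_equality) blast+
  then show ?thesis using r by simp
qed

lemma residue_norm_eqI:
  "s \<in> frac_cauchy Q p \<Longrightarrow> (\<lambda>n. frac_norm p (s n)) \<longlonglongrightarrow> r \<Longrightarrow> residue_norm p (cls s) = r"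
  using residue_norm_lim LIMSEQ_unique by blast

lemma residue_norm_frac: "a \<in> Q \<Longrightarrow> p (snd a) \<noteq> 0 \<Longrightarrow> residue_norm p (residue_frac Q p a) = frac_norm p a"
  unfolding residue_frac_def by (intro residue_norm_eqI frac_cauchy_const) auto

lemma residue_frac_in_carrier:
  "a \<in> Q \<Longrightarrow> p (snd a) \<noteq> 0 \<Longrightarrow> residue_frac Q p a \<in> carrier (residue_field Q p)"
  unfolding residue_frac_def by (intro cls_in_carrier frac_cauchy_const)

lemma residue_dist_lim:
  assumes s: "s \<in> frac_cauchy Q p" and a: "a \<in> Q" "p (snd a) \<noteq> 0"
  shows "(\<lambda>n. frac_dist p (s n) a) \<longlonglongrightarrow> residue_dist Q p (cls s) a"
  unfolding residue_frac_def residue_diff[OF s frac_cauchy_const[OF a]]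
  using residue_norm_lim[OF frac_cauchy_add[OF s frac_cauchy_neg[OF frac_cauchy_const[OF a]]]]
  by (simp add: frac_dist_eq_norm)

text \<open>In an ultrametric field an approximation whose error is below the norm of
  \<open>g\<close> has exactly the norm of \<open>g\<close>. This replaces an analytic function by a
  single fraction when only norms matter.\<close>

lemma residue_norm_approx:
  assumes g: "g \<in> carrier (residue_field Q p)" and a: "a \<in> Q" "p (snd a) \<noteq> 0"
    and less: "residue_dist Q p g a < residue_norm p g"
  shows "frac_norm p a = residue_norm p g"
proof -
  obtain s where s: "s \<in> frac_cauchy Q p" "g = cls s" using residue_field_carrierE[OF g] by blast
  note lim = residue_dist_lim[OF s(1) a] residue_norm_lim[OF s(1)]
  have "eventually (\<lambda>n. frac_dist p (s n) a < frac_norm p (s n)) sequentially"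
  proof -
    obtain e where "residue_dist Q p g a < e" "e < residue_norm p g"
      using less dense by blast
    then have "eventually (\<lambda>n. frac_dist p (s n) a < e) sequentially"
      "eventually (\<lambda>n. e < frac_norm p (s n)) sequentially"
      using order_tendstoD(2)[OF lim(1)] order_tendstoD(1)[OF lim(2)] s(2) by auto
    then show ?thesis by eventually_elim simp
  qed
  then have "eventually (\<lambda>n. frac_norm p (s n) = frac_norm p a) sequentially"
  proof eventually_elim
    case (elim n)
    then show ?case
      using frac_norm_le_dist[OF p frac_cauchyD(2)[OF s(1)] a(2), of n]
        frac_norm_le_dist[OF p a(2) frac_cauchyD(2)[OF s(1)], of n] frac_dist_commute[OF p, of "s n" a]
      by linarith
  qed
  then have "(\<lambda>n. frac_norm p (s n)) \<longlonglongrightarrow> frac_norm p a" by (rule tendsto_eventually)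
  then show ?thesis using residue_norm_eqI s by metis
qed

end


section \<open>Analytic isomorphisms from homomorphisms of coordinate rings\<close>

text \<open>Uniform approximation by fractions passes through a continuous map as soon as every
  fraction on the target has a counterpart with the same error at corresponding points. The two
  directions of the comparison of sheaves are both instances.\<close>

lemma analytic_fun_pullback:
  assumes an: "analytic_fun R U f" and cont: "continuous_on V \<phi>" and \<phi>: "\<phi> ` V \<subseteq> U"
    and g: "\<And>x. x \<in> V \<Longrightarrow> g x \<in> carrier (residue_field Q x)"
    and transfer: "\<And>r. r \<in> R \<Longrightarrow> \<exists>a\<in>Q. \<forall>x\<in>V. \<phi> x (snd r) \<noteq> 0 \<longrightarrow>
      x (snd a) \<noteq> 0 \<and> residue_dist Q x (g x) a = residue_dist R (\<phi> x) (f (\<phi> x)) r"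
  shows "analytic_fun Q V g"
  unfolding analytic_fun_def
proof (intro conjI ballI g)
  fix x assume x: "x \<in> V"
  obtain N where N: "openin (top_of_set U) N" "\<phi> x \<in> N"
    "\<forall>e>0. \<exists>r\<in>R. \<forall>y\<in>N. y (snd r) \<noteq> 0 \<and> residue_dist R y (f y) r < e"
    using an x \<phi> unfolding analytic_fun_def by blast
  obtain S where S: "open S" "N = U \<inter> S" using N(1) by (auto simp: openin_open)
  show "\<exists>N. openin (top_of_set V) N \<and> x \<in> N \<and>
      (\<forall>e>0. \<exists>a\<in>Q. \<forall>y\<in>N. y (snd a) \<noteq> 0 \<and> residue_dist Q y (g y) a < e)"
  proof (intro exI[of _ "V \<inter> \<phi> -` S"] conjI allI impI)
    show "openin (top_of_set V) (V \<inter> \<phi> -` S)" by (rule continuous_openin_preimage_gen[OF cont S(1)])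
    show "x \<in> V \<inter> \<phi> -` S" using x N(2) S(2) by simp
    fix e :: real assume "e > 0"
    then obtain r where r: "r \<in> R" "\<And>y. y \<in> N \<Longrightarrow> y (snd r) \<noteq> 0 \<and> residue_dist R y (f y) r < e"
      using N(3) by blast
    obtain a where a: "a \<in> Q" "\<And>x. x \<in> V \<Longrightarrow> \<phi> x (snd r) \<noteq> 0 \<Longrightarrow>
        x (snd a) \<noteq> 0 \<and> residue_dist Q x (g x) a = residue_dist R (\<phi> x) (f (\<phi> x)) r"
      using transfer[OF r(1)] by blast
    have "y (snd a) \<noteq> 0 \<and> residue_dist Q y (g y) a < e" if y: "y \<in> V \<inter> \<phi> -` S" for y
      using a(2)[of y] r(2)[of "\<phi> y"] y \<phi> S(2) by auto
    then show "\<exists>a\<in>Q. \<forall>y\<in>V \<inter> \<phi> -` S. y (snd a) \<noteq> 0 \<and> residue_dist Q y (g y) a < e"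
      using a(1) by blast
  qed
qed

text \<open>\<open>E\<close> is the homomorphism of coordinate rings that induces
  \<open>\<phi>\<close>. It maps fractions at \<open>x\<close> isometrically to fractions at
  \<open>\<phi> x\<close>, and by \<open>lift\<close> every fraction on the target arises so after
  expansion by a factor \<open>u\<close> without zeros. The two completions therefore agree.\<close>

lemma analytic_isoI:
  fixes E :: "'m::comm_monoid_add nov_alg \<Rightarrow> 'k::comm_monoid_add nov_alg"
  assumes Q: "frac_closed Q" and Q_const: "\<And>c. (const c, 1) \<in> Q"
    and W: "\<And>x. x \<in> W \<Longrightarrow> mult_seminorm x" and W': "\<And>y. y \<in> W' \<Longrightarrow> mult_seminorm y"
    and homeo: "homeomorphic_map (top_of_set W) (top_of_set W') \<phi>"
    and E_add: "\<And>f g. E (f + g) = E f + E g" and E_mult: "\<And>f g. E (f * g) = E f * E g"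
    and E_const: "\<And>c. E (const c) = const c"
    and transport: "\<And>x g h. x \<in> W \<Longrightarrow> (g, h) \<in> Q \<Longrightarrow>
      (x h = 0 \<longleftrightarrow> \<phi> x (E h) = 0) \<and> x g / x h = \<phi> x (E g) / \<phi> x (E h)"
    and lift: "\<And>r. \<exists>a\<in>Q. \<exists>u. E (fst a) = u * fst r \<and> E (snd a) = u * snd r \<and> (\<forall>x\<in>W. \<phi> x u \<noteq> 0)"
  shows "analytic_iso Q W UNIV W' \<phi>"
proof -
  define \<beta> where "\<beta> a = (E (fst a), E (snd a))" for a
  \<comment> \<open>Push-forward of sequences by \<open>\<beta>\<close> goes from \<open>x\<close>
    to \<open>\<phi> x\<close>, whereas the comparison of residue fields goes back;
    \<open>\<tau>\<close> is the inverse, given by choosing a preimage sequence.\<close>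
  define \<tau> where "\<tau> x B = frac_equiv Q x ``
    {SOME s. s \<in> frac_cauchy Q x \<and> frac_equiv UNIV (\<phi> x) `` {\<lambda>n. \<beta> (s n)} = B}" for x B
  let ?C = "\<lambda>x s. frac_equiv UNIV (\<phi> x) `` {\<lambda>n. \<beta> (s n)}"
  have E_1: "E 1 = 1" using E_const[of 1] by simp
  have "E 0 = 0" using E_add[of 0 0] by simp
  then have E_neg: "E (- f) = - E f" for f using E_add[of f "- f"] by (simp add: eq_neg_iff_add_eq_0 add.commute)
  have \<phi>W: "\<phi> x \<in> W'" if "x \<in> W" for x
    using homeo that by (metis homeomorphic_imp_surjective_map imageI topspace_euclidean_subtopology)
  note W'\<phi> = W'[OF \<phi>W]
  have \<beta>_add: "\<beta> (frac_add a b) = frac_add (\<beta> a) (\<beta> b)" for a b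
    by (simp add: \<beta>_def frac_add_def E_add E_mult)
  have \<beta>_mult: "\<beta> (frac_mult a b) = frac_mult (\<beta> a) (\<beta> b)" for a b
    by (simp add: \<beta>_def frac_mult_def E_mult)
  have \<beta>_neg: "\<beta> (frac_neg a) = frac_neg (\<beta> a)" for a
    by (simp add: \<beta>_def frac_neg_def E_neg)
  have valid: "\<phi> x (snd (\<beta> a)) \<noteq> 0 \<longleftrightarrow> x (snd a) \<noteq> 0" if "x \<in> W" "a \<in> Q" for x a
    using transport[of x "fst a" "snd a"] that by (simp add: \<beta>_def)
  have norm: "frac_norm (\<phi> x) (\<beta> a) = frac_norm x a" if "x \<in> W" "a \<in> Q" for x a
    using transport[of x "fst a" "snd a"] that by (simp add: \<beta>_def frac_norm_def)
  have dist: "frac_dist (\<phi> x) (\<beta> a) (\<beta> b) = frac_dist x a b" if "x \<in> W" "a \<in> Q" "b \<in> Q" for x a b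
  proof -
    have "frac_add a (frac_neg b) \<in> Q" using that Q by (simp add: frac_closed_def)
    then show ?thesis
      using norm[OF that(1)] by (simp add: frac_dist_eq_norm \<beta>_add[symmetric] \<beta>_neg[symmetric])
  qed
  have cauchy: "(\<lambda>n. \<beta> (s n)) \<in> frac_cauchy UNIV (\<phi> x)" if "x \<in> W" "s \<in> frac_cauchy Q x" for x s
    using that valid[OF that(1)] dist[OF that(1)] by (auto simp: frac_cauchy_def)
  \<comment> \<open>Surjectivity of the push-forward: \<open>lift\<close> replaces each term of a
    Cauchy sequence on the target by an equal fraction coming from \<open>Q\<close>, and the new
    sequence is Cauchy since distances are preserved.\<close>
  have K1: "\<exists>s\<in>frac_cauchy Q x. B = ?C x s"
    if x: "x \<in> W" and B: "B \<in> carrier (residue_field UNIV (\<phi> x))" for x B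
  proof -
    note \<phi>x = W'\<phi>[OF x] and U = frac_closed_UNIV
    obtain r where r: "r \<in> frac_cauchy UNIV (\<phi> x)" "B = frac_equiv UNIV (\<phi> x) `` {r}"
      using residue_field_carrierE[OF \<phi>x U B] by blast
    define s where "s n = (SOME a. a \<in> Q \<and> (\<exists>u. E (fst a) = u * fst (r n) \<and> E (snd a) = u * snd (r n) \<and> (\<forall>x\<in>W. \<phi> x u \<noteq> 0)))" for n
    have s: "s n \<in> Q \<and> (\<exists>u. E (fst (s n)) = u * fst (r n) \<and> E (snd (s n)) = u * snd (r n) \<and> (\<forall>x\<in>W. \<phi> x u \<noteq> 0))" for n
      unfolding s_def by (rule someI_ex) (use lift[of "r n"] in blast)
    have sQ: "s n \<in> Q" for n using s by blast
    have cross: "fst (\<beta> (s n)) * snd (r n) = fst (r n) * snd (\<beta> (s n))" for n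
      using s[of n] by (auto simp: \<beta>_def mult_ac)
    have nz: "x (snd (s n)) \<noteq> 0" for n
    proof -
      obtain u where "E (snd (s n)) = u * snd (r n)" "\<phi> x u \<noteq> 0" using s[of n] x by blast
      then have "\<phi> x (snd (\<beta> (s n))) \<noteq> 0"
        using frac_cauchyD(2)[OF \<phi>x U r(1)] by (simp add: \<beta>_def ms_mult[OF \<phi>x])
      then show ?thesis using valid[OF x sQ] by simp
    qed
    have d0: "frac_dist (\<phi> x) (\<beta> (s n)) (r n) = 0" for n
      by (rule frac_dist_eq_0[OF \<phi>x cross])
    have "frac_dist x (s m) (s n) \<le> frac_dist (\<phi> x) (r m) (r n)" for m n
    proof -
      note rn = frac_cauchyD(2)[OF \<phi>x U r(1)]
      have "frac_dist (\<phi> x) (\<beta> (s m)) (\<beta> (s n)) \<le>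
          max (frac_dist (\<phi> x) (\<beta> (s m)) (r m)) (frac_dist (\<phi> x) (r m) (\<beta> (s n)))"
        by (rule frac_dist_triangle[OF \<phi>x rn])
      moreover have "frac_dist (\<phi> x) (r m) (\<beta> (s n)) \<le>
          max (frac_dist (\<phi> x) (r m) (r n)) (frac_dist (\<phi> x) (r n) (\<beta> (s n)))"
        by (rule frac_dist_triangle[OF \<phi>x rn])
      moreover have "frac_dist (\<phi> x) (r n) (\<beta> (s n)) = 0"
        using d0 frac_dist_commute[OF \<phi>x] by metis
      ultimately show ?thesis
        using d0[of m] frac_dist_nonneg[OF \<phi>x, of "r m" "r n"] dist[OF x sQ sQ, of m n] by simp
    qed
    moreover have "\<exists>N. \<forall>m\<ge>N. \<forall>n\<ge>N. frac_dist (\<phi> x) (r m) (r n) < e" if "e > 0" for e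
      using r(1) that by (simp add: frac_cauchy_def)
    ultimately have "\<exists>N. \<forall>m\<ge>N. \<forall>n\<ge>N. frac_dist x (s m) (s n) < e" if "e > 0" for e
      using that by (meson order.strict_trans1)
    then have "s \<in> frac_cauchy Q x"
      by (simp add: frac_cauchy_def sQ nz)
    moreover from this have "?C x s = frac_equiv UNIV (\<phi> x) `` {r}"
      by (intro cls_eqI[OF \<phi>x U] cauchy[OF x] r cross)
    ultimately show ?thesis using r(2) by metis
  qed
  have eq_iff: "?C x s = ?C x t \<longleftrightarrow>
      frac_equiv Q x `` {s} = frac_equiv Q x `` {t}"
    if x: "x \<in> W" and st: "s \<in> frac_cauchy Q x" "t \<in> frac_cauchy Q x" for x s t
    using dist[OF x frac_cauchyD(1)[OF W[OF x] Q st(1)] frac_cauchyD(1)[OF W[OF x] Q st(2)]]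
    by (simp add: cls_eq_iff[OF W[OF x] Q] cls_eq_iff[OF W'\<phi>[OF x] frac_closed_UNIV] st cauchy x)
  \<comment> \<open>The choice inside \<open>\<tau>\<close> is harmless: by \<open>eq_iff\<close>,
    sequences with equivalent push-forwards are equivalent.\<close>
  have K2: "\<tau> x (?C x s) = frac_equiv Q x `` {s}"
    if x: "x \<in> W" and s: "s \<in> frac_cauchy Q x" for x s
  proof -
    let ?P = "\<lambda>t. t \<in> frac_cauchy Q x \<and> ?C x t = ?C x s"
    have "?P (SOME t. ?P t)" by (rule someI[of ?P s]) (simp add: s)
    then show ?thesis unfolding \<tau>_def using eq_iff[OF x _ s] by blast
  qed
  have K3: "residue_dist Q x (\<tau> x B) a =
      residue_dist UNIV (\<phi> x) B (\<beta> a)"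
    if x: "x \<in> W" and B: "B \<in> carrier (residue_field UNIV (\<phi> x))" and a: "a \<in> Q" "x (snd a) \<noteq> 0" for x B a
  proof -
    obtain s where s: "s \<in> frac_cauchy Q x" "B = ?C x s"
      using K1[OF x B] by blast
    have "(\<lambda>n. frac_dist (\<phi> x) (\<beta> (s n)) (\<beta> a)) \<longlonglongrightarrow>
        residue_dist UNIV (\<phi> x) B (\<beta> a)"
      unfolding s(2) using valid[OF x a(1)] a(2)
      by (intro residue_dist_lim[OF W'\<phi>[OF x] frac_closed_UNIV cauchy[OF x s(1)]]) auto
    then have "(\<lambda>n. frac_dist x (s n) a) \<longlonglongrightarrow>
        residue_dist UNIV (\<phi> x) B (\<beta> a)"
      using dist[OF x frac_cauchyD(1)[OF W[OF x] Q s(1)] a(1)] by simp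
    then show ?thesis
      unfolding s(2) K2[OF x s(1)] using residue_dist_lim[OF W[OF x] Q s(1) a] LIMSEQ_unique by metis
  qed
  have \<tau>_carrier: "\<tau> x B \<in> carrier (residue_field Q x)"
    if "x \<in> W" "B \<in> carrier (residue_field UNIV (\<phi> x))" for x B
    using K1[OF that] K2[OF that(1)] cls_in_carrier[OF W[OF that(1)] Q] by metis
  have iso: "\<tau> x \<in> ring_iso (residue_field UNIV (\<phi> x)) (residue_field Q x)" if x: "x \<in> W" for x
  proof -
    note px = W[OF x] and \<phi>x = W'\<phi>[OF x] and U = frac_closed_UNIV
    let ?R = "residue_field UNIV (\<phi> x)" and ?S = "residue_field Q x"
    have "\<tau> x \<in> ring_hom ?R ?S"
    proof (rule ring_hom_memI)
      fix A B assume A: "A \<in> carrier ?R" and B: "B \<in> carrier ?R"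
      obtain s where s: "s \<in> frac_cauchy Q x" "A = ?C x s"
        using K1[OF x A] by blast
      obtain t where t: "t \<in> frac_cauchy Q x" "B = ?C x t"
        using K1[OF x B] by blast
      show "\<tau> x (A \<otimes>\<^bsub>?R\<^esub> B) = \<tau> x A \<otimes>\<^bsub>?S\<^esub> \<tau> x B"
        using K2[OF x frac_cauchy_mult[OF px Q s(1) t(1)]]
        by (simp add: s t K2[OF x] residue_mult[OF px Q] residue_mult[OF \<phi>x U] cauchy[OF x] \<beta>_mult)
      show "\<tau> x (A \<oplus>\<^bsub>?R\<^esub> B) = \<tau> x A \<oplus>\<^bsub>?S\<^esub> \<tau> x B"
        using K2[OF x frac_cauchy_add[OF px Q s(1) t(1)]]
        by (simp add: s t K2[OF x] residue_add[OF px Q] residue_add[OF \<phi>x U] cauchy[OF x] \<beta>_add)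
    next
      show "\<tau> x \<one>\<^bsub>?R\<^esub> = \<one>\<^bsub>?S\<^esub>"
        using K2[OF x frac_cauchy_1[OF px Q]] by (simp add: residue_one[OF px Q] residue_one[OF \<phi>x U] \<beta>_def E_1)
    qed (rule \<tau>_carrier[OF x])
    moreover have "bij_betw (\<tau> x) (carrier ?R) (carrier ?S)"
    proof (rule bij_betw_imageI)
      show "inj_on (\<tau> x) (carrier ?R)"
      proof (rule inj_onI)
        fix A B assume A: "A \<in> carrier ?R" and B: "B \<in> carrier ?R" and eq: "\<tau> x A = \<tau> x B"
        obtain s where s: "s \<in> frac_cauchy Q x" "A = ?C x s"
          using K1[OF x A] by blast
        obtain t where t: "t \<in> frac_cauchy Q x" "B = ?C x t"
          using K1[OF x B] by blast
        have "frac_equiv Q x `` {s} = frac_equiv Q x `` {t}"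
          using eq by (simp only: s(2) t(2) K2[OF x s(1)] K2[OF x t(1)])
        then show "A = B" unfolding s(2) t(2) eq_iff[OF x s(1) t(1)] .
      qed
      show "\<tau> x ` carrier ?R = carrier ?S"
      proof (intro equalityI subsetI)
        fix A assume "A \<in> carrier ?S"
        then obtain s where s: "s \<in> frac_cauchy Q x" "A = frac_equiv Q x `` {s}"
          using residue_field_carrierE[OF px Q] by metis
        then have "A = \<tau> x (?C x s)" using K2[OF x] by simp
        moreover have "?C x s \<in> carrier ?R"
          using cls_in_carrier[OF \<phi>x U cauchy[OF x s(1)]] .
        ultimately show "A \<in> \<tau> x ` carrier ?R" by blast
      qed (use \<tau>_carrier[OF x] in blast)
    qed
    ultimately show ?thesis by (simp add: ring_iso_def)
  qed
  have isometry: "residue_norm x (\<tau> x A) = residue_norm (\<phi> x) A"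
    if x: "x \<in> W" and A: "A \<in> carrier (residue_field UNIV (\<phi> x))" for x A
  proof -
    obtain s where s: "s \<in> frac_cauchy Q x" "A = ?C x s"
      using K1[OF x A] by blast
    have "(\<lambda>n. frac_norm (\<phi> x) (\<beta> (s n))) \<longlonglongrightarrow> residue_norm x (frac_equiv Q x `` {s})"
      using residue_norm_lim[OF W[OF x] Q s(1)] norm[OF x frac_cauchyD(1)[OF W[OF x] Q s(1)]] by simp
    then show ?thesis
      unfolding s(2) K2[OF x s(1)]
      using residue_norm_eqI[OF W'\<phi>[OF x] frac_closed_UNIV cauchy[OF x s(1)]] by simp
  qed
  have \<tau>_const: "\<tau> x (residue_frac UNIV (\<phi> x) (const c, 1)) = residue_frac Q x (const c, 1)" if x: "x \<in> W" for x c
    using K2[OF x frac_cauchy_const[OF W[OF x] Q Q_const[of c]]]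
    by (simp add: residue_frac_def \<beta>_def E_const E_1 ms_1[OF W[OF x]])
  obtain \<phi>' where "homeomorphic_maps (top_of_set W) (top_of_set W') \<phi> \<phi>'"
    using homeo unfolding homeomorphic_map_maps by blast
  then have cont: "continuous_on W \<phi>" "continuous_on W' \<phi>'"
    and inv: "\<And>y. y \<in> W' \<Longrightarrow> \<phi>' y \<in> W \<and> \<phi> (\<phi>' y) = y"
    unfolding homeomorphic_maps_def by auto
  have sheaf: "analytic_fun UNIV U f \<longleftrightarrow> analytic_fun Q {x\<in>W. \<phi> x \<in> U} (\<lambda>x. \<tau> x (f (\<phi> x)))"
    if U: "openin (top_of_set W') U" and f: "\<forall>y\<in>U. f y \<in> carrier (residue_field UNIV y)" for U f
  proof
    let ?V = "{x\<in>W. \<phi> x \<in> U}"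
    have UW': "U \<subseteq> W'" using U by (rule openin_imp_subset)
    {
      assume an: "analytic_fun UNIV U f"
      show "analytic_fun Q ?V (\<lambda>x. \<tau> x (f (\<phi> x)))"
      proof (rule analytic_fun_pullback[OF an continuous_on_subset[OF cont(1)]])
        show "\<tau> x (f (\<phi> x)) \<in> carrier (residue_field Q x)" if "x \<in> ?V" for x
          using that f by (intro \<tau>_carrier) auto
        fix r :: "'k nov_frac"
        obtain a u where a: "a \<in> Q" "E (fst a) = u * fst r" "E (snd a) = u * snd r" "\<And>x. x \<in> W \<Longrightarrow> \<phi> x u \<noteq> 0"
          using lift[of r] by blast
        have "x (snd a) \<noteq> 0 \<and> residue_dist Q x (\<tau> x (f (\<phi> x))) a = residue_dist UNIV (\<phi> x) (f (\<phi> x)) r"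
          if x: "x \<in> ?V" and r: "\<phi> x (snd r) \<noteq> 0" for x
        proof -
          have xW: "x \<in> W" and car: "f (\<phi> x) \<in> carrier (residue_field UNIV (\<phi> x))" using x f by auto
          note \<phi>x = W'\<phi>[OF xW]
          have nz: "\<phi> x (snd (\<beta> a)) \<noteq> 0"
            using r a(4)[OF xW] by (simp add: \<beta>_def a(3) ms_mult[OF \<phi>x])
          then have nz': "x (snd a) \<noteq> 0" using valid[OF xW a(1)] by simp
          have "residue_frac UNIV (\<phi> x) (\<beta> a) = residue_frac UNIV (\<phi> x) r"
            unfolding residue_frac_def
            by (intro cls_eqI[OF \<phi>x frac_closed_UNIV] frac_cauchy_const[OF \<phi>x frac_closed_UNIV] UNIV_I nz r)
               (simp add: \<beta>_def a mult_ac)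
          then show ?thesis using K3[OF xW car a(1) nz'] nz' by simp
        qed
        then show "\<exists>a\<in>Q. \<forall>x\<in>?V. \<phi> x (snd r) \<noteq> 0 \<longrightarrow> x (snd a) \<noteq> 0 \<and>
            residue_dist Q x (\<tau> x (f (\<phi> x))) a = residue_dist UNIV (\<phi> x) (f (\<phi> x)) r"
          using a(1) by blast
      qed auto
    next
      assume an: "analytic_fun Q ?V (\<lambda>x. \<tau> x (f (\<phi> x)))"
      show "analytic_fun UNIV U f"
      \<comment> \<open>The converse pulls back along the inverse homeomorphism; the counterpart of
        a fraction \<open>a\<close> is its push-forward \<open>\<beta> a\<close>.\<close>
      proof (rule analytic_fun_pullback[OF an continuous_on_subset[OF cont(2) UW']])
        show "\<phi>' ` U \<subseteq> ?V" using inv UW' by auto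
        fix a assume a: "a \<in> Q"
        have "y (snd (\<beta> a)) \<noteq> 0 \<and> residue_dist UNIV y (f y) (\<beta> a) =
            residue_dist Q (\<phi>' y) (\<tau> (\<phi>' y) (f (\<phi> (\<phi>' y)))) a" if "y \<in> U" "\<phi>' y (snd a) \<noteq> 0" for y
          using K3[of "\<phi>' y" "f y" a] valid[of "\<phi>' y" a] a that inv[of y] f UW' by auto
        then show "\<exists>r\<in>UNIV. \<forall>y\<in>U. \<phi>' y (snd a) \<noteq> 0 \<longrightarrow> y (snd r) \<noteq> 0 \<and>
            residue_dist UNIV y (f y) r = residue_dist Q (\<phi>' y) (\<tau> (\<phi>' y) (f (\<phi> (\<phi>' y)))) a"
          by blast
      qed (use f in blast)
    }
  qed
  show ?thesis
    unfolding analytic_iso_def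
  proof (intro conjI homeo exI[of _ \<tau>] ballI allI impI)
    fix x assume x: "x \<in> W"
    show "\<tau> x \<in> ring_iso (residue_field UNIV (\<phi> x)) (residue_field Q x)" by (rule iso[OF x])
    show "residue_norm x (\<tau> x A) = residue_norm (\<phi> x) A" if "A \<in> carrier (residue_field UNIV (\<phi> x))" for A
      by (rule isometry[OF x that])
    show "\<tau> x (residue_frac UNIV (\<phi> x) (const c, 1)) = residue_frac Q x (const c, 1)" for c
      by (rule \<tau>_const[OF x])
  next
    fix U f assume "openin (top_of_set W') U \<and> (\<forall>y\<in>U. f y \<in> carrier (residue_field UNIV y))"
    then show "analytic_fun UNIV U f \<longleftrightarrow> analytic_fun Q {x\<in>W. \<phi> x \<in> U} (\<lambda>x. \<tau> x (f (\<phi> x)))"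
      using sheaf by blast
  qed
qed


section \<open>Points of \<open>Y\<close>\<close>

definition zdeg :: "y_mon \<Rightarrow> nat"
  where "zdeg m = lookup m Z0 + lookup m Z1"

lemma zdeg_add: "zdeg (a + b) = zdeg a + zdeg b"
  by (simp add: zdeg_def lookup_add)

lemma zdeg_0 [simp]: "zdeg 0 = 0"
  by (simp add: zdeg_def)

lemma zpart_eq_gpart: "zpart = gpart zdeg"
  by (simp add: fun_eq_iff zpart_def gpart_def zdeg_def)

abbreviation homog :: "nat \<Rightarrow> y_mon nov_alg \<Rightarrow> bool"
  where "homog d f \<equiv> gpart zdeg d f = f"

definition vdeg :: "yvar \<Rightarrow> nat"
  where "vdeg v = (if v = Z0 \<or> v = Z1 then 1 else 0)"

lemma homog_mult: "homog d f \<Longrightarrow> homog e g \<Longrightarrow> homog (d + e) (f * g)"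
  by (rule gpart_mult_homog[OF zdeg_add])

lemma homog_const: "homog 0 (const c)"
  by (simp add: const_def gpart_single)

lemma homog_1: "homog 0 1"
  using homog_const[of 1] by simp

lemma homog_power: "homog d f \<Longrightarrow> homog (k * d) (f ^ k)"
  by (induction k) (simp_all add: homog_1 homog_mult)

lemma homog_sum: "(\<And>i. i \<in> I \<Longrightarrow> homog d (f i)) \<Longrightarrow> homog d (\<Sum>i\<in>I. f i)"
  by (simp add: gpart_sum)

lemma homog_var: "homog (vdeg v) (var v)"
  by (cases v) (simp_all add: var_def gpart_single zdeg_def vdeg_def lookup_single)

lemma frac_closed_y_fracs: "frac_closed y_fracs"
  unfolding frac_closed_def
proof (intro conjI ballI)
  show "(0, 1) \<in> y_fracs" "(1, 1) \<in> y_fracs"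
    by (auto simp: y_fracs_def zpart_eq_gpart homog_1 intro!: exI[of _ 0])
  fix a assume "a \<in> y_fracs"
  then obtain d where a: "homog d (fst a)" "homog d (snd a)"
    by (auto simp: y_fracs_def zpart_eq_gpart)
  then show "frac_neg a \<in> y_fracs"
    by (auto simp: y_fracs_def zpart_eq_gpart frac_neg_def gpart_uminus)
  fix b assume "b \<in> y_fracs"
  then obtain e where b: "homog e (fst b)" "homog e (snd b)"
    by (auto simp: y_fracs_def zpart_eq_gpart)
  note h = homog_mult[OF a(1) b(1)] homog_mult[OF a(1) b(2)] homog_mult[OF b(1) a(2)] homog_mult[OF a(2) b(2)]
  show "frac_add a b \<in> y_fracs" "frac_mult a b \<in> y_fracs"
    using h by (auto simp: y_fracs_def zpart_eq_gpart frac_add_def frac_mult_def gpart_add add.commute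
        intro!: exI[of _ "d + e"])
qed

lemma const_in_y_fracs: "(const c, 1) \<in> y_fracs"
  using homog_const[of c] homog_1 by (auto simp: y_fracs_def zpart_eq_gpart)

lemma YanD:
  assumes "p \<in> Yan"
  shows "mult_seminorm p" "p f = (SUP d. p (gpart zdeg d f))"
    "max (p (var Z0)) (p (var Z1)) = 1" "p (var Y1) \<noteq> 0" "p (var Y2) \<noteq> 0"
    "p (var X1 * var Z0 - (1 + var Y1) * var Z1) = 0"
    "p (var X2 * var Z1 - (1 + var Y2) * var Z0) = 0"
  using assms unfolding Yan_def zpart_eq_gpart by blast+

text \<open>The normalized representative of the projective class of \<open>N\<close>: the factor
  makes the larger of |Z0| and |Z1| equal to 1, and \<open>gauss\<close> makes the norm a maximum
  over homogeneous components.\<close>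

definition yan_pt :: "y_mon berk_pt \<Rightarrow> y_mon berk_pt"
  where "yan_pt N = gauss zdeg N (1 / max (N (var Z0)) (N (var Z1)))"

context
  fixes N :: "y_mon berk_pt"
  assumes N: "mult_seminorm N" and nz: "N (var Z0) \<noteq> 0 \<or> N (var Z1) \<noteq> 0"
begin

lemma yan_pt_scale: "0 < 1 / max (N (var Z0)) (N (var Z1))"
  using nz ms_nonneg[OF N, of "var Z0"] ms_nonneg[OF N, of "var Z1"]
  by (auto simp: max_def)

lemma yan_pt_homog: "homog d f \<Longrightarrow> yan_pt N f = (1 / max (N (var Z0)) (N (var Z1))) ^ d * N f"
  unfolding yan_pt_def by (rule gauss_homog[OF zdeg_add N yan_pt_scale])

lemma yan_pt_var: "yan_pt N (var v) = (1 / max (N (var Z0)) (N (var Z1))) ^ vdeg v * N (var v)"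
  by (rule yan_pt_homog[OF homog_var])

lemma yan_pt_in_Yan:
  assumes "N (var Y1) \<noteq> 0" "N (var Y2) \<noteq> 0"
    "N (var X1 * var Z0 - (1 + var Y1) * var Z1) = 0"
    "N (var X2 * var Z1 - (1 + var Y2) * var Z0) = 0"
  shows "yan_pt N \<in> Yan"
proof -
  let ?c = "1 / max (N (var Z0)) (N (var Z1))"
  have h0: "homog 0 (1 + var Y1)" "homog 0 (1 + var Y2)"
    using homog_1 homog_var[of Y1] homog_var[of Y2] by (simp_all add: gpart_add vdeg_def)
  have h1: "homog 1 (var X1 * var Z0 - (1 + var Y1) * var Z1)" "homog 1 (var X2 * var Z1 - (1 + var Y2) * var Z0)"
    using homog_mult[OF homog_var[of X1] homog_var[of Z0]] homog_mult[OF h0(1) homog_var[of Z1]]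
      homog_mult[OF homog_var[of X2] homog_var[of Z1]] homog_mult[OF h0(2) homog_var[of Z0]]
    by (simp_all add: gpart_diff vdeg_def)
  have "max (?c * N (var Z0)) (?c * N (var Z1)) = ?c * max (N (var Z0)) (N (var Z1))"
    using yan_pt_scale by (simp add: max_mult_distrib_left)
  also have "\<dots> = 1" using yan_pt_scale by auto
  finally have "max (yan_pt N (var Z0)) (yan_pt N (var Z1)) = 1"
    by (simp add: yan_pt_var vdeg_def)
  moreover have "yan_pt N f = (SUP d. yan_pt N (gpart zdeg d f))" for f
  proof -
    have "yan_pt N (gpart zdeg d f) = ?c ^ d * N (gpart zdeg d f)" for d
      by (rule yan_pt_homog) (simp add: gpart_gpart)
    then show ?thesis by (simp only: yan_pt_def gauss_def)
  qed
  moreover have "mult_seminorm (yan_pt N)"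
    unfolding yan_pt_def by (rule mult_seminorm_gauss[OF zdeg_add N yan_pt_scale])
  moreover have "yan_pt N (var Y1) \<noteq> 0" "yan_pt N (var Y2) \<noteq> 0"
    using assms by (simp_all add: yan_pt_var vdeg_def)
  moreover have "yan_pt N (var X1 * var Z0 - (1 + var Y1) * var Z1) = 0"
    "yan_pt N (var X2 * var Z1 - (1 + var Y2) * var Z0) = 0"
    using assms by (simp_all add: yan_pt_homog[OF h1(1)] yan_pt_homog[OF h1(2)])
  ultimately show ?thesis unfolding Yan_def zpart_eq_gpart by blast
qed

end

definition yvars :: "yvar set"
  where "yvars = {X1, X2, Z0, Z1, Y1, Y2}"

lemma in_yvars [simp]: "v \<in> yvars"
  by (cases v) (simp_all add: yvars_def)

lemma finite_yvars [simp]: "finite yvars"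
  by (simp add: yvars_def)

definition ymon :: "(yvar \<Rightarrow> 'r::comm_ring_1) \<Rightarrow> y_mon \<Rightarrow> 'r"
  where "ymon e m = (\<Prod>v\<in>yvars. e v ^ lookup m v)"

lemma ymon_add: "ymon e (a + b) = ymon e a * ymon e b"
  by (simp add: ymon_def lookup_add power_add prod.distrib)

lemma ymon_0 [simp]: "ymon e 0 = 1"
  by (simp add: ymon_def)

lemma ymon_single: "ymon e (single v 1) = e v"
proof -
  have "ymon e (single v 1) = (\<Prod>w\<in>yvars. if w = v then e w else 1)"
    unfolding ymon_def by (rule prod.cong) (auto simp: lookup_single when_def)
  then show ?thesis by simp
qed

lemma ymon_var: "ymon var m = single m 1"
proof -
  have pow: "var v ^ k = single (single v k) 1" for v k
    by (induction k) (simp_all add: var_def mult_single single_add[symmetric])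
  have "ymon var m = (\<Prod>v\<in>yvars. single (single v (lookup m v)) 1)"
    by (simp add: ymon_def pow)
  also have "\<dots> = single (\<Sum>v\<in>yvars. single v (lookup m v)) 1"
    by (rule finite_induct[OF finite_yvars]) (simp_all add: mult_single)
  also have "(\<Sum>v\<in>yvars. single v (lookup m v)) = m"
    by (rule poly_mapping_eqI) (simp add: lookup_sum lookup_single when_def sum.delta)
  finally show ?thesis .
qed

abbreviation yeval :: "(novikov \<Rightarrow> 'r::comm_ring_1) \<Rightarrow> (yvar \<Rightarrow> 'r) \<Rightarrow> y_mon nov_alg \<Rightarrow> 'r"
  where "yeval \<iota> e \<equiv> heval \<iota> (ymon e)"

lemma yeval_var: "nov_hom \<iota> \<Longrightarrow> yeval \<iota> e (var v) = e v"
  unfolding var_def by (simp only: heval_single ymon_single) (simp add: nov_hom_def)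

lemma yeval_mult: "nov_hom \<iota> \<Longrightarrow> yeval \<iota> e (f * g) = yeval \<iota> e f * yeval \<iota> e g"
  by (rule heval_mult) (simp_all add: ymon_add)

lemma yeval_const: "nov_hom \<iota> \<Longrightarrow> yeval \<iota> e (const c) = \<iota> c"
  by (simp add: heval_const)

lemma yeval_1: "nov_hom \<iota> \<Longrightarrow> yeval \<iota> e 1 = 1"
  using yeval_const[of \<iota> e 1] by (simp add: nov_hom_def)

lemma yeval_power: "nov_hom \<iota> \<Longrightarrow> yeval \<iota> e (f ^ k) = yeval \<iota> e f ^ k"
  by (induction k) (simp_all add: yeval_1 yeval_mult)

definition yrel :: "(yvar \<Rightarrow> 'r::comm_ring_1) \<Rightarrow> bool"
  where "yrel e \<longleftrightarrow> e X1 * e Z0 = (1 + e Y1) * e Z1 \<and> e X2 * e Z1 = (1 + e Y2) * e Z0"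

lemma yeval_rel:
  assumes "nov_hom \<iota>" "yrel e"
  shows "yeval \<iota> e (var X1 * var Z0 - (1 + var Y1) * var Z1) = 0"
    "yeval \<iota> e (var X2 * var Z1 - (1 + var Y2) * var Z0) = 0"
  using assms by (simp_all add: heval_diff heval_add yeval_mult yeval_var yeval_1 yrel_def)


section \<open>Toric charts\<close>

abbreviation tvar :: "3 \<Rightarrow> 3 torus_mon nov_alg"
  where "tvar i \<equiv> single (single i 1) 1"

abbreviation tinv :: "3 \<Rightarrow> 3 torus_mon nov_alg"
  where "tinv i \<equiv> single (single i (- 1)) 1"

lemma tvar_tinv: "tvar i * tinv i = 1"
  by (simp add: mult_single single_add[symmetric])

lemma tinv_tvar: "tinv i * tvar i = 1"
  by (simp add: mult_single single_add[symmetric])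

lemma tvar_nonzero:
  assumes "mult_seminorm q"
  shows "q (tvar i) \<noteq> 0"
proof
  assume "q (tvar i) = 0"
  then have "q (tvar i * tinv i) = 0" by (simp only: ms_mult[OF assms] mult_zero_left)
  then show False by (simp add: tvar_tinv ms_1[OF assms])
qed

text \<open>Bounds the exponents in absolute value, so that the shifted exponents in
  \<open>cmon\<close> are nonnegative and the conversion by \<open>nat\<close> loses
  nothing.\<close>

definition tbound :: "nat \<Rightarrow> 3 torus_mon nov_alg \<Rightarrow> bool"
  where "tbound n f \<longleftrightarrow> (\<forall>m\<in>keys f. \<forall>i. \<bar>lookup m i\<bar> \<le> int n)"

lemma tbound_mono: "tbound n f \<Longrightarrow> n \<le> k \<Longrightarrow> tbound k f"
  unfolding tbound_def by (intro ballI allI) (drule (1) bspec, drule spec, erule order_trans, simp)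

lemma tbound_add: "tbound n f \<Longrightarrow> tbound n g \<Longrightarrow> tbound n (f + g)"
  using keys_add[of f g] by (auto simp: tbound_def)

lemma tbound_mult:
  assumes "tbound n f" "tbound k g"
  shows "tbound (n + k) (f * g)"
  unfolding tbound_def
proof (intro ballI allI)
  fix m i assume "m \<in> keys (f * g)"
  then obtain a b where ab: "a \<in> keys f" "b \<in> keys g" "m = a + b"
    using keys_mult[of f g] by blast
  then have "\<bar>lookup a i\<bar> \<le> int n" "\<bar>lookup b i\<bar> \<le> int k"
    using assms by (auto simp: tbound_def)
  then show "\<bar>lookup m i\<bar> \<le> int (n + k)"
    by (simp add: ab lookup_add)
qed

lemma tbound_const: "tbound n (const c)"
  by (auto simp: tbound_def const_def)

lemma tbound_1: "tbound n 1"
  using tbound_const[of n 1] by simp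

lemma tbound_tvar: "tbound 1 (tvar i)"
  by (auto simp: tbound_def lookup_single when_def)

lemma tbound_ex: "\<exists>n. tbound n f"
proof -
  let ?A = "\<Union>m\<in>keys f. range (\<lambda>i::3. nat \<bar>lookup m i\<bar>)"
  have "finite ?A" by simp
  then obtain n where "\<forall>k\<in>?A. k \<le> n" unfolding finite_nat_set_iff_bounded_le by blast
  then have "nat \<bar>lookup m i\<bar> \<le> n" if "m \<in> keys f" for m i
    using that by blast
  then have "tbound n f" by (simp add: tbound_def nat_le_iff)
  then show ?thesis by blast
qed

text \<open>A Laurent polynomial in \<open>T0 / var zv ^ dT\<close>, \<open>Y1\<close>, \<open>Y2\<close> with exponents bounded by \<open>n\<close> is
  multiplied by the \<open>n\<close>-th power of \<open>den = T0 * var zv ^ dT * Y1 * Y2\<close> to clear denominators.\<close>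

locale chart0 =
  fixes T0 :: "y_mon nov_alg" and zv :: yvar and dT :: nat
  assumes zv: "zv = Z0 \<or> zv = Z1" and T0: "homog dT T0"
begin

abbreviation "T1 \<equiv> var zv ^ dT"

definition den :: "y_mon nov_alg"
  where "den = T0 * T1 * var Y1 * var Y2"

text \<open>The monomial \<open>m\<close> times the \<open>n\<close>-th power of \<open>den\<close>.
  The exponent of \<open>T1\<close> carries the opposite sign because the first torus coordinate is
  \<open>T0 / T1\<close>.\<close>

definition cmon :: "nat \<Rightarrow> 3 torus_mon \<Rightarrow> y_mon nov_alg"
  where "cmon n m = T0 ^ nat (int n + lookup m 1) * T1 ^ nat (int n - lookup m 1) *
    var Y1 ^ nat (int n + lookup m 2) * var Y2 ^ nat (int n + lookup m 3)"

definition clear :: "nat \<Rightarrow> 3 torus_mon nov_alg \<Rightarrow> y_mon nov_alg"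
  where "clear n = heval const (cmon n)"

lemma clear_add: "clear n (f + g) = clear n f + clear n g"
  by (simp add: clear_def heval_add nov_hom_const)

lemma clear_const: "clear n (const c) = const c * den ^ n"
  by (simp add: clear_def heval_const nov_hom_const cmon_def den_def power_mult_distrib mult_ac)

lemma clear_1: "clear n 1 = den ^ n"
  using clear_const[of n 1] by simp

lemma clear_mult:
  assumes "tbound n f" "tbound k g"
  shows "clear (n + k) (f * g) = clear n f * clear k g"
  unfolding clear_def
proof (rule heval_mult_graded[OF nov_hom_const])
  fix a b assume "a \<in> keys f" "b \<in> keys g"
  then have ab: "\<bar>lookup a i\<bar> \<le> int n" "\<bar>lookup b i\<bar> \<le> int k" for i
    using assms by (auto simp: tbound_def)
  have "nat (int (n + k) + lookup (a + b) i) =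
      nat (int n + lookup a i) + nat (int k + lookup b i)"
    "nat (int (n + k) - lookup (a + b) i) =
      nat (int n - lookup a i) + nat (int k - lookup b i)" for i
    using ab[of i] by (simp_all add: lookup_add)
  then show "cmon (n + k) (a + b) = cmon n a * cmon k b"
    unfolding cmon_def by (simp only: power_add mult_ac)
qed

lemma clear_Suc_den: "tbound n f \<Longrightarrow> clear (n + k) f = clear n f * den ^ k"
  using clear_mult[of n f k 1] by (simp add: tbound_1 clear_1)

lemma homog_clear:
  assumes "tbound n f"
  shows "homog (2 * n * dT) (clear n f)"
  unfolding clear_def heval_def
proof (rule homog_sum)
  fix m assume "m \<in> keys f"
  then have m: "\<bar>lookup m i\<bar> \<le> int n" for i using assms by (auto simp: tbound_def)
  let ?a = "nat (int n + lookup m 1)" and ?b = "nat (int n - lookup m 1)"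
  have T1: "homog dT T1" using homog_power[OF homog_var[of zv], of dT] zv by (auto simp: vdeg_def)
  have Y: "homog 0 (var Y1 ^ k)" "homog 0 (var Y2 ^ k)" for k
    using homog_power[OF homog_var[of Y1], of k] homog_power[OF homog_var[of Y2], of k] by (simp_all add: vdeg_def)
  have "homog (0 + (?a * dT + ?b * dT + 0 + 0)) (const (lookup f m) * cmon n m)"
    unfolding cmon_def by (intro homog_mult homog_const homog_power T0 T1 Y)
  moreover have "?a + ?b = 2 * n" using m[of 1] by linarith
  then have "0 + (?a * dT + ?b * dT + 0 + 0) = 2 * n * dT" by (simp add: distrib_right[symmetric])
  ultimately show "homog (2 * n * dT) (const (lookup f m) * cmon n m)" by metis
qed

definition dom :: "y_mon berk_pt set"
  where "dom = {p\<in>Yan. p T0 \<noteq> 0 \<and> p (var zv) \<noteq> 0}"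

lemma domD:
  assumes "p \<in> dom"
  shows "p \<in> Yan" "mult_seminorm p" "p T0 \<noteq> 0" "p (var zv) \<noteq> 0" "p den \<noteq> 0"
proof -
  show *: "p \<in> Yan" "p T0 \<noteq> 0" "p (var zv) \<noteq> 0" using assms by (auto simp: dom_def)
  show "mult_seminorm p" using * YanD by blast
  then show "p den \<noteq> 0" using * YanD(4,5)[OF *(1)] by (simp add: den_def ms_mult ms_power)
qed

text \<open>Any admissible \<open>n\<close> gives the same quotient, because raising
  \<open>n\<close> multiplies numerator and denominator by the same power of \<open>den\<close>; the
  least one only fixes a choice.\<close>

definition to_torus :: "y_mon berk_pt \<Rightarrow> 3 torus_mon berk_pt"
  where "to_torus p f = (let n = (LEAST n. tbound n f) in p (clear n f) / p den ^ n)"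

lemma to_torus_eq:
  assumes p: "p \<in> dom" and n: "tbound n f"
  shows "to_torus p f = p (clear n f) / p den ^ n"
proof -
  let ?k = "LEAST n. tbound n f"
  have k: "tbound ?k f" using n by (rule LeastI)
  have "?k \<le> n" using n by (rule Least_le)
  then have "clear n f = clear ?k f * den ^ (n - ?k)" "n = ?k + (n - ?k)"
    using clear_Suc_den[OF k, of "n - ?k"] by simp_all
  then have "p (clear n f) / p den ^ n = p (clear ?k f) * p den ^ (n - ?k) / (p den ^ ?k * p den ^ (n - ?k))"
    by (metis ms_mult[OF domD(2)[OF p]] ms_power[OF domD(2)[OF p]] power_add)
  then show ?thesis using domD(5)[OF p] by (simp add: to_torus_def Let_def)
qed

lemma mult_seminorm_to_torus:
  assumes p: "p \<in> dom"
  shows "mult_seminorm (to_torus p)"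
  unfolding mult_seminorm_def
proof (intro conjI allI)
  note ms = domD(2)[OF p]
  fix f g :: "3 torus_mon nov_alg"
  obtain n where n: "tbound n f" using tbound_ex by blast
  obtain k where k: "tbound k g" using tbound_ex by blast
  have d: "p den > 0" using domD(5)[OF p] ms_nonneg[OF ms, of den] by linarith
  show "0 \<le> to_torus p f" using to_torus_eq[OF p n] ms_nonneg[OF ms] d by simp
  have nk: "tbound (n + k) f" "tbound (n + k) g" using tbound_mono n k by force+
  have "p (clear (n + k) (f + g)) / p den ^ (n + k) \<le>
      max (p (clear (n + k) f)) (p (clear (n + k) g)) / p den ^ (n + k)"
    unfolding clear_add using d by (intro divide_right_mono ms_add[OF ms]) simp
  also have "\<dots> = max (p (clear (n + k) f) / p den ^ (n + k)) (p (clear (n + k) g) / p den ^ (n + k))"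
    using d by (simp add: max_divide_distrib_right)
  finally show "to_torus p (f + g) \<le> max (to_torus p f) (to_torus p g)"
    using to_torus_eq[OF p nk(1)] to_torus_eq[OF p nk(2)] to_torus_eq[OF p tbound_add[OF nk]] by simp
  show "to_torus p (f * g) = to_torus p f * to_torus p g"
    using to_torus_eq[OF p n] to_torus_eq[OF p k] to_torus_eq[OF p tbound_mult[OF n k]]
    by (simp add: clear_mult[OF n k] ms_mult[OF ms] power_add)
next
  note ms = domD(2)[OF p]
  fix c
  show "to_torus p (const c) = nov_norm c"
    using to_torus_eq[OF p tbound_const[of 0 c]] by (simp add: clear_const ms_const[OF ms])
qed

text \<open>At \<open>p\<close>, the form \<open>f\<close> of degree \<open>d\<close> equals \<open>var zv ^ d\<close> times the Laurent polynomial \<open>l\<close>.\<close>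

definition represents :: "y_mon berk_pt \<Rightarrow> nat \<Rightarrow> y_mon nov_alg \<Rightarrow> 3 torus_mon nov_alg \<Rightarrow> bool"
  where "represents p d f l \<longleftrightarrow> (\<exists>n. tbound n l \<and> p (f * den ^ n - var zv ^ d * clear n l) = 0)"

context
  fixes p assumes p: "p \<in> dom"
begin

lemma represents_at:
  assumes "represents p d f l"
  obtains n where "\<And>k. n \<le> k \<Longrightarrow> tbound k l \<and> p (f * den ^ k - var zv ^ d * clear k l) = 0"
proof -
  obtain n where n: "tbound n l" "p (f * den ^ n - var zv ^ d * clear n l) = 0"
    using assms by (auto simp: represents_def)
  have "tbound k l \<and> p (f * den ^ k - var zv ^ d * clear k l) = 0" if "n \<le> k" for k
  proof -
    have k: "k = n + (k - n)" using that by simp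
    have "f * den ^ k - var zv ^ d * clear k l = den ^ (k - n) * (f * den ^ n - var zv ^ d * clear n l)"
      by (subst (1 2) k, unfold clear_Suc_den[OF n(1)]) (simp only: power_add right_diff_distrib mult_ac)
    then show ?thesis using n tbound_mono[OF n(1) that] by (simp add: ms_mult[OF domD(2)[OF p]])
  qed
  then show ?thesis using that by blast
qed

lemma represents_norm:
  assumes "represents p d f l"
  shows "p f = p (var zv) ^ d * to_torus p l"
proof -
  obtain n where n: "tbound n l" "p (f * den ^ n - var zv ^ d * clear n l) = 0"
    using assms by (auto simp: represents_def)
  have "p f * p den ^ n = p (var zv) ^ d * p (clear n l)"
    using ms_eq_of_diff[OF domD(2)[OF p] n(2)] by (simp add: ms_mult[OF domD(2)[OF p]] ms_power[OF domD(2)[OF p]])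
  then show ?thesis using domD(5)[OF p] by (simp add: to_torus_eq[OF p n(1)] field_simps)
qed

lemma represents_cong: "represents p d g l \<Longrightarrow> p (f - g) = 0 \<Longrightarrow> represents p d f l"
proof -
  assume g: "represents p d g l" and fg: "p (f - g) = 0"
  then obtain n where n: "tbound n l" "p (g * den ^ n - var zv ^ d * clear n l) = 0"
    by (auto simp: represents_def)
  let ?a = "(f - g) * den ^ n" and ?b = "g * den ^ n - var zv ^ d * clear n l"
  have "f * den ^ n - var zv ^ d * clear n l = ?a + ?b"
    by (simp add: algebra_simps)
  moreover have "p ?a = 0" using fg by (simp add: ms_mult[OF domD(2)[OF p]])
  then have "p (?a + ?b) = 0"
    using n(2) ms_add[OF domD(2)[OF p], of ?a ?b] ms_nonneg[OF domD(2)[OF p], of "?a + ?b"] by linarith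
  ultimately show ?thesis using n(1) unfolding represents_def by metis
qed

lemma represents_add:
  assumes "represents p d f l" "represents p d g k"
  shows "represents p d (f + g) (l + k)"
proof -
  obtain n where n: "\<And>j. n \<le> j \<Longrightarrow> tbound j l \<and> p (f * den ^ j - var zv ^ d * clear j l) = 0"
    using represents_at[OF assms(1)] by blast
  obtain m where m: "\<And>j. m \<le> j \<Longrightarrow> tbound j k \<and> p (g * den ^ j - var zv ^ d * clear j k) = 0"
    using represents_at[OF assms(2)] by blast
  let ?j = "n + m"
  let ?a = "f * den ^ ?j - var zv ^ d * clear ?j l" and ?b = "g * den ^ ?j - var zv ^ d * clear ?j k"
  have "(f + g) * den ^ ?j - var zv ^ d * clear ?j (l + k) = ?a + ?b"
    by (simp add: clear_add algebra_simps)
  moreover have "p (?a + ?b) = 0"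
    using n[of ?j] m[of ?j] ms_add[OF domD(2)[OF p], of ?a ?b] ms_nonneg[OF domD(2)[OF p], of "?a + ?b"] by simp
  ultimately show ?thesis
    using n[of ?j] m[of ?j] tbound_add unfolding represents_def by (metis le_add1 le_add2)
qed

lemma represents_mult:
  assumes "represents p d f l" "represents p e g k"
  shows "represents p (d + e) (f * g) (l * k)"
proof -
  obtain n where n: "tbound n l" "p (f * den ^ n - var zv ^ d * clear n l) = 0"
    using assms(1) by (auto simp: represents_def)
  obtain m where m: "tbound m k" "p (g * den ^ m - var zv ^ e * clear m k) = 0"
    using assms(2) by (auto simp: represents_def)
  let ?a = "f * den ^ n - var zv ^ d * clear n l" and ?b = "g * den ^ m - var zv ^ e * clear m k"
  have "(f * g) * den ^ (n + m) - var zv ^ (d + e) * clear (n + m) (l * k) =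
      f * den ^ n * ?b + ?a * (var zv ^ e * clear m k)"
    unfolding clear_mult[OF n(1) m(1)] power_add by (simp add: algebra_simps)
  moreover have "p (f * den ^ n * ?b + ?a * (var zv ^ e * clear m k)) = 0"
    using ms_add[OF domD(2)[OF p], of "f * den ^ n * ?b" "?a * (var zv ^ e * clear m k)"]
      ms_nonneg[OF domD(2)[OF p]] n(2) m(2)
    by (simp only: ms_mult[OF domD(2)[OF p]] mult_zero_left mult_zero_right max.idem order_antisym)
  ultimately show ?thesis
    using tbound_mult[OF n(1) m(1)] unfolding represents_def by metis
qed

text \<open>This is how the equations of \<open>Y\<close> are solved for a variable, such as
  \<open>X1\<close> from \<open>X1 * Z0 = (1 + Y1) * Z1\<close>. Multiplicativity of
  \<open>p\<close> leaves no zero divisors, so a factor that does not vanish at \<open>p\<close> can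
  be removed.\<close>

lemma represents_cancel:
  assumes fg: "represents p (d + e) (f * g) (l * k)" and g: "represents p e g k" "p g \<noteq> 0"
  shows "represents p d f l"
proof -
  obtain n where n: "\<And>j. n \<le> j \<Longrightarrow> tbound j (l * k) \<and> p (f * g * den ^ j - var zv ^ (d + e) * clear j (l * k)) = 0"
    using represents_at[OF fg] by blast
  obtain m where m: "tbound m k" "p (g * den ^ m - var zv ^ e * clear m k) = 0"
    using g(1) by (auto simp: represents_def)
  obtain r where r: "tbound r l" using tbound_ex by blast
  let ?r = "n + r"
  have r': "tbound ?r l" using tbound_mono[OF r] by simp
  let ?a = "f * den ^ ?r - var zv ^ d * clear ?r l" and ?b = "g * den ^ m - var zv ^ e * clear m k"
  let ?c = "f * g * den ^ (?r + m) - var zv ^ (d + e) * clear (?r + m) (l * k)"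
  have eq: "g * den ^ m * ?a = ?c - (var zv ^ d * clear ?r l) * ?b"
    unfolding clear_mult[OF r' m(1)] power_add by (simp add: algebra_simps)
  have c0: "p ?c = 0" using n[of "?r + m"] by simp
  have "p (var zv ^ d * clear ?r l * ?b) = 0" using m(2) by (simp only: ms_mult[OF domD(2)[OF p]] mult_zero_right)
  then have "p (g * den ^ m * ?a) \<le> 0"
    unfolding eq using ms_diff[OF domD(2)[OF p], of ?c "var zv ^ d * clear ?r l * ?b"] c0 by simp
  then have "p g * p den ^ m * p ?a = 0"
    using ms_nonneg[OF domD(2)[OF p], of "g * den ^ m * ?a"]
    by (simp add: ms_mult[OF domD(2)[OF p]] ms_power[OF domD(2)[OF p]])
  then have "p ?a = 0" using g(2) domD(5)[OF p] by simp
  then show ?thesis using r' unfolding represents_def by blast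
qed

lemma represents_const: "represents p 0 (const c) (const c)"
  unfolding represents_def by (rule exI[of _ 0]) (simp add: tbound_const clear_const ms_0[OF domD(2)[OF p]])

lemma represents_1: "represents p 0 1 1"
  using represents_const[of 1] by simp

lemma represents_0: "represents p d 0 0"
  unfolding represents_def using tbound_const[of 0 0]
  by (intro exI[of _ 0]) (simp add: clear_def heval_0[OF nov_hom_const] ms_0[OF domD(2)[OF p]])

lemma clear_single: "clear n (single m 1) = cmon n m"
  by (simp add: clear_def heval_single nov_hom_const)

lemma represents_Y: "represents p 0 (var Y1) (tvar 2)" "represents p 0 (var Y2) (tvar 3)"
  unfolding represents_def
  by (rule exI[of _ 1], simp add: tbound_tvar[unfolded One_nat_def] clear_single cmon_def den_def lookup_single
      numeral_2_eq_2 nat_add_distrib mult_ac ms_0[OF domD(2)[OF p]])+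

lemma represents_zv: "represents p 1 (var zv) 1"
  unfolding represents_def by (rule exI[of _ 0]) (simp add: tbound_1 clear_1 ms_0[OF domD(2)[OF p]])

lemma represents_T0: "represents p dT T0 (tvar 1)"
  unfolding represents_def
  by (rule exI[of _ 1], simp add: tbound_tvar[unfolded One_nat_def] clear_single cmon_def den_def lookup_single
      numeral_2_eq_2 nat_add_distrib mult_ac ms_0[OF domD(2)[OF p]])

lemma represents_power: "represents p d f l \<Longrightarrow> represents p (k * d) (f ^ k) (l ^ k)"
  by (induction k) (simp_all add: represents_1 represents_mult)

text \<open>Representations of the variables multiply to those of monomials; homogeneity gives all
  monomials of \<open>f\<close> the same power of \<open>zv\<close>, so that they can be
  added.\<close>

lemma represents_homog:
  assumes vars: "\<And>v. represents p (vdeg v) (var v) (e v)" and f: "homog d f"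
  shows "represents p d f (yeval const e f)"
proof -
  have mon: "represents p (zdeg m) (single m c) (yeval const e (single m c))" for m c
  proof -
    let ?k = "lookup m"
    have "represents p (\<Sum>v\<in>V. ?k v * vdeg v) (\<Prod>v\<in>V. var v ^ ?k v) (\<Prod>v\<in>V. e v ^ ?k v)" if "finite V" for V
      using that by (induction V) (simp_all add: represents_1 represents_mult represents_power vars)
    from this[OF finite_yvars] have "represents p (zdeg m) (ymon var m) (ymon e m)"
      by (simp add: ymon_def yvars_def zdeg_def vdeg_def)
    from represents_mult[OF represents_const[of c] this]
    show ?thesis by (simp add: ymon_var heval_single nov_hom_const) (simp add: const_def mult_single)
  qed
  have deg: "zdeg m = d" if "m \<in> keys f" for m
    using that arg_cong[OF f, of "\<lambda>f. lookup f m"] by (auto simp: lookup_gpart in_keys_iff split: if_splits)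
  have "represents p d (\<Sum>m\<in>M. single m (lookup f m))
      (yeval const e (\<Sum>m\<in>M. single m (lookup f m)))"
    if "finite M" "M \<subseteq> keys f" for M
    using that
  proof (induction M)
    case empty
    then show ?case by (simp add: represents_0 heval_0[OF nov_hom_const])
  next
    case (insert m M)
    then show ?case
      using mon[of m "lookup f m"] deg[of m]
      by (simp add: heval_add nov_hom_const represents_add)
  qed
  from this[OF finite_keys order_refl] show ?thesis by (simp only: nov_alg_sum_single[symmetric])
qed

end

end


section \<open>Continuity of evaluations and of the supremum over degrees\<close>

lemma continuous_on_point_eval [continuous_intros]:
  "continuous_on S (\<lambda>p :: 'm berk_pt. p f)"
  by (rule continuous_on_subset[OF continuous_on_product_coordinates]) simp

text \<open>The index \<open>Suc K\<close> is retained so that the value 0 of all discarded terms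
  still occurs among the finitely many that remain.\<close>

lemma SUP_eventually_zero:
  fixes g :: "nat \<Rightarrow> real"
  assumes "\<And>d. K < d \<Longrightarrow> g d = 0"
  shows "(SUP d. g d) = (SUP d\<in>{..Suc K}. g d)"
proof -
  have "range g = g ` {..Suc K}"
  proof (intro equalityI subsetI)
    fix y assume "y \<in> range g"
    then obtain d where "y = g d" by blast
    then show "y \<in> g ` {..Suc K}"
      using assms[of d] assms[of "Suc K"] by (cases "K < d") auto
  qed auto
  then show ?thesis by simp
qed

lemma continuous_on_SUP_eventually_zero:
  fixes g :: "nat \<Rightarrow> 'a::topological_space \<Rightarrow> real"
  assumes cont: "\<And>d. continuous_on S (g d)" and zero: "\<And>d x. x \<in> S \<Longrightarrow> K < d \<Longrightarrow> g d x = 0"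
  shows "continuous_on S (\<lambda>x. SUP d. g d x)"
proof -
  have "continuous_on S (\<lambda>x. SUP d\<in>{..n}. g d x)" for n
  proof (induction n)
    case (Suc n)
    have "(SUP d\<in>{..Suc n}. g d x) = max (g (Suc n) x) (SUP d\<in>{..n}. g d x)" for x
      unfolding atMost_Suc image_insert
      by (subst cSup_insert) (auto simp: sup_max bdd_above_finite)
    then show ?case using continuous_on_max[OF cont Suc] by simp
  qed (simp add: cont)
  moreover have "(SUP d. g d x) = (SUP d\<in>{..Suc K}. g d x)" if "x \<in> S" for x
    using zero[OF that] by (rule SUP_eventually_zero)
  ultimately show ?thesis
    using continuous_on_cong[OF refl, of S "\<lambda>x. SUP d. g d x" "\<lambda>x. SUP d\<in>{..Suc K}. g d x"] by blast
qed

lemma gdegs_bound: obtains K where "\<And>d. K < d \<Longrightarrow> gpart deg d f = 0"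
proof -
  obtain K where "\<forall>d\<in>gdegs deg f. d \<le> K"
    using finite_gdegs[of deg f] unfolding finite_nat_set_iff_bounded_le by blast
  then have "gpart deg d f = 0" if "K < d" for d
    using that gpart_eq_0[of d deg f] by force
  then show ?thesis using that by blast
qed

text \<open>\<open>e\<close> expresses the variables as Laurent polynomials after normalizing
  \<open>zv\<close> to 1. The assumptions \<open>e_rel\<close> to \<open>e_T0\<close> serve to
  produce points of \<open>Y\<close> from points of the torus, and \<open>vars\<close> says that
  every point of \<open>dom\<close> arises in this way.\<close>

locale chart = chart0 +
  fixes e :: "yvar \<Rightarrow> 3 torus_mon nov_alg"
  assumes e_rel: "yrel e" and e_zv: "e zv = 1" and e_Y1: "e Y1 = tvar 2" and e_Y2: "e Y2 = tvar 3"
    and e_T0: "yeval const e T0 = tvar 1"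
    and vars: "\<And>p v. p \<in> dom \<Longrightarrow> represents p (vdeg v) (var v) (e v)"
begin

abbreviation ev :: "y_mon nov_alg \<Rightarrow> 3 torus_mon nov_alg"
  where "ev \<equiv> yeval const e"

definition from_torus :: "3 torus_mon berk_pt \<Rightarrow> y_mon berk_pt"
  where "from_torus q = yan_pt (\<lambda>f. q (ev f))"

lemma point_homog: "p \<in> dom \<Longrightarrow> homog d f \<Longrightarrow> p f = p (var zv) ^ d * to_torus p (ev f)"
  by (rule represents_norm) (auto intro: represents_homog vars)

lemma mult_seminorm_ev: "mult_seminorm q \<Longrightarrow> mult_seminorm (\<lambda>f. q (ev f))"
  by (rule mult_seminorm_heval) (simp_all add: ymon_add)

lemma ev_Z_nonzero:
  assumes "mult_seminorm q"
  shows "q (ev (var Z0)) \<noteq> 0 \<or> q (ev (var Z1)) \<noteq> 0"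
  using e_zv zv ms_1[OF assms] by (auto simp: yeval_var[OF nov_hom_const])

abbreviation scale :: "3 torus_mon berk_pt \<Rightarrow> real"
  where "scale q \<equiv> 1 / max (q (e Z0)) (q (e Z1))"

lemma scale_pos:
  assumes "mult_seminorm q"
  shows "0 < scale q"
  using yan_pt_scale[OF mult_seminorm_ev[OF assms] ev_Z_nonzero[OF assms]]
  by (simp only: yeval_var[OF nov_hom_const])

lemma from_torus_homog:
  assumes "mult_seminorm q" "homog d f"
  shows "from_torus q f = scale q ^ d * q (ev f)"
  using yan_pt_homog[OF mult_seminorm_ev[OF assms(1)] ev_Z_nonzero[OF assms(1)] assms(2)]
  by (simp only: from_torus_def yeval_var[OF nov_hom_const])

lemma from_torus_in_dom:
  assumes q: "mult_seminorm q"
  shows "from_torus q \<in> dom"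
proof -
  have "from_torus q \<in> Yan"
    unfolding from_torus_def using tvar_nonzero[OF q]
    by (intro yan_pt_in_Yan[OF mult_seminorm_ev[OF q] ev_Z_nonzero[OF q]])
       (simp_all only: yeval_var[OF nov_hom_const] e_Y1 e_Y2 yeval_rel[OF nov_hom_const e_rel] ms_0[OF q] not_False_eq_True)
  moreover have "from_torus q T0 \<noteq> 0"
    using from_torus_homog[OF q T0] tvar_nonzero[OF q] scale_pos[OF q] by (simp add: e_T0)
  moreover have "from_torus q (var zv) \<noteq> 0"
    using from_torus_homog[OF q homog_var[of zv]] scale_pos[OF q]
    by (simp add: yeval_var[OF nov_hom_const] e_zv ms_1[OF q])
  ultimately show ?thesis by (simp add: dom_def)
qed

lemma ev_den: "ev den = tvar 1 * tvar 2 * tvar 3"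
  by (simp add: den_def yeval_mult[OF nov_hom_const] yeval_power[OF nov_hom_const] e_T0
      yeval_var[OF nov_hom_const] e_zv e_Y1 e_Y2)

lemma tvar_power_shift:
  assumes "\<bar>k\<bar> \<le> int n"
  shows "tvar i ^ nat (int n + k) = tvar i ^ n * single (single i k) 1"
proof -
  have pow: "tvar i ^ n = single (single i (int n)) 1" for n
    by (induction n) (simp_all add: mult_single single_add[symmetric])
  show ?thesis using assms unfolding pow by (simp add: mult_single single_add[symmetric])
qed

text \<open>Clearing denominators is a section of \<open>ev\<close> up to a power of the unit
  \<open>ev den\<close>. Hence the seminorm on the torus is recovered from forms, and every fraction
  on the torus lifts.\<close>

lemma ev_clear:
  assumes "tbound n f"
  shows "ev (clear n f) = ev den ^ n * f"
proof -
  have "ev (const (lookup f m) * cmon n m) = ev den ^ n * single m (lookup f m)"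
    if "m \<in> keys f" for m
  proof -
    have b: "\<bar>lookup m i\<bar> \<le> int n" for i using assms that by (auto simp: tbound_def)
    have sum3: "single 1 (lookup m 1) + single 2 (lookup m 2)
        + single 3 (lookup m 3) = m"
    proof (rule poly_mapping_eqI)
      fix i :: 3
      show "lookup (single 1 (lookup m 1) + single 2 (lookup m 2)
        + single 3 (lookup m 3)) i = lookup m i"
        using exhaust_3[of i] by (auto simp: lookup_add lookup_single when_def)
    qed
    have s: "single (single 1 (lookup m 1)) 1 *
        single (single 2 (lookup m 2)) 1 *
        single (single 3 (lookup m 3)) 1 = (single m 1 :: 3 torus_mon nov_alg)"
      by (simp add: mult_single sum3)
    have "ev (cmon n m) = tvar 1 ^ nat (int n + lookup m 1) *
        tvar 2 ^ nat (int n + lookup m 2) * tvar 3 ^ nat (int n + lookup m 3)"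
      by (simp add: cmon_def yeval_mult[OF nov_hom_const] yeval_power[OF nov_hom_const] e_T0
          yeval_var[OF nov_hom_const] e_zv e_Y1 e_Y2)
    also have "\<dots> = ev den ^ n * single m 1"
      unfolding tvar_power_shift[OF b] ev_den s[symmetric] by (simp only: power_mult_distrib mult_ac)
    finally have "ev (const (lookup f m) * cmon n m) = ev den ^ n * (const (lookup f m) * single m 1)"
      by (simp add: yeval_mult[OF nov_hom_const] yeval_const[OF nov_hom_const] mult_ac)
    then show ?thesis by (simp add: const_def mult_single)
  qed
  then have "ev (clear n f) = (\<Sum>m\<in>keys f. ev den ^ n * single m (lookup f m))"
    unfolding clear_def heval_def[of const "cmon n"] heval_sum[OF nov_hom_const] by (intro sum.cong refl)
  also have "\<dots> = ev den ^ n * f"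
    by (simp only: sum_distrib_left[symmetric] nov_alg_sum_single[symmetric])
  finally show ?thesis .
qed

lemma ev_den_nonzero: "mult_seminorm q \<Longrightarrow> q (ev den) \<noteq> 0"
  using tvar_nonzero by (simp add: ev_den ms_mult)

lemma to_torus_from_torus:
  assumes q: "mult_seminorm q"
  shows "to_torus (from_torus q) = q"
proof
  fix f
  obtain n where n: "tbound n f" using tbound_ex by blast
  have den: "from_torus q den = scale q ^ (2 * 1 * dT) * q (ev den)"
    using from_torus_homog[OF q homog_clear[OF tbound_1[of 1]]] by (simp add: clear_1)
  have "from_torus q (clear n f) = scale q ^ (2 * n * dT) * (q (ev den) ^ n * q f)"
    using from_torus_homog[OF q homog_clear[OF n]] by (simp add: ev_clear[OF n] ms_mult[OF q] ms_power[OF q])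
  also have "\<dots> = from_torus q den ^ n * q f"
    unfolding den by (simp add: power_mult_distrib power_mult[symmetric] mult_ac)
  finally show "to_torus (from_torus q) f = q f"
    using to_torus_eq[OF from_torus_in_dom[OF q] n] domD(5)[OF from_torus_in_dom[OF q]] by simp
qed

lemma from_torus_to_torus:
  assumes p: "p \<in> dom"
  shows "from_torus (to_torus p) = p"
proof
  fix f
  note t = mult_seminorm_to_torus[OF p]
  have z: "p (var Z0) = p (var zv) * to_torus p (e Z0)" "p (var Z1) = p (var zv) * to_torus p (e Z1)"
    using point_homog[OF p homog_var[of Z0]] point_homog[OF p homog_var[of Z1]]
    by (simp_all add: vdeg_def yeval_var[OF nov_hom_const])
  \<comment> \<open>The normalization of |Z0| and |Z1| identifies the rescaling factor of
    \<open>from_torus\<close> with the norm of \<open>zv\<close> at \<open>p\<close>, which is why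
    the round trip returns \<open>p\<close> itself and not just its class.\<close>
  have "1 = p (var zv) * max (to_torus p (e Z0)) (to_torus p (e Z1))"
    using YanD(3)[OF domD(1)[OF p]] ms_nonneg[OF domD(2)[OF p], of "var zv"] unfolding z
    by (simp add: max_mult_distrib_left)
  moreover have "max (to_torus p (e Z0)) (to_torus p (e Z1)) \<noteq> 0" using calculation by auto
  ultimately have c: "scale (to_torus p) = p (var zv)"
    by (simp add: field_simps)
  have "from_torus (to_torus p) f = (SUP d. from_torus (to_torus p) (gpart zdeg d f))"
    by (rule YanD(2)[OF domD(1)[OF from_torus_in_dom[OF t]]])
  also have "\<dots> = (SUP d. p (gpart zdeg d f))"
  proof (rule SUP_cong[OF refl])
    fix d
    have h: "homog d (gpart zdeg d f)" by (simp add: gpart_gpart)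
    show "from_torus (to_torus p) (gpart zdeg d f) = p (gpart zdeg d f)"
      unfolding from_torus_homog[OF t h] point_homog[OF p h] c ..
  qed
  also have "\<dots> = p f" by (rule YanD(2)[OF domD(1)[OF p], symmetric])
  finally show "from_torus (to_torus p) f = p f" .
qed

lemma continuous_to_torus: "continuous_on dom to_torus"
proof (rule continuous_on_coordinatewise_then_product)
  fix f
  obtain n where n: "tbound n f" using tbound_ex by blast
  have "continuous_on dom (\<lambda>p. p (clear n f) / p den ^ n)"
    using domD(5) by (intro continuous_intros) auto
  then show "continuous_on dom (\<lambda>p. to_torus p f)"
    by (rule continuous_on_eq) (simp add: to_torus_eq[OF _ n])
qed

lemma continuous_from_torus: "continuous_on torus_an from_torus"
proof (rule continuous_on_coordinatewise_then_product)
  fix f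
  obtain K where K: "\<And>d. K < d \<Longrightarrow> gpart zdeg d f = 0" by (rule gdegs_bound[of zdeg f]) blast
  have "continuous_on torus_an (\<lambda>q. SUP d. scale q ^ d * q (ev (gpart zdeg d f)))"
  proof (rule continuous_on_SUP_eventually_zero)
    fix d show "continuous_on (torus_an :: 3 torus_mon berk_pt set) (\<lambda>q. scale q ^ d * q (ev (gpart zdeg d f)))"
      using scale_pos by (intro continuous_intros) (force simp: torus_an_def)
  next
    fix d and q :: "3 torus_mon berk_pt" assume "q \<in> torus_an" "K < d"
    then show "scale q ^ d * q (ev (gpart zdeg d f)) = 0"
      using K[of d] ms_0[of q] by (simp add: torus_an_def heval_0[OF nov_hom_const])
  qed
  then show "continuous_on torus_an (\<lambda>q. from_torus q f)"
    by (simp add: from_torus_def yan_pt_def gauss_def yeval_var[OF nov_hom_const])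
qed

lemma analytic_iso_to_torus:
  assumes W: "W \<subseteq> dom"
  shows "analytic_iso y_fracs W UNIV {q\<in>torus_an. from_torus q \<in> W} to_torus"
proof (rule analytic_isoI[where E = ev, OF frac_closed_y_fracs const_in_y_fracs])
  let ?W' = "{q\<in>torus_an. from_torus q \<in> W}"
  show "mult_seminorm x" if "x \<in> W" for x using that W domD(2) by blast
  show "mult_seminorm y" if "y \<in> ?W'" for y using that by (simp add: torus_an_def)
  have "homeomorphic_maps (top_of_set W) (top_of_set ?W') to_torus from_torus"
    unfolding homeomorphic_maps_def
  proof (intro conjI ballI)
    show "continuous_map (top_of_set W) (top_of_set ?W') to_torus"
      using continuous_on_subset[OF continuous_to_torus W] W mult_seminorm_to_torus from_torus_to_torus
      by (auto simp: torus_an_def)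
    show "continuous_map (top_of_set ?W') (top_of_set W) from_torus"
      using continuous_on_subset[OF continuous_from_torus, of ?W'] by auto
  qed (use W from_torus_to_torus to_torus_from_torus in \<open>auto simp: torus_an_def\<close>)
  then show "homeomorphic_map (top_of_set W) (top_of_set ?W') to_torus"
    by (auto simp: homeomorphic_map_maps)
  show "ev (f + g) = ev f + ev g" "ev (f * g) = ev f * ev g" "ev (const c) = const c" for f g c
    by (simp_all add: heval_add yeval_mult yeval_const nov_hom_const)
  show "(x h = 0 \<longleftrightarrow> to_torus x (ev h) = 0) \<and> x g / x h = to_torus x (ev g) / to_torus x (ev h)"
    if x: "x \<in> W" and gh: "(g, h) \<in> y_fracs" for x g h
  proof -
    have xd: "x \<in> dom" using x W by blast
    obtain d where "homog d g" "homog d h" using gh by (auto simp: y_fracs_def zpart_eq_gpart)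
    from this[THEN point_homog[OF xd]] show ?thesis using domD(4)[OF xd] by simp
  qed
  show "\<exists>a\<in>y_fracs. \<exists>u. ev (fst a) = u * fst r \<and> ev (snd a) = u * snd r \<and> (\<forall>x\<in>W. to_torus x u \<noteq> 0)" for r
  proof -
    \<comment> \<open>Numerator and denominator are cleared with a common bound, so that they become
      forms of equal degree and acquire the same factor.\<close>
    obtain n where "tbound n (fst r)" using tbound_ex by blast
    moreover obtain k where "tbound k (snd r)" using tbound_ex by blast
    ultimately have b: "tbound (n + k) (fst r)" "tbound (n + k) (snd r)"
      using tbound_mono by force+
    show ?thesis
    proof (intro bexI exI conjI ballI)
      show "(clear (n + k) (fst r), clear (n + k) (snd r)) \<in> y_fracs"
        using homog_clear[OF b(1)] homog_clear[OF b(2)] by (auto simp: y_fracs_def zpart_eq_gpart)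
      show "ev (fst (clear (n + k) (fst r), clear (n + k) (snd r))) = ev den ^ (n + k) * fst r"
        "ev (snd (clear (n + k) (fst r), clear (n + k) (snd r))) = ev den ^ (n + k) * snd r"
        by (simp_all add: ev_clear b)
      fix x assume "x \<in> W"
      then have t: "mult_seminorm (to_torus x)" using W mult_seminorm_to_torus by blast
      show "to_torus x (ev den ^ (n + k)) \<noteq> 0"
        using ev_den_nonzero[OF t] by (simp add: ms_power[OF t])
    qed
  qed
qed

lemma trop_to_torus:
  assumes p: "p \<in> dom"
  shows "trop (to_torus p) = vector [- ln (p T0 / p (var zv) ^ dT), y_val p Y1, y_val p Y2]"
proof -
  note t = mult_seminorm_to_torus[OF p]
  have "to_torus p (tvar 1) = p T0 / p (var zv) ^ dT"
    using point_homog[OF p T0] domD(4)[OF p] by (simp add: e_T0 field_simps)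
  moreover have "to_torus p (tvar 2) = p (var Y1)" "to_torus p (tvar 3) = p (var Y2)"
    using point_homog[OF p homog_var[of Y1]] point_homog[OF p homog_var[of Y2]]
    by (simp_all add: vdeg_def yeval_var[OF nov_hom_const] e_Y1 e_Y2)
  ultimately show ?thesis
    using tvar_nonzero[OF t] YanD(4,5)[OF domD(1)[OF p]]
    by (simp add: vec_eq_iff forall_3 trop_def pt_val_def y_val_def vector_3)
qed

end

section \<open>The three charts\<close>

definition chart_z :: "yvar \<Rightarrow> 3 torus_mon nov_alg"
  where "chart_z = (\<lambda>v. case v of X1 \<Rightarrow> (1 + tvar 2) * tinv 1 | X2 \<Rightarrow> (1 + tvar 3) * tvar 1
    | Z0 \<Rightarrow> tvar 1 | Z1 \<Rightarrow> 1 | Y1 \<Rightarrow> tvar 2 | Y2 \<Rightarrow> tvar 3)"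

text \<open>Here z = (1 + y_1) / x_1 need not be invertible, so the points with y_1 = -1, where z =
  0, belong to this chart.\<close>

definition chart_x1 :: "yvar \<Rightarrow> 3 torus_mon nov_alg"
  where "chart_x1 = (\<lambda>v. case v of X1 \<Rightarrow> tvar 1 | X2 \<Rightarrow> (1 + tvar 3) * ((1 + tvar 2) * tinv 1)
    | Z0 \<Rightarrow> (1 + tvar 2) * tinv 1 | Z1 \<Rightarrow> 1 | Y1 \<Rightarrow> tvar 2 | Y2 \<Rightarrow> tvar 3)"

text \<open>Normalized by \<open>Z0 = 1\<close>: the inverse of z is (1 + y_2) / x_2, and the points
  with y_2 = -1, where z is infinite, are included.\<close>

definition chart_x2 :: "yvar \<Rightarrow> 3 torus_mon nov_alg"
  where "chart_x2 = (\<lambda>v. case v of X1 \<Rightarrow> (1 + tvar 2) * ((1 + tvar 3) * tinv 1) | X2 \<Rightarrow> tvar 1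
    | Z0 \<Rightarrow> 1 | Z1 \<Rightarrow> (1 + tvar 3) * tinv 1 | Y1 \<Rightarrow> tvar 2 | Y2 \<Rightarrow> tvar 3)"

lemma (in chart0) represents_rel:
  assumes p: "p \<in> dom" and "represents p 0 f l" "represents p 1 (var w) k"
    and rel: "p (var x * var z - f * var w) = 0"
  shows "represents p 1 (var x * var z) (l * k)"
  using represents_cong[OF p represents_mult[OF p assms(2,3)] rel] by simp

lemma (in chart0) represents_one_plus: "p \<in> dom \<Longrightarrow> represents p 0 (1 + var Y1) (1 + tvar 2)"
  "p \<in> dom \<Longrightarrow> represents p 0 (1 + var Y2) (1 + tvar 3)"
  by (simp_all add: represents_add represents_1 represents_Y)

lemma mult_tinv_tvar: "a * tinv i * tvar i = a"
  by (simp only: mult.assoc tinv_tvar mult_1_right)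

lemma mult_tvar_tinv: "tvar i * (a * tinv i) = a"
  by (simp only: mult.left_commute[of _ a] tvar_tinv mult_1_right)

interpretation cz: chart0 "var Z0" Z1 1
  by unfold_locales (use homog_var[of Z0] in \<open>simp_all add: vdeg_def\<close>)

interpretation cx1: chart0 "var X1" Z1 0
  by unfold_locales (use homog_var[of X1] in \<open>simp_all add: vdeg_def\<close>)

interpretation cx2: chart0 "var X2" Z0 0
  by unfold_locales (use homog_var[of X2] in \<open>simp_all add: vdeg_def\<close>)

interpretation cz: chart "var Z0" Z1 1 chart_z
proof unfold_locales
  show "yrel chart_z"
    by (simp add: yrel_def chart_z_def mult_tinv_tvar)
  show "yeval const chart_z (var Z0) = tvar 1"
    by (simp add: yeval_var[OF nov_hom_const] chart_z_def)
  fix p v assume p: "p \<in> cz.dom"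
  note D = cz.domD[OF p] and R = cz.represents_rel[OF p]
  have Z: "cz.represents p 1 (var Z0) (tvar 1)" "cz.represents p 1 (var Z1) 1"
    using cz.represents_T0[OF p] cz.represents_zv[OF p] by simp_all
  have X1: "cz.represents p 0 (var X1) ((1 + tvar 2) * tinv 1)"
    by (rule cz.represents_cancel[OF p _ Z(1) D(3)])
       (use R[OF cz.represents_one_plus(1)[OF p] Z(2) YanD(6)[OF D(1)]] in \<open>simp add: mult_tinv_tvar\<close>)
  have X2: "cz.represents p 0 (var X2) ((1 + tvar 3) * tvar 1)"
    by (rule cz.represents_cancel[OF p _ Z(2) D(4)])
       (use R[OF cz.represents_one_plus(2)[OF p] Z(1) YanD(7)[OF D(1)]] in simp)
  show "cz.represents p (vdeg v) (var v) (chart_z v)"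
    using X1 X2 Z cz.represents_Y[OF p] by (cases v) (simp_all add: vdeg_def chart_z_def)
qed (simp_all add: chart_z_def)

interpretation cx1: chart "var X1" Z1 0 chart_x1
proof unfold_locales
  show "yrel chart_x1"
    by (simp add: yrel_def chart_x1_def mult_tvar_tinv)
  show "yeval const chart_x1 (var X1) = tvar 1"
    by (simp add: yeval_var[OF nov_hom_const] chart_x1_def)
  fix p v assume p: "p \<in> cx1.dom"
  note D = cx1.domD[OF p] and R = cx1.represents_rel[OF p]
  have X1: "cx1.represents p 0 (var X1) (tvar 1)" and Z1: "cx1.represents p 1 (var Z1) 1"
    using cx1.represents_T0[OF p] cx1.represents_zv[OF p] by simp_all
  have Z0: "cx1.represents p 1 (var Z0) ((1 + tvar 2) * tinv 1)"
    by (rule cx1.represents_cancel[OF p _ X1 D(3)])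
       (use R[OF cx1.represents_one_plus(1)[OF p] Z1 YanD(6)[OF D(1)]] in \<open>simp add: mult_tinv_tvar mult.commute[of "var Z0"]\<close>)
  have X2: "cx1.represents p 0 (var X2) ((1 + tvar 3) * ((1 + tvar 2) * tinv 1))"
    by (rule cx1.represents_cancel[OF p _ Z1 D(4)])
       (use R[OF cx1.represents_one_plus(2)[OF p] Z0 YanD(7)[OF D(1)]] in simp)
  show "cx1.represents p (vdeg v) (var v) (chart_x1 v)"
    using X1 X2 Z0 Z1 cx1.represents_Y[OF p] by (cases v) (simp_all add: vdeg_def chart_x1_def)
qed (simp_all add: chart_x1_def)

interpretation cx2: chart "var X2" Z0 0 chart_x2
proof unfold_locales
  show "yrel chart_x2"
    by (simp add: yrel_def chart_x2_def mult_tvar_tinv)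
  show "yeval const chart_x2 (var X2) = tvar 1"
    by (simp add: yeval_var[OF nov_hom_const] chart_x2_def)
  fix p v assume p: "p \<in> cx2.dom"
  note D = cx2.domD[OF p] and R = cx2.represents_rel[OF p]
  have X2: "cx2.represents p 0 (var X2) (tvar 1)" and Z0: "cx2.represents p 1 (var Z0) 1"
    using cx2.represents_T0[OF p] cx2.represents_zv[OF p] by simp_all
  have Z1: "cx2.represents p 1 (var Z1) ((1 + tvar 3) * tinv 1)"
    by (rule cx2.represents_cancel[OF p _ X2 D(3)])
       (use R[OF cx2.represents_one_plus(2)[OF p] Z0 YanD(7)[OF D(1)]] in \<open>simp add: mult_tinv_tvar mult.commute[of "var Z1"]\<close>)
  have X1: "cx2.represents p 0 (var X1) ((1 + tvar 2) * ((1 + tvar 3) * tinv 1))"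
    by (rule cx2.represents_cancel[OF p _ Z0 D(4)])
       (use R[OF cx2.represents_one_plus(1)[OF p] Z1 YanD(6)[OF D(1)]] in simp)
  show "cx2.represents p (vdeg v) (var v) (chart_x2 v)"
    using X1 X2 Z0 Z1 cx2.represents_Y[OF p] by (cases v) (simp_all add: vdeg_def chart_x2_def)
qed (simp_all add: chart_x2_def)


section \<open>The map \<open>F\<close> and its base\<close>

lemma ln_max: "0 < a \<Longrightarrow> 0 < b \<Longrightarrow> ln (max a b) = max (ln a) (ln (b::real))"
  by (simp add: max_def)

text \<open>The minimum with a real number is finite even where \<open>f\<close> vanishes, so no
  default value of \<open>real_of_ereal\<close> enters; the right side is visibly continuous in
  \<open>p f\<close>.\<close>

lemma real_min_pt_val:
  assumes "0 \<le> p f"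
  shows "real_of_ereal (min (pt_val p f) (ereal B)) = - ln (max (p f) (exp (- B)))"
proof (cases "p f = 0")
  case False
  then have "ln (max (p f) (exp (- B))) = max (ln (p f)) (- B)" using assms by (simp add: ln_max)
  then show ?thesis using False by (auto simp: pt_val_def min_def max_def)
qed (simp add: pt_val_def max_def)

text \<open>The value of \<open>median (z + k) lo hi\<close> in terms of the norms \<open>a0\<close>, \<open>a1\<close> of the homogeneous
  coordinates, in a form that is continuous also at \<open>z = 0\<close> and \<open>z = \<infinity>\<close>.\<close>

definition zclamp :: "real \<Rightarrow> real \<Rightarrow> real \<Rightarrow> real \<Rightarrow> real \<Rightarrow> real"
  where "zclamp lo hi k a0 a1 = ln (max a1 (exp (lo - k) * max a0 (exp (k - hi) * a1)))
    - ln (max a0 (exp (k - hi) * a1)) + k"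

lemma zclamp_eq:
  assumes "lo < hi" "a0 > 0" "a1 > 0"
  shows "zclamp lo hi k a0 a1 = median (- ln (a0 / a1) + k) hi lo"
proof -
  have M: "max a0 (exp (k - hi) * a1) > 0" using assms by (simp add: less_max_iff_disj)
  have "ln (max a0 (exp (k - hi) * a1)) = max (ln a0) (k - hi + ln a1)"
    using assms by (simp add: ln_max ln_mult)
  moreover from this have "ln (max a1 (exp (lo - k) * max a0 (exp (k - hi) * a1))) =
      max (ln a1) (lo - k + max (ln a0) (k - hi + ln a1))"
    using assms M by (simp add: ln_max ln_mult)
  ultimately show ?thesis
    using assms by (simp add: zclamp_def median_def ln_div max_def min_def)
qed

lemma zclamp_0: "lo < hi \<Longrightarrow> a1 > 0 \<Longrightarrow> zclamp lo hi k 0 a1 = hi"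
  by (simp add: zclamp_def ln_mult max_def exp_add[symmetric] mult.assoc[symmetric])

lemma zclamp_infinity: "a0 > 0 \<Longrightarrow> zclamp lo hi k a0 0 = lo"
  by (simp add: zclamp_def ln_mult max_def)

text \<open>The last hypothesis says that the valuation of z plus \<open>k\<close> is at least
  \<open>hi\<close>, multiplied out so that z = 0 is covered too.\<close>

lemma zclamp_hi:
  assumes "lo < hi" "a1 > 0" "a0 \<le> exp (k - hi) * a1"
  shows "zclamp lo hi k a0 a1 = hi"
proof -
  have "exp (lo - k) * (exp (k - hi) * a1) = exp (lo - hi) * a1"
    by (simp add: mult.assoc[symmetric] exp_add[symmetric])
  also have "\<dots> \<le> a1" using assms by simp
  finally show ?thesis using assms by (simp add: zclamp_def ln_mult max_def)
qed

lemma zclamp_lo: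
  assumes "lo < hi" "a0 > 0" "0 \<le> a1" "a1 \<le> exp (lo - k) * a0"
  shows "zclamp lo hi k a0 a1 = lo"
proof -
  have "exp (k - hi) * a1 \<le> exp (k - hi) * (exp (lo - k) * a0)" using assms by simp
  also have "\<dots> = exp (lo - hi) * a0" by (simp add: mult.assoc[symmetric] exp_add[symmetric])
  also have "\<dots> \<le> a0" using assms by simp
  finally show ?thesis using assms by (simp add: zclamp_def ln_mult max_def)
qed

lemma median_ereal: "median (ereal a) (ereal b) (ereal c) = ereal (median a b c)"
  by (simp add: median_def)

lemma zclamp_range:
  assumes "lo < hi" "0 \<le> a0" "0 \<le> a1" "max a0 a1 = 1"
  shows "zclamp lo hi k a0 a1 \<in> {lo..hi}"
proof -
  consider "a0 = 0" "a1 > 0" | "a1 = 0" "a0 > 0" | "a0 > 0" "a1 > 0"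
    using assms by (cases "a0 = 0"; cases "a1 = 0") auto
  then show ?thesis
    using assms(1) by cases (auto simp: zclamp_0 zclamp_infinity zclamp_eq median_def)
qed

text \<open>The parametrization of \<open>F(Y)\<close> by \<open>(q\<^sub>1, q\<^sub>2, s)\<close>, and its inverse.\<close>

definition PS :: "real \<Rightarrow> real \<Rightarrow> (real3 \<Rightarrow> real) \<Rightarrow> real3 \<Rightarrow> real5"
  where "PS c1 c2 \<psi> = (\<lambda>(q1, q2, s). (min 0 q1 + min 0 q2 - max s (psi_at \<psi> c1 q1 q2),
    min s (psi_at \<psi> c2 q1 q2), median s (psi_at \<psi> c1 q1 q2) (psi_at \<psi> c2 q1 q2), q1, q2))"

definition PS_inv :: "real \<Rightarrow> real \<Rightarrow> (real3 \<Rightarrow> real) \<Rightarrow> real5 \<Rightarrow> real3"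
  where "PS_inv c1 c2 \<psi> = (\<lambda>(u1, u2, v, q1, q2).
    (q1, q2, min 0 q1 + min 0 q2 - u1 + u2 + v - psi_at \<psi> c1 q1 q2 - psi_at \<psi> c2 q1 q2))"

locale psi =
  fixes c1 c2 :: real and \<psi> :: "real3 \<Rightarrow> real"
  assumes c: "c2 < c1" "0 < c2" and psi_continuous: "continuous_on UNIV \<psi>"
    and psi_mono: "\<And>q1 q2. strict_mono (\<lambda>q3. \<psi> (q1, q2, q3))"
    and psi_range: "\<And>q1 q2. range (\<lambda>q3. \<psi> (q1, q2, q3)) = {0<..}"
begin

abbreviation "F \<equiv> F_map c1 c2 \<psi>"
abbreviation "P1 q1 q2 \<equiv> psi_at \<psi> c1 q1 q2"
abbreviation "P2 q1 q2 \<equiv> psi_at \<psi> c2 q1 q2"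
abbreviation "ps \<equiv> PS c1 c2 \<psi>"
abbreviation "ps_inv \<equiv> PS_inv c1 c2 \<psi>"

lemma psi_at_less: "P2 q1 q2 < P1 q1 q2"
  using psi_mono[of q1 q2] c by (simp add: psi_at_def strict_mono_def)

lemma psi_pos: "0 < \<psi> (q1, q2, q3)"
  using psi_range[of q1 q2] by (metis greaterThan_iff rangeI)

lemma psi_at_pos: "0 < psi_at \<psi> a q1 q2"
  by (simp add: psi_at_def psi_pos)

lemma continuous_on_psi_at [continuous_intros]:
  assumes "continuous_on S f" "continuous_on S g"
  shows "continuous_on S (\<lambda>x. psi_at \<psi> a (f x) (g x))"
  unfolding psi_at_def
  by (rule continuous_on_compose2[OF psi_continuous]) (intro continuous_intros assms, simp)

text \<open>Because \<open>P2 < P1\<close>, the numbers \<open>max s P1\<close>,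
  \<open>min s P2\<close> and the median are the triple \<open>s, P1, P2\<close> in sorted order.
  Their sum is \<open>s + P1 + P2\<close>, so \<open>s\<close> is an affine function of the
  coordinates and of \<open>P1\<close>, \<open>P2\<close>.\<close>

lemma ps_inv_ps: "ps_inv (ps x) = x"
  using psi_at_less[of "fst x" "fst (snd x)"]
  by (cases x) (auto simp: PS_def PS_inv_def median_def max_def min_def)

lemma ps_inject: "ps x = ps y \<longleftrightarrow> x = y"
  by (metis ps_inv_ps)

lemma continuous_on_ps: "continuous_on S ps"
  unfolding PS_def case_prod_unfold median_def by (intro continuous_intros)

lemma continuous_on_ps_inv: "continuous_on S ps_inv"
  unfolding PS_inv_def case_prod_unfold by (intro continuous_intros)

lemma homeomorphism_ps: "homeomorphism UNIV (range ps) ps ps_inv"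
  by (simp add: homeomorphism_def ps_inv_ps continuous_on_ps continuous_on_ps_inv image_image)

lemma F_eq:
  assumes p: "p \<in> Yan"
  defines "q1 \<equiv> y_val p Y1" and "q2 \<equiv> y_val p Y2"
  shows "F p = (- ln (max (p (var X1)) (exp (P1 q1 q2 - min 0 q1 - min 0 q2))),
    - ln (max (p (var X2)) (exp (- P2 q1 q2))),
    zclamp (P2 q1 q2) (P1 q1 q2) (min 0 q2) (p (var Z0)) (p (var Z1)), q1, q2)"
proof -
  note ms = YanD(1)[OF p]
  note nn = ms_nonneg[OF ms]
  have max1: "max (p (var Z0)) (p (var Z1)) = 1" by (rule YanD(3)[OF p])
  consider (zero) "p (var Z0) = 0" "p (var Z1) = 1" | (inf) "p (var Z1) = 0" "p (var Z0) = 1"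
    | (gen) "p (var Z0) > 0" "p (var Z1) > 0"
    using max1 nn[of "var Z0"] nn[of "var Z1"] by (fastforce simp: max_def split: if_splits)
  then have "real_of_ereal (median (z_val p + ereal k) (ereal (P1 q1 q2)) (ereal (P2 q1 q2))) =
      zclamp (P2 q1 q2) (P1 q1 q2) k (p (var Z0)) (p (var Z1))" for k
  proof cases
    case zero
    then show ?thesis using psi_at_less[of q1 q2] by (simp add: z_val_def pt_val_def zclamp_0 median_def)
  next
    case inf
    then show ?thesis using psi_at_less[of q1 q2] by (simp add: z_val_def pt_val_def zclamp_infinity median_def)
  next
    case gen
    then show ?thesis using psi_at_less[of q1 q2]
      by (simp add: z_val_def pt_val_def zclamp_eq median_ereal ln_div)
  qed
  from this[of "min 0 q2"] show ?thesis
    using real_min_pt_val[of p "var X1" "- P1 q1 q2 + min 0 q1 + min 0 q2"] real_min_pt_val[of p "var X2" "P2 q1 q2"] nn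
    by (simp add: F_map_def Let_def q1_def[symmetric] q2_def[symmetric])
qed

lemma y_val_eq: "p \<in> Yan \<Longrightarrow> y_val p Y1 = - ln (p (var Y1))" "p \<in> Yan \<Longrightarrow> y_val p Y2 = - ln (p (var Y2))"
  using YanD(4,5)[of p] by (simp_all add: y_val_def pt_val_def)

lemma continuous_on_y_val: "continuous_on Yan (\<lambda>p. y_val p Y1)" "continuous_on Yan (\<lambda>p. y_val p Y2)"
proof -
  have "continuous_on Yan (\<lambda>p. - ln (p (var Y1)))" "continuous_on Yan (\<lambda>p. - ln (p (var Y2)))"
    using YanD(4,5) by (auto intro!: continuous_intros)
  then show "continuous_on Yan (\<lambda>p. y_val p Y1)" "continuous_on Yan (\<lambda>p. y_val p Y2)"
    by (auto elim!: continuous_on_eq simp: y_val_eq)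
qed

text \<open>The bounds inside \<open>F\<close> keep every argument of a logarithm positive: for x_1
  and x_2 by the exponential term, for z because |Z0| and |Z1| do not vanish together.\<close>

lemma continuous_on_F: "continuous_on Yan F"
proof -
  have pos: "0 < max (p (var Z0)) (exp a * p (var Z1))" if "p \<in> Yan" for p a
    using YanD(3)[OF that] ms_nonneg[OF YanD(1)[OF that], of "var Z0"] ms_nonneg[OF YanD(1)[OF that], of "var Z1"]
    by (cases "p (var Z1) = 0") (auto simp: less_max_iff_disj)
  have pos2: "0 < max (p (var Z1)) (exp b * max (p (var Z0)) (exp a * p (var Z1)))" if "p \<in> Yan" for p a b
    using pos[OF that, of a] by (simp add: less_max_iff_disj)
  have "max (p f) (exp a) \<noteq> 0" for p :: "y_mon berk_pt" and f a
    by (metis exp_gt_zero less_max_iff_disj less_irrefl)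
  then show ?thesis
    using continuous_on_y_val pos pos2
    by (intro continuous_on_eq[OF _ F_eq[symmetric]]) (auto intro!: continuous_intros simp: zclamp_def less_imp_neq[THEN not_sym])
qed

section \<open>Values of \<open>F\<close> in terms of the norms at a point\<close>

context
  fixes p q1 q2 k m r1 r2
  assumes p: "p \<in> Yan"
  defines "q1 \<equiv> y_val p Y1" and "q2 \<equiv> y_val p Y2" and "k \<equiv> min 0 q2" and "m \<equiv> min 0 q1 + min 0 q2"
    and "r1 \<equiv> p (1 + var Y1)" and "r2 \<equiv> p (1 + var Y2)"
begin

lemma Yan_rel:
  "p (var X1) * p (var Z0) = r1 * p (var Z1)" "p (var X2) * p (var Z1) = r2 * p (var Z0)"
  using ms_eq_of_diff[OF YanD(1)[OF p] YanD(6)[OF p]] ms_eq_of_diff[OF YanD(1)[OF p] YanD(7)[OF p]]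
  by (simp_all add: ms_mult[OF YanD(1)[OF p]] r1_def r2_def)

lemma Yan_nonneg: "0 \<le> p f"
  by (rule ms_nonneg[OF YanD(1)[OF p]])

lemma Yan_one_plus:
  "r1 \<le> exp (- min 0 q1)" "q1 \<noteq> 0 \<Longrightarrow> r1 = exp (- min 0 q1)"
  "r2 \<le> exp (- min 0 q2)" "q2 \<noteq> 0 \<Longrightarrow> r2 = exp (- min 0 q2)"
proof -
  have y: "p (var Y1) = exp (- q1)" "p (var Y2) = exp (- q2)"
    using YanD(4,5)[OF p] Yan_nonneg[of "var Y1"] Yan_nonneg[of "var Y2"]
    by (simp_all add: q1_def q2_def y_val_eq[OF p])
  have mx: "max 1 (exp (- q)) = exp (- min 0 q)" for q :: real by (simp add: max_def min_def)
  note op = ms_one_plus[OF YanD(1)[OF p]]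
  show "r1 \<le> exp (- min 0 q1)" "q1 \<noteq> 0 \<Longrightarrow> r1 = exp (- min 0 q1)"
    using op[of "var Y1"] unfolding y mx r1_def by simp_all
  show "r2 \<le> exp (- min 0 q2)" "q2 \<noteq> 0 \<Longrightarrow> r2 = exp (- min 0 q2)"
    using op[of "var Y2"] unfolding y mx r2_def by simp_all
qed

lemma F_eq': "F p = (- ln (max (p (var X1)) (exp (P1 q1 q2 - m))), - ln (max (p (var X2)) (exp (- P2 q1 q2))),
    zclamp (P2 q1 q2) (P1 q1 q2) k (p (var Z0)) (p (var Z1)), q1, q2)"
  using F_eq[OF p] by (simp add: q1_def q2_def k_def m_def diff_diff_eq)

text \<open>Beyond the wall of x_1, the equation x_1 z = 1 + y_1 makes z so small that the bounds on
  z and on x_2 take over; only x_1 and q remain visible in \<open>F\<close>.\<close>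

lemma F_x1:
  assumes b: "exp (P1 q1 q2 - m) < p (var X1)"
  shows "F p = ps (q1, q2, m + ln (p (var X1)))" "p (var Z1) > 0" "P1 q1 q2 < m + ln (p (var X1))"
proof -
  let ?a0 = "p (var Z0)" and ?a1 = "p (var Z1)" and ?b1 = "p (var X1)" and ?b2 = "p (var X2)"
  have b1: "?b1 > 0" using b by (meson exp_gt_zero order.strict_trans)
  show a1: "?a1 > 0"
    using Yan_rel(1) b1 YanD(3)[OF p] Yan_nonneg[of "var Z1"] by (cases "?a1 = 0") auto
  have a0: "?a0 \<le> exp (k - P1 q1 q2) * ?a1"
  proof -
    have "exp (P1 q1 q2 - m) * ?a0 \<le> r1 * ?a1"
      using b Yan_nonneg[of "var Z0"] unfolding Yan_rel(1)[symmetric] by (intro mult_right_mono) auto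
    also have "\<dots> \<le> exp (- min 0 q1) * ?a1" using Yan_one_plus(1) a1 by (intro mult_right_mono) auto
    finally have "?a0 \<le> exp (- min 0 q1) * ?a1 / exp (P1 q1 q2 - m)"
      by (simp add: field_simps)
    also have "\<dots> = exp (k - P1 q1 q2) * ?a1"
      by (simp add: k_def m_def exp_diff exp_add exp_minus field_simps)
    finally show ?thesis .
  qed
  have "?b2 \<le> exp (- P2 q1 q2)"
  proof -
    have "?b2 * ?a1 \<le> exp (- min 0 q2) * ?a0"
      unfolding Yan_rel(2) using Yan_one_plus(3) Yan_nonneg by (intro mult_right_mono) auto
    also have "\<dots> \<le> exp (- min 0 q2) * (exp (k - P1 q1 q2) * ?a1)" using a0 by simp
    also have "\<dots> = exp (- P1 q1 q2) * ?a1" by (simp add: k_def mult.assoc[symmetric] exp_add[symmetric])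
    also have "\<dots> \<le> exp (- P2 q1 q2) * ?a1" using a1 psi_at_less[of q1 q2] by simp
    finally show ?thesis using a1 by simp
  qed
  moreover have "ln (exp (P1 q1 q2 - m)) < ln ?b1" using b b1 by (subst ln_less_cancel_iff) auto
  then show s: "P1 q1 q2 < m + ln ?b1" by simp
  ultimately show "F p = ps (q1, q2, m + ln ?b1)"
    using b psi_at_less[of q1 q2] s
    by (simp add: F_eq' PS_def zclamp_hi[OF psi_at_less a1 a0] median_def m_def max_def min_def)
qed

text \<open>The mirror image at z infinite: large x_2 makes 1/z small by x_2 / z = 1 + y_2, and then
  x_1 is concealed by its bound.\<close>

lemma F_x2:
  assumes b: "exp (- P2 q1 q2) < p (var X2)"
  shows "F p = ps (q1, q2, - ln (p (var X2)))" "p (var Z0) > 0" "- ln (p (var X2)) < P2 q1 q2"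
proof -
  let ?a0 = "p (var Z0)" and ?a1 = "p (var Z1)" and ?b1 = "p (var X1)" and ?b2 = "p (var X2)"
  have b2: "?b2 > 0" using b by (meson exp_gt_zero order.strict_trans)
  show a0: "?a0 > 0"
    using Yan_rel(2) b2 YanD(3)[OF p] Yan_nonneg[of "var Z0"] by (cases "?a0 = 0") auto
  have a1: "?a1 \<le> exp (P2 q1 q2 - k) * ?a0"
  proof -
    have "exp (- P2 q1 q2) * ?a1 \<le> r2 * ?a0"
      using b Yan_nonneg[of "var Z1"] unfolding Yan_rel(2)[symmetric] by (intro mult_right_mono) auto
    also have "\<dots> \<le> exp (- min 0 q2) * ?a0" using Yan_one_plus(3) a0 by (intro mult_right_mono) auto
    finally have "?a1 \<le> exp (- min 0 q2) * ?a0 / exp (- P2 q1 q2)"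
      by (simp add: field_simps)
    also have "\<dots> = exp (P2 q1 q2 - k) * ?a0"
      by (simp add: k_def exp_diff exp_minus field_simps)
    finally show ?thesis .
  qed
  have "?b1 \<le> exp (P1 q1 q2 - m)"
  proof -
    have "?b1 * ?a0 \<le> exp (- min 0 q1) * ?a1"
      unfolding Yan_rel(1) using Yan_one_plus(1) Yan_nonneg by (intro mult_right_mono) auto
    also have "\<dots> \<le> exp (- min 0 q1) * (exp (P2 q1 q2 - k) * ?a0)" using a1 by simp
    also have "\<dots> = exp (P2 q1 q2 - m) * ?a0"
      by (simp add: k_def m_def mult.assoc[symmetric] exp_add[symmetric] algebra_simps)
    also have "\<dots> \<le> exp (P1 q1 q2 - m) * ?a0" using a0 psi_at_less[of q1 q2] by simp
    finally show ?thesis using a0 by simp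
  qed
  moreover have "ln (exp (- P2 q1 q2)) < ln ?b2" using b b2 by (subst ln_less_cancel_iff) auto
  then show s: "- ln ?b2 < P2 q1 q2" by simp
  ultimately show "F p = ps (q1, q2, - ln ?b2)"
    using b psi_at_less[of q1 q2] s
    by (simp add: F_eq' PS_def zclamp_lo[OF psi_at_less a0 Yan_nonneg a1] median_def m_def max_def min_def)
qed

text \<open>With x_1 and x_2 both at their bounds only the clamped z varies, and by
  \<open>zclamp_range\<close> it stays between the walls, where it is the parameter itself.\<close>

lemma F_else:
  assumes "p (var X1) \<le> exp (P1 q1 q2 - m)" "p (var X2) \<le> exp (- P2 q1 q2)"
  shows "F p = ps (q1, q2, zclamp (P2 q1 q2) (P1 q1 q2) k (p (var Z0)) (p (var Z1)))"
  using assms psi_at_less[of q1 q2] zclamp_range[OF psi_at_less Yan_nonneg Yan_nonneg YanD(3)[OF p], of q1 q2 k]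
  by (simp add: F_eq' PS_def median_def m_def max_def min_def)

lemma F_in_range: obtains s where "F p = ps (q1, q2, s)"
  using F_x1(1) F_x2(1) F_else by (meson not_le)

text \<open>For each i, either 1 + y_i has maximal norm, so that z determines the norm of x_i, or z
  lies on the side of the wall where x_i is concealed by its bound.\<close>

lemma F_mid:
  assumes a: "p (var Z0) > 0" "p (var Z1) > 0"
  defines "z \<equiv> - ln (p (var Z0) / p (var Z1)) + k"
  assumes 1: "r1 = exp (- min 0 q1) \<or> z \<le> P1 q1 q2" and 2: "r2 = exp (- min 0 q2) \<or> P2 q1 q2 \<le> z"
  shows "F p = ps (q1, q2, z)"
proof -
  let ?a0 = "p (var Z0)" and ?a1 = "p (var Z1)"
  \<comment> \<open>If \<open>x\<close> falls short of \<open>exp u\<close>, then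
    \<open>u \<le> v\<close> and the bound \<open>exp v\<close> decides the maximum in either
    form.\<close>
  have ln_max_exp: "ln (max x (exp v)) = max u v" if "x \<le> exp u" "x = exp u \<or> u \<le> v" for x u v :: real
    using that order_trans[OF that(1), of "exp v"] by (auto simp: max_def)
  have "exp (z - k) = exp (ln (?a1 / ?a0))" using a by (simp add: z_def ln_div)
  then have e: "?a1 / ?a0 = exp (z - k)" "?a0 / ?a1 = exp (k - z)"
    using a by (simp_all add: exp_diff field_simps)
  have b1: "p (var X1) = r1 * exp (z - k)" "p (var X2) = r2 * exp (k - z)"
    using Yan_rel a by (simp_all add: e[symmetric] field_simps)
  have e1: "exp (- min 0 q1) * exp (z - k) = exp (z - m)" and e2: "exp (- min 0 q2) * exp (k - z) = exp (- z)"
    by (simp_all add: exp_add[symmetric] k_def m_def algebra_simps)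
  have "ln (max (p (var X1)) (exp (P1 q1 q2 - m))) = max (z - m) (P1 q1 q2 - m)"
  proof (rule ln_max_exp)
    show "p (var X1) \<le> exp (z - m)" unfolding b1 e1[symmetric] using Yan_one_plus(1) by simp
    show "p (var X1) = exp (z - m) \<or> z - m \<le> P1 q1 q2 - m" using 1 b1 e1 by auto
  qed
  moreover have "ln (max (p (var X2)) (exp (- P2 q1 q2))) = max (- z) (- P2 q1 q2)"
  proof (rule ln_max_exp)
    show "p (var X2) \<le> exp (- z)" unfolding b1 e2[symmetric] using Yan_one_plus(3) by simp
    show "p (var X2) = exp (- z) \<or> - z \<le> - P2 q1 q2" using 2 b1 e2 by auto
  qed
  moreover have "zclamp (P2 q1 q2) (P1 q1 q2) k ?a0 ?a1 = median z (P1 q1 q2) (P2 q1 q2)"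
    unfolding z_def by (rule zclamp_eq[OF psi_at_less a])
  ultimately show ?thesis
    unfolding F_eq' PS_def by (simp add: m_def max_def min_def)
qed

end

text \<open>At \<open>q = 0\<close> the sum is 2, which still has norm 1: a monomial with
  coefficient 1 never cancels against 1.\<close>

lemma nov_norm_one_plus_monom: "nov_norm (1 + nov_monom 1 q) = exp (- min 0 q)"
proof (rule nov_norm_eq)
  show "nov_coeff (1 + nov_monom 1 q) (min 0 q) \<noteq> 0"
    by (auto simp: nov_coeff_one nov_coeff_monom min_def)
qed (auto simp: nov_coeff_one nov_coeff_monom split: if_splits)

lemma nov_monom_nonzero: "nov_monom 1 a \<noteq> 0"
  using nov_norm_monom[of 1 a] by auto

lemma nov_monom_inverse: "nov_monom 1 (- a) * nov_monom 1 a = 1"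
  by (rule nov_eqI) (simp add: nov_coeff_monom_times nov_coeff_monom nov_coeff_one)

lemma ps_in_F: "ps (q1, q2, s) \<in> F ` Yan"
proof -
  \<comment> \<open>The valuation of z; the parameter of the point is this valuation plus
    \<open>min 0 q2\<close>.\<close>
  define a where "a = s - min 0 q2"
  \<comment> \<open>A point with values in the Novikov field: y_1, y_2, z are pure powers of T and
    x_1, x_2 are solved from the equations. Both 1 + y_i have maximal norm, so \<open>F_mid\<close>
    applies for every \<open>s\<close>.\<close>
  define e where "e = (\<lambda>v. case v of X1 \<Rightarrow> (1 + nov_monom 1 q1) * nov_monom 1 (- a)
    | X2 \<Rightarrow> (1 + nov_monom 1 q2) * nov_monom 1 a | Z0 \<Rightarrow> nov_monom 1 a | Z1 \<Rightarrow> 1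
    | Y1 \<Rightarrow> nov_monom 1 q1 | Y2 \<Rightarrow> nov_monom 1 q2)"
  define N where "N f = nov_norm (yeval (\<lambda>x. x) e f)" for f
  have N: "mult_seminorm N"
    unfolding N_def by (rule mult_seminorm_heval_norm) (simp_all add: ymon_add)
  have var: "N (var v) = nov_norm (e v)" for v by (simp add: N_def yeval_var[OF nov_hom_id])
  have rel: "yrel e" by (simp add: yrel_def e_def mult.assoc nov_monom_inverse)
  have nz: "N (var Z0) \<noteq> 0 \<or> N (var Z1) \<noteq> 0" by (simp add: var e_def)
  let ?p = "yan_pt N"
  have p: "?p \<in> Yan"
  proof (rule yan_pt_in_Yan[OF N nz])
    show "N (var Y1) \<noteq> 0" "N (var Y2) \<noteq> 0" by (simp_all add: var e_def nov_monom_nonzero)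
    show "N (var X1 * var Z0 - (1 + var Y1) * var Z1) = 0" "N (var X2 * var Z1 - (1 + var Y2) * var Z0) = 0"
      by (simp_all add: N_def yeval_rel[OF nov_hom_id rel])
  qed
  define c where "c = 1 / max (N (var Z0)) (N (var Z1))"
  have c: "c > 0" unfolding c_def by (rule yan_pt_scale[OF N nz])
  have pv: "?p (var v) = c ^ vdeg v * nov_norm (e v)" for v
    unfolding yan_pt_var[OF N nz] c_def var ..
  have q: "y_val ?p Y1 = q1" "y_val ?p Y2 = q2"
    by (simp_all add: y_val_eq[OF p] pv vdeg_def e_def nov_norm_monom)
  have h0: "homog 0 (1 + var Y1)" "homog 0 (1 + var Y2)"
    using homog_1 homog_var[of Y1] homog_var[of Y2] by (simp_all add: gpart_add vdeg_def)
  have r: "?p (1 + var Y1) = exp (- min 0 q1)" "?p (1 + var Y2) = exp (- min 0 q2)"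
    by (simp_all add: yan_pt_homog[OF N nz h0(1)] yan_pt_homog[OF N nz h0(2)] N_def heval_add[OF nov_hom_id]
        yeval_1[OF nov_hom_id] yeval_var[OF nov_hom_id] e_def nov_norm_one_plus_monom)
  have "F ?p = ps (q1, q2, - ln (?p (var Z0) / ?p (var Z1)) + min 0 q2)"
    using F_mid[OF p] c r by (simp add: q pv vdeg_def e_def nov_norm_monom)
  also have "- ln (?p (var Z0) / ?p (var Z1)) + min 0 q2 = s"
    using c by (simp add: pv vdeg_def e_def nov_norm_monom a_def)
  finally show ?thesis using p by (metis imageI)
qed

lemma F_image: "F ` Yan = range ps"
proof (intro equalityI subsetI)
  fix u assume "u \<in> F ` Yan"
  then obtain p where p: "p \<in> Yan" "u = F p" by blast
  then show "u \<in> range ps" using F_in_range[OF p(1)] by (metis rangeI)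
next
  fix u assume "u \<in> range ps"
  then obtain q1 q2 s where "u = ps (q1, q2, s)" by (metis rangeE prod_cases3)
  then show "u \<in> F ` Yan" using ps_in_F by blast
qed

end


section \<open>Properness\<close>

lemma closed_Collect_mult_seminorm: "closed {p :: 'm::comm_monoid_add berk_pt. mult_seminorm p}"
  unfolding mult_seminorm_def
  by (intro closed_Collect_conj closed_Collect_all closed_Collect_le closed_Collect_eq continuous_intros)

text \<open>The conditions that |y_1| and |y_2| be nonzero are not closed; the lower bounds make
  them so, while the upper bounds on the variables give compactness.\<close>

definition Yan_bounded :: "real \<Rightarrow> y_mon berk_pt set"
  where "Yan_bounded R = {p\<in>Yan. p (var X1) \<le> exp R \<and> p (var X2) \<le> exp R \<and>
    exp (- R) \<le> p (var Y1) \<and> p (var Y1) \<le> exp R \<and> exp (- R) \<le> p (var Y2) \<and> p (var Y2) \<le> exp R}"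

lemma closed_Yan_bounded: "closed (Yan_bounded R)"
proof -
  let ?S = "{p :: y_mon berk_pt. mult_seminorm p}"
  have sup: "closed {p\<in>?S. p f - (SUP d. p (gpart zdeg d f)) = 0}" for f
  proof (rule continuous_closed_preimage_constant[OF _ closed_Collect_mult_seminorm])
    obtain K where "\<And>d. K < d \<Longrightarrow> gpart zdeg d f = 0" by (rule gdegs_bound[of zdeg f]) blast
    then show "continuous_on ?S (\<lambda>p. p f - (SUP d. p (gpart zdeg d f)))"
      by (intro continuous_on_diff continuous_on_SUP_eventually_zero[where K = K] continuous_intros)
         (simp add: ms_0)
  qed
  have "closed {p :: y_mon berk_pt. max (p (var Z0)) (p (var Z1)) = 1 \<and>
      p (var X1 * var Z0 - (1 + var Y1) * var Z1) = 0 \<and> p (var X2 * var Z1 - (1 + var Y2) * var Z0) = 0 \<and>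
      p (var X1) \<le> exp R \<and> p (var X2) \<le> exp R \<and>
      exp (- R) \<le> p (var Y1) \<and> p (var Y1) \<le> exp R \<and> exp (- R) \<le> p (var Y2) \<and> p (var Y2) \<le> exp R}" (is "closed ?T")
    by (intro closed_Collect_conj closed_Collect_le closed_Collect_eq continuous_intros)
  then have "closed (?S \<inter> (\<Inter>f. {p\<in>?S. p f - (SUP d. p (gpart zdeg d f)) = 0}) \<inter> ?T)"
    by (intro closed_Int closed_INT closed_Collect_mult_seminorm ballI sup)
  also have "?S \<inter> (\<Inter>f. {p\<in>?S. p f - (SUP d. p (gpart zdeg d f)) = 0}) \<inter> ?T = Yan_bounded R"
  proof (intro equalityI subsetI)
    fix p assume p: "p \<in> ?S \<inter> (\<Inter>f. {p\<in>?S. p f - (SUP d. p (gpart zdeg d f)) = 0}) \<inter> ?T"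
    then have "exp (- R) \<le> p (var Y1)" "exp (- R) \<le> p (var Y2)" by blast+
    then have "p (var Y1) \<noteq> 0" "p (var Y2) \<noteq> 0"
      by (metis exp_gt_zero not_le)+
    moreover have "\<forall>f. p f = (SUP d. p (gpart zdeg d f))"
    proof
      fix f
      have "p f - (SUP d. p (gpart zdeg d f)) = 0" using p by blast
      then show "p f = (SUP d. p (gpart zdeg d f))" by (rule eq_iff_diff_eq_0[THEN iffD2])
    qed
    ultimately show "p \<in> Yan_bounded R"
      using p unfolding Yan_bounded_def Yan_def zpart_eq_gpart by blast
  next
    fix p assume p: "p \<in> Yan_bounded R"
    then have "p f - (SUP d. p (gpart zdeg d f)) = 0" for f
      using YanD(2)[of p f] unfolding Yan_bounded_def by (intro eq_iff_diff_eq_0[THEN iffD1]) blast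
    then show "p \<in> ?S \<inter> (\<Inter>f. {p\<in>?S. p f - (SUP d. p (gpart zdeg d f)) = 0}) \<inter> ?T"
      using p unfolding Yan_bounded_def Yan_def by blast
  qed
  finally show ?thesis .
qed

lemma compact_Pi_fun:
  fixes S :: "'a \<Rightarrow> 'b::topological_space set"
  assumes "\<And>i. compact (S i)"
  shows "compact {f. \<forall>i. f i \<in> S i}"
proof -
  have "compactin (product_topology (\<lambda>_. euclidean) UNIV) (PiE UNIV S)"
    using assms by (simp add: compactin_PiE)
  moreover have "PiE UNIV S = {f. \<forall>i. f i \<in> S i}" by (auto simp: PiE_def)
  ultimately show ?thesis by (simp add: euclidean_product_topology)
qed

text \<open>By Tychonoff: bounds on the variables bound the value at every polynomial, so the set is
  a closed part of a product of compact intervals.\<close>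

lemma compact_Yan_bounded:
  assumes "0 \<le> R"
  shows "compact (Yan_bounded R)"
proof -
  \<comment> \<open>The value of each monomial when all variables are replaced by
    \<open>exp R\<close>, summed over \<open>f\<close>; \<open>Z0\<close> and \<open>Z1\<close> obey
    this bound by normalization and \<open>R \<ge> 0\<close>.\<close>
  define M where "M f = (\<Sum>m\<in>keys f. nov_norm (lookup f m) * (\<Prod>v\<in>yvars. exp R ^ lookup m v))"
    for f :: "y_mon nov_alg"
  have bound: "p f \<le> M f" if p: "p \<in> Yan_bounded R" for p f
  proof -
    have pY: "p \<in> Yan" using p by (simp add: Yan_bounded_def)
    note ms = YanD(1)[OF pY]
    have "1 \<le> exp R" using assms by simp
    then have "p (var Z0) \<le> exp R" "p (var Z1) \<le> exp R" using YanD(3)[OF pY] by linarith+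
    then have v: "p (var v) \<le> exp R" for v
      using p by (cases v) (auto simp: Yan_bounded_def)
    have mono: "p (single m c) \<le> nov_norm c * (\<Prod>v\<in>yvars. exp R ^ lookup m v)" for m c
    proof -
      have "p (ymon var m) = (\<Prod>v\<in>yvars. p (var v) ^ lookup m v)"
        unfolding ymon_def by (rule finite_induct[OF finite_yvars]) (simp_all add: ms_mult[OF ms] ms_power[OF ms] ms_1[OF ms])
      also have "\<dots> \<le> (\<Prod>v\<in>yvars. exp R ^ lookup m v)"
        using v ms_nonneg[OF ms] by (intro prod_mono) (auto intro: power_mono)
      finally have "nov_norm c * p (ymon var m) \<le> nov_norm c * (\<Prod>v\<in>yvars. exp R ^ lookup m v)"
        by (intro mult_left_mono) simp_all
      moreover have "single m c = const c * ymon var m" by (simp add: ymon_var const_def mult_single)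
      ultimately show ?thesis by (simp add: ms_mult[OF ms] ms_const[OF ms])
    qed
    have "p (\<Sum>m\<in>I. single m (lookup f m)) \<le>
        (\<Sum>m\<in>I. nov_norm (lookup f m) * (\<Prod>v\<in>yvars. exp R ^ lookup m v))" if "finite I" for I
      using that
    proof (induction I)
      case (insert m I)
      let ?s = "\<Sum>m\<in>I. single m (lookup f m)"
      have "p (single m (lookup f m) + ?s) \<le> p (single m (lookup f m)) + p ?s"
        using ms_add[OF ms, of "single m (lookup f m)" ?s] ms_nonneg[OF ms, of ?s]
          ms_nonneg[OF ms, of "single m (lookup f m)"] by linarith
      then show ?case using insert mono[of m "lookup f m"] by simp
    qed (simp add: ms_0[OF ms])
    from this[OF finite_keys[of f]] show ?thesis by (simp only: nov_alg_sum_single[symmetric] M_def)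
  qed
  have "compact {p :: y_mon berk_pt. \<forall>f. p f \<in> {0..M f}}"
    by (rule compact_Pi_fun) simp
  then have "compact ({p. \<forall>f. p f \<in> {0..M f}} \<inter> Yan_bounded R)"
    by (rule compact_Int_closed[OF _ closed_Yan_bounded])
  moreover have "Yan_bounded R \<subseteq> {p. \<forall>f. p f \<in> {0..M f}}"
    using bound ms_nonneg[OF YanD(1)] by (auto simp: Yan_bounded_def)
  ultimately show ?thesis by (simp add: Int_absorb1)
qed

context psi
begin

text \<open>The first two coordinates of \<open>F\<close> bound x_1 and x_2 from above, the last two
  bound y_1 and y_2 on both sides, and \<open>Z0\<close>, \<open>Z1\<close> are normalized.\<close>

lemma compact_F_preimage:
  assumes K: "compact K"
  shows "compact {p\<in>Yan. F p \<in> K}"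
proof -
  obtain B where B: "\<And>u. u \<in> K \<Longrightarrow> norm u \<le> B" using compact_imp_bounded[OF K] by (auto simp: bounded_iff)
  define R where "R = max B 0"
  have sub: "p \<in> Yan_bounded R" if p: "p \<in> Yan" "F p \<in> K" for p
  proof -
    let ?q1 = "y_val p Y1" and ?q2 = "y_val p Y2"
    let ?a = "max (p (var X1)) (exp (P1 ?q1 ?q2 - min 0 ?q1 - min 0 ?q2))" and ?b = "max (p (var X2)) (exp (- P2 ?q1 ?q2))"
    obtain g where g: "F p = (- ln ?a, - ln ?b, g, ?q1, ?q2)" using F_eq[OF p(1)] by blast
    note n = B[OF p(2), unfolded g]
    have le: "\<bar>x\<bar> \<le> norm (x, y)" "norm y \<le> norm (x, y)" for x :: real and y :: "'b::real_normed_vector"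
      using norm_fst_le[of x y] norm_snd_le[of y x] by simp_all
    have "\<bar>ln ?a\<bar> \<le> B" "\<bar>ln ?b\<bar> \<le> B" "\<bar>?q1\<bar> \<le> B" "\<bar>?q2\<bar> \<le> B"
      using n le(1)[of "- ln ?a" "(- ln ?b, g, ?q1, ?q2)"] le(2)[of "(- ln ?b, g, ?q1, ?q2)" "- ln ?a"]
        le(1)[of "- ln ?b" "(g, ?q1, ?q2)"] le(2)[of "(g, ?q1, ?q2)" "- ln ?b"]
        le(2)[of "(?q1, ?q2)" g] le(1)[of ?q1 ?q2] le(2)[of ?q2 ?q1]
      by (simp_all only: real_norm_def abs_minus_cancel)
    then have *: "ln ?a \<le> R" "ln ?b \<le> R" "\<bar>?q1\<bar> \<le> R" "\<bar>?q2\<bar> \<le> R" unfolding R_def by linarith+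
    have "?a > 0" "?b > 0" by (simp_all add: less_max_iff_disj)
    with *(1,2) have "?a \<le> exp R" "?b \<le> exp R" by (metis exp_le_cancel_iff exp_ln)+
    moreover have "p (var Y1) = exp (- ?q1)" "p (var Y2) = exp (- ?q2)"
      using YanD(4,5)[OF p(1)] ms_nonneg[OF YanD(1)[OF p(1)], of "var Y1"] ms_nonneg[OF YanD(1)[OF p(1)], of "var Y2"]
      by (simp_all add: y_val_eq[OF p(1)])
    ultimately show ?thesis using p(1) *(3,4) by (auto simp: Yan_bounded_def)
  qed
  have Y: "Yan_bounded R \<subseteq> Yan" by (auto simp: Yan_bounded_def)
  have "closed (Yan_bounded R \<inter> F -` K)"
    using continuous_on_subset[OF continuous_on_F Y] closed_Yan_bounded compact_imp_closed[OF K]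
    by (rule continuous_closed_preimage)
  then have "compact (Yan_bounded R \<inter> (Yan_bounded R \<inter> F -` K))"
    by (intro compact_Int_closed compact_Yan_bounded) (simp_all add: R_def)
  also have "Yan_bounded R \<inter> (Yan_bounded R \<inter> F -` K) = {p\<in>Yan. F p \<in> K}"
    using sub Y by auto
  finally show ?thesis .
qed

text \<open>The base is metrizable, hence compactly generated, so compactness of preimages of
  compact sets suffices. The restriction over \<open>B\<close> is then inherited.\<close>

lemma proper_continuous_F: "proper_continuous {p\<in>Yan. F p \<in> B} F (F ` Yan \<inter> B)"
proof -
  have cont: "continuous_map (top_of_set Yan) (top_of_set (F ` Yan)) F"
    using continuous_on_F by simp
  have "proper_map (top_of_set Yan) (top_of_set (F ` Yan)) F"
  proof (rule compact_imp_proper_map)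
    show "k_space (top_of_set (F ` Yan))"
      by (intro metrizable_imp_k_space metrizable_space_subtopology metrizable_space_euclidean)
    show "kc_space (top_of_set (F ` Yan))"
      by (intro Hausdorff_imp_kc_space Hausdorff_space_subtopology Hausdorff_space_euclidean)
    show "F \<in> topspace (top_of_set Yan) \<rightarrow> topspace (top_of_set (F ` Yan))" by auto
    show "continuous_map (top_of_set Yan) (top_of_set (F ` Yan)) F \<or> kc_space (top_of_set Yan)"
      using cont by blast
    fix K assume "compactin (top_of_set (F ` Yan)) K"
    then show "compactin (top_of_set Yan) {x \<in> topspace (top_of_set Yan). F x \<in> K}"
      using compact_F_preimage[of K] by (auto simp: compactin_subtopology)
  qed
  from proper_map_restriction[OF this, of B "{p\<in>Yan. F p \<in> B}"]
  have "proper_map (top_of_set {p\<in>Yan. F p \<in> B}) (top_of_set (F ` Yan \<inter> B)) F"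
    by (simp add: subtopology_subtopology Collect_conj_eq[symmetric] Int_absorb1 Collect_mono)
  moreover have "continuous_map (top_of_set {p\<in>Yan. F p \<in> B}) (top_of_set (F ` Yan \<inter> B)) F"
    using continuous_on_subset[OF continuous_on_F, of "{p\<in>Yan. F p \<in> B}"] by auto
  ultimately show ?thesis by (simp add: proper_continuous_def)
qed

end


section \<open>Smooth points\<close>

lemma continuous_on_vector_3:
  fixes f g h :: "'a::topological_space \<Rightarrow> real"
  assumes "continuous_on S f" "continuous_on S g" "continuous_on S h"
  shows "continuous_on S (\<lambda>x. vector [f x, g x, h x] :: real ^ 3)"
proof -
  have "continuous_on S (\<lambda>x. \<chi> i. (vector [f x, g x, h x] :: real ^ 3) $ i)"
  proof (rule continuous_on_vec_lambda)
    fix i :: 3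
    show "continuous_on S (\<lambda>x. (vector [f x, g x, h x] :: real ^ 3) $ i)"
      using exhaust_3[of i] assms by (auto simp: vector_3)
  qed
  then show ?thesis by (simp add: vec_lambda_eta)
qed

text \<open>The tropicalization of each chart in the coordinates \<open>(q1, q2, s)\<close>. The
  sign is -1 for the chart of x_1, where the valuation of x_1 decreases as \<open>s\<close> grows;
  the inverse relies on the square of the sign being 1.\<close>

definition shear :: "real \<Rightarrow> (real \<times> real \<Rightarrow> real) \<Rightarrow> real3 \<Rightarrow> real ^ 3"
  where "shear \<epsilon> g = (\<lambda>(q1, q2, s). vector [\<epsilon> * s + g (q1, q2), q1, q2])"

definition shear_inv :: "real \<Rightarrow> (real \<times> real \<Rightarrow> real) \<Rightarrow> real ^ 3 \<Rightarrow> real3"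
  where "shear_inv \<epsilon> g = (\<lambda>w. (w $ 2, w $ 3, \<epsilon> * (w $ 1 - g (w $ 2, w $ 3))))"

lemma homeomorphism_shear:
  assumes g: "continuous_on UNIV g" and \<epsilon>: "\<epsilon> = 1 \<or> \<epsilon> = - 1"
  shows "homeomorphism UNIV UNIV (shear \<epsilon> g) (shear_inv \<epsilon> g)"
proof (rule homeomorphismI)
  have g': "continuous_on S (\<lambda>x. g (f x))" if "continuous_on S f" for S :: "'x::topological_space set" and f
    using continuous_on_compose2[OF g that] by simp
  show "continuous_on UNIV (shear \<epsilon> g)"
    unfolding shear_def case_prod_unfold by (intro continuous_on_vector_3 continuous_intros g')
  show "continuous_on UNIV (shear_inv \<epsilon> g)"
    unfolding shear_inv_def by (intro continuous_intros g')
  show "shear_inv \<epsilon> g (shear \<epsilon> g x) = x" for x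
    using \<epsilon> by (cases x) (auto simp: shear_def shear_inv_def vector_3)
  show "shear \<epsilon> g (shear_inv \<epsilon> g y) = y" for y
    using \<epsilon> by (auto simp: shear_def shear_inv_def vec_eq_iff forall_3 vector_3)
qed auto

lemma shear_in_image:
  assumes "\<epsilon> = 1 \<or> \<epsilon> = - 1"
  shows "shear \<epsilon> g x \<in> shear \<epsilon> g ` V \<longleftrightarrow> x \<in> V"
proof -
  have "shear_inv \<epsilon> g (shear \<epsilon> g x) = x" for x
    using assms by (cases x) (auto simp: shear_def shear_inv_def vector_3)
  then show ?thesis by (metis imageE imageI)
qed

text \<open>\<open>into\<close> and \<open>onto\<close> together say that the part of
  \<open>Y\<close> over \<open>ps\<close> V\<open>is exactly the part of the chart whose
  tropicalization lies in\<close>\<kappa> \<open>V\<close>; the chart isomorphism then restricts,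
  covering \<open>\<kappa>\<close> after \<open>ps'\<close>.\<close>

lemma (in chart) smooth_pointI:
  fixes F :: "y_mon berk_pt \<Rightarrow> 'b::topological_space" and ps :: "'c::topological_space \<Rightarrow> 'b" and \<kappa> :: "'c \<Rightarrow> real ^ 3"
  assumes ps: "homeomorphism UNIV (range ps) ps ps'" and \<kappa>: "homeomorphism UNIV UNIV \<kappa> \<kappa>'"
    and V: "open V" and B: "ps ` V \<subseteq> B" "B \<subseteq> range ps"
    and into: "\<And>p. p \<in> Yan \<Longrightarrow> F p \<in> ps ` V \<Longrightarrow> p \<in> dom \<and> trop (to_torus p) = \<kappa> (ps' (F p))"
    and onto: "\<And>p. p \<in> dom \<Longrightarrow> trop (to_torus p) \<in> \<kappa> ` V \<Longrightarrow> F p \<in> ps ` V"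
    and b: "b \<in> ps ` V"
  shows "smooth_point TYPE(3) y_fracs {p\<in>Yan. F p \<in> B} F B b"
proof -
  let ?h = "\<lambda>u. \<kappa> (ps' u)"
  have ps': "ps' (ps x) = x" for x using ps by (simp add: homeomorphism_def)
  have "openin (top_of_set (range ps)) (ps ` V)"
    using homeomorphism_imp_open_map[OF ps, of V] V by simp
  then have opU: "openin (top_of_set B) (ps ` V)" using B openin_subset_trans by blast
  have opV: "open (\<kappa> ` V)"
    using homeomorphism_imp_open_map[OF \<kappa>, of V] V by simp
  have "homeomorphism V (ps ` V) ps ps'"
    by (rule homeomorphism_of_subsets[OF ps]) auto
  then have 1: "homeomorphism (ps ` V) V ps' ps" by (rule homeomorphism_symD)
  have 2: "homeomorphism V (\<kappa> ` V) \<kappa> \<kappa>'"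
    by (rule homeomorphism_of_subsets[OF \<kappa>]) auto
  have 3: "homeomorphism (ps ` V) (\<kappa> ` V) (\<kappa> \<circ> ps') (ps \<circ> \<kappa>')"
    by (rule homeomorphism_compose[OF 1 2])
  have "homeomorphic_maps (top_of_set (ps ` V)) (top_of_set (\<kappa> ` V)) (\<kappa> \<circ> ps') (ps \<circ> \<kappa>')"
    using homeomorphism_cont1[OF 3] homeomorphism_cont2[OF 3] homeomorphism_image1[OF 3] homeomorphism_image2[OF 3]
      homeomorphism_apply1[OF 3] homeomorphism_apply2[OF 3]
    unfolding homeomorphic_maps_def by (simp add: image_subset_iff_funcset[symmetric])
  then have hom: "homeomorphic_map (top_of_set (ps ` V)) (top_of_set (\<kappa> ` V)) ?h"
    unfolding homeomorphic_map_maps o_def by blast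
  let ?W = "{x \<in> {p\<in>Yan. F p \<in> B}. F x \<in> ps ` V}"
  have W: "?W = {p\<in>Yan. F p \<in> ps ` V}" using B by auto
  have Wd: "?W \<subseteq> dom" using into by auto
  have W': "{q\<in>torus_an. from_torus q \<in> ?W} = {q\<in>torus_an. trop q \<in> \<kappa> ` V}"
  proof (intro Collect_cong conj_cong refl)
    fix q :: "3 torus_mon berk_pt" assume "q \<in> torus_an"
    then have q: "mult_seminorm q" by (simp add: torus_an_def)
    note d = from_torus_in_dom[OF q] and tq = to_torus_from_torus[OF q]
    show "from_torus q \<in> ?W \<longleftrightarrow> trop q \<in> \<kappa> ` V"
    proof
      assume "from_torus q \<in> ?W"
      then have "trop q = \<kappa> (ps' (F (from_torus q)))" "F (from_torus q) \<in> ps ` V"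
        using into[of "from_torus q"] tq by auto
      then show "trop q \<in> \<kappa> ` V" using ps' by auto
    next
      assume "trop q \<in> \<kappa> ` V"
      then show "from_torus q \<in> ?W" unfolding W using onto[OF d] tq domD(1)[OF d] by simp
    qed
  qed
  show ?thesis
    unfolding smooth_point_def
  proof (intro conjI exI)
    show "b \<in> B" "b \<in> ps ` V" using b B by auto
    show "analytic_iso y_fracs ?W UNIV {q\<in>torus_an. trop q \<in> \<kappa> ` V} to_torus"
      using analytic_iso_to_torus[OF Wd] unfolding W' .
    show "\<forall>x\<in>{p \<in> Yan. F p \<in> B}. F x \<in> ps ` V \<longrightarrow> trop (to_torus x) = \<kappa> (ps' (F x))"
      using into by simp
  qed (rule opU, rule opV, rule hom)
qed

context psi
begin

lemma smooth_x1:
  assumes B: "B \<subseteq> range ps" "ps ` {(q1, q2, s). P1 q1 q2 < s} \<subseteq> B" and s: "P1 q1 q2 < s"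
  shows "smooth_point TYPE(3) y_fracs {p\<in>Yan. F p \<in> B} F B (ps (q1, q2, s))"
proof (rule cx1.smooth_pointI[OF homeomorphism_ps _ _ B(2,1)])
  let ?V = "{(q1, q2, s). P1 q1 q2 < s}"
  let ?\<kappa> = "shear (- 1) (\<lambda>(q1, q2). min 0 q1 + min 0 q2)"
  show "homeomorphism UNIV UNIV ?\<kappa> (shear_inv (- 1) (\<lambda>(q1, q2). min 0 q1 + min 0 q2))"
    by (rule homeomorphism_shear) (auto simp: case_prod_unfold intro!: continuous_intros)
  show "open ?V"
    unfolding case_prod_unfold by (intro open_Collect_less continuous_intros)
  show "ps (q1, q2, s) \<in> ps ` ?V" using s by blast
  have key: "trop (cx1.to_torus p) = ?\<kappa> (y_val p Y1, y_val p Y2, min 0 (y_val p Y1) + min 0 (y_val p Y2) + ln (p (var X1)))"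
    if "p \<in> cx1.dom" for p
    by (simp add: cx1.trop_to_torus[OF that] shear_def)
  show "p \<in> cx1.dom \<and> trop (cx1.to_torus p) = ?\<kappa> (ps_inv (F p))" if p: "p \<in> Yan" "F p \<in> ps ` ?V" for p
  proof -
    let ?q1 = "y_val p Y1" and ?q2 = "y_val p Y2"
    obtain s where s: "F p = ps (?q1, ?q2, s)" using F_in_range[OF p(1)] by blast
    with p(2) have s2: "P1 ?q1 ?q2 < s" by (auto simp: ps_inject)
    \<comment> \<open>Otherwise the first coordinate of \<open>F\<close> would equal its bound, and
      the parameter could not exceed \<open>P1\<close>.\<close>
    have "exp (P1 ?q1 ?q2 - (min 0 ?q1 + min 0 ?q2)) < p (var X1)"
    proof (rule ccontr)
      assume "\<not> ?thesis"
      then show False using s s2 F_eq'[OF p(1)] psi_at_less[of ?q1 ?q2] by (simp add: PS_def max_def)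
    qed
    note x1 = F_x1[OF p(1) this]
    have "p (var X1) \<noteq> 0" using \<open>exp _ < _\<close> by (metis exp_gt_zero less_asym)
    then have "p \<in> cx1.dom" using p(1) x1(2) by (simp add: cx1.dom_def)
    then show ?thesis using key x1(1) by (simp add: ps_inv_ps)
  qed
  show "F p \<in> ps ` ?V" if p: "p \<in> cx1.dom" "trop (cx1.to_torus p) \<in> ?\<kappa> ` ?V" for p
  proof -
    let ?q1 = "y_val p Y1" and ?q2 = "y_val p Y2"
    have "(?q1, ?q2, min 0 ?q1 + min 0 ?q2 + ln (p (var X1))) \<in> ?V"
      using p(2) unfolding key[OF p(1)] by (simp only: shear_in_image simp_thms)
    then have "P1 ?q1 ?q2 - (min 0 ?q1 + min 0 ?q2) < ln (p (var X1))" by simp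
    moreover have "0 < p (var X1)" using cx1.domD(3)[OF p(1)] ms_nonneg[OF cx1.domD(2)[OF p(1)], of "var X1"] by simp
    ultimately have "exp (P1 ?q1 ?q2 - (min 0 ?q1 + min 0 ?q2)) < p (var X1)"
      by (metis exp_less_cancel_iff exp_ln)
    from F_x1[OF cx1.domD(1)[OF p(1)] this] show ?thesis by simp
  qed
qed

lemma smooth_x2:
  assumes B: "B \<subseteq> range ps" "ps ` {(q1, q2, s). s < P2 q1 q2} \<subseteq> B" and s: "s < P2 q1 q2"
  shows "smooth_point TYPE(3) y_fracs {p\<in>Yan. F p \<in> B} F B (ps (q1, q2, s))"
proof (rule cx2.smooth_pointI[OF homeomorphism_ps _ _ B(2,1)])
  let ?V = "{(q1, q2, s). s < P2 q1 q2}"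
  let ?\<kappa> = "shear 1 (\<lambda>_. 0)"
  show "homeomorphism UNIV UNIV ?\<kappa> (shear_inv 1 (\<lambda>_. 0))"
    by (rule homeomorphism_shear) (auto simp: case_prod_unfold intro!: continuous_intros)
  show "open ?V"
    unfolding case_prod_unfold by (intro open_Collect_less continuous_intros)
  show "ps (q1, q2, s) \<in> ps ` ?V" using s by blast
  have key: "trop (cx2.to_torus p) = ?\<kappa> (y_val p Y1, y_val p Y2, - ln (p (var X2)))"
    if "p \<in> cx2.dom" for p
    by (simp add: cx2.trop_to_torus[OF that] shear_def)
  show "p \<in> cx2.dom \<and> trop (cx2.to_torus p) = ?\<kappa> (ps_inv (F p))" if p: "p \<in> Yan" "F p \<in> ps ` ?V" for p
  proof -
    let ?q1 = "y_val p Y1" and ?q2 = "y_val p Y2"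
    obtain s where s: "F p = ps (?q1, ?q2, s)" using F_in_range[OF p(1)] by blast
    with p(2) have s2: "s < P2 ?q1 ?q2" by (auto simp: ps_inject)
    have "exp (- P2 ?q1 ?q2) < p (var X2)"
    proof (rule ccontr)
      assume "\<not> ?thesis"
      then show False using s s2 F_eq'[OF p(1)] psi_at_less[of ?q1 ?q2] by (simp add: PS_def max_def)
    qed
    note x2 = F_x2[OF p(1) this]
    have "p (var X2) \<noteq> 0" using \<open>exp _ < _\<close> by (metis exp_gt_zero less_asym)
    then have "p \<in> cx2.dom" using p(1) x2(2) by (simp add: cx2.dom_def)
    then show ?thesis using key x2(1) by (simp add: ps_inv_ps)
  qed
  show "F p \<in> ps ` ?V" if p: "p \<in> cx2.dom" "trop (cx2.to_torus p) \<in> ?\<kappa> ` ?V" for p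
  proof -
    let ?q1 = "y_val p Y1" and ?q2 = "y_val p Y2"
    have "(?q1, ?q2, - ln (p (var X2))) \<in> ?V"
      using p(2) unfolding key[OF p(1)] by (simp only: shear_in_image simp_thms)
    then have "- P2 ?q1 ?q2 < ln (p (var X2))" by simp
    moreover have "0 < p (var X2)" using cx2.domD(3)[OF p(1)] ms_nonneg[OF cx2.domD(2)[OF p(1)], of "var X2"] by simp
    ultimately have "exp (- P2 ?q1 ?q2) < p (var X2)"
      by (metis exp_less_cancel_iff exp_ln)
    from F_x2[OF cx2.domD(1)[OF p(1)] this] show ?thesis by simp
  qed
qed

text \<open>The wall at \<open>P1\<close> may be crossed where \<open>q1 \<noteq> 0\<close> and the
  wall at \<open>P2\<close> where \<open>q2 \<noteq> 0\<close>, since there 1 + y_i has maximal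
  norm. This largest region for the z chart contains the points of the walls that the other two
  charts miss.\<close>

definition mid :: "real3 set"
  where "mid = {(q1, q2, s). (q1 \<noteq> 0 \<or> s < P1 q1 q2) \<and> (q2 \<noteq> 0 \<or> P2 q1 q2 < s)}"

lemma F_mid_dom:
  assumes p: "p \<in> cz.dom" 
  defines "q1 \<equiv> y_val p Y1" and "q2 \<equiv> y_val p Y2" and "z \<equiv> - ln (p (var Z0) / p (var Z1)) + min 0 (y_val p Y2)"
  assumes "q1 \<noteq> 0 \<or> z \<le> P1 q1 q2" "q2 \<noteq> 0 \<or> P2 q1 q2 \<le> z"
  shows "F p = ps (q1, q2, z)"
  using F_mid[OF cz.domD(1)[OF p]] Yan_one_plus(2,4)[OF cz.domD(1)[OF p]] cz.domD(3,4)[OF p] assms(5,6)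
    ms_nonneg[OF cz.domD(2)[OF p]]
  unfolding q1_def q2_def z_def by (metis order_less_le)

lemma smooth_mid:
  assumes B: "B \<subseteq> range ps" "ps ` mid \<subseteq> B" and s: "x \<in> mid"
  shows "smooth_point TYPE(3) y_fracs {p\<in>Yan. F p \<in> B} F B (ps x)"
proof (rule cz.smooth_pointI[OF homeomorphism_ps _ _ B(2,1)])
  let ?\<kappa> = "shear 1 (\<lambda>(q1, q2). - min 0 q2)"
  show "homeomorphism UNIV UNIV ?\<kappa> (shear_inv 1 (\<lambda>(q1, q2). - min 0 q2))"
    by (rule homeomorphism_shear) (auto simp: case_prod_unfold intro!: continuous_intros)
  show "open mid"
    unfolding mid_def case_prod_unfold
    by (intro open_Collect_less open_Collect_neq open_Collect_disj open_Collect_conj continuous_intros)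
  show "ps x \<in> ps ` mid" using s by blast
  have key: "trop (cz.to_torus p) = ?\<kappa> (y_val p Y1, y_val p Y2, - ln (p (var Z0) / p (var Z1)) + min 0 (y_val p Y2))"
    if "p \<in> cz.dom" for p
    by (simp add: cz.trop_to_torus[OF that] shear_def del: One_nat_def)
  show "p \<in> cz.dom \<and> trop (cz.to_torus p) = ?\<kappa> (ps_inv (F p))" if p: "p \<in> Yan" "F p \<in> ps ` mid" for p
  proof -
    let ?q1 = "y_val p Y1" and ?q2 = "y_val p Y2"
    let ?z = "- ln (p (var Z0) / p (var Z1)) + min 0 ?q2"
    have max1: "max (p (var Z0)) (p (var Z1)) = 1" by (rule YanD(3)[OF p(1)])
    obtain s where s1: "F p = ps (?q1, ?q2, s)" using F_in_range[OF p(1)] by blast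
    with p(2) have "(?q1, ?q2, s) \<in> mid" by (auto simp: ps_inject)
    note s = s1 this
    have G: "median s (P1 ?q1 ?q2) (P2 ?q1 ?q2) = zclamp (P2 ?q1 ?q2) (P1 ?q1 ?q2) (min 0 ?q2) (p (var Z0)) (p (var Z1))"
      using s(1) F_eq'[OF p(1)] by (simp add: PS_def)
    note less = psi_at_less[of ?q1 ?q2]
    \<comment> \<open>If z = 0, then |1 + y_1| = 0, hence \<open>q1 = 0\<close>, and
      \<open>mid\<close> puts \<open>s\<close> below \<open>P1\<close>; but at z = 0 the third
      coordinate of \<open>F\<close> is \<open>P1\<close>.\<close>
    have "p (var Z0) \<noteq> 0"
    proof
      assume z: "p (var Z0) = 0"
      then have Z1: "p (var Z1) = 1" using max1 ms_nonneg[OF YanD(1)[OF p(1)], of "var Z1"] by (simp add: max_def split: if_splits)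
      then have "?q1 = 0" using Yan_rel(1)[OF p(1)] Yan_one_plus(2)[OF p(1)] z by (metis exp_not_eq_zero mult_zero_right mult_1_right)
      then have "s < P1 ?q1 ?q2" using s(2) by (simp add: mid_def)
      then show False using G less zclamp_0[OF less] z Z1 by (simp add: median_def max_def min_def split: if_splits)
    qed
    moreover have "p (var Z1) \<noteq> 0"
    proof
      assume z: "p (var Z1) = 0"
      then have Z0: "p (var Z0) = 1" using max1 ms_nonneg[OF YanD(1)[OF p(1)], of "var Z0"] by (simp add: max_def split: if_splits)
      then have "?q2 = 0" using Yan_rel(2)[OF p(1)] Yan_one_plus(4)[OF p(1)] z by (metis exp_not_eq_zero mult_zero_right mult_1_right)
      then have "P2 ?q1 ?q2 < s" using s(2) by (simp add: mid_def)
      then show False using G less zclamp_infinity z Z0 by (simp add: median_def max_def min_def split: if_splits)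
    qed
    ultimately have d: "p \<in> cz.dom" using p(1) by (simp add: cz.dom_def)
    have a: "p (var Z0) > 0" "p (var Z1) > 0"
      using \<open>p (var Z0) \<noteq> 0\<close> \<open>p (var Z1) \<noteq> 0\<close> ms_nonneg[OF YanD(1)[OF p(1)], of "var Z0"]
        ms_nonneg[OF YanD(1)[OF p(1)], of "var Z1"] by simp_all
    \<comment> \<open>Equal medians do not yet give \<open>s = ?z\<close> outside the walls, only
      the side of each wall on which \<open>?z\<close> lies; this is what \<open>F_mid_dom\<close>
      asks for.\<close>
    have G': "median s (P1 ?q1 ?q2) (P2 ?q1 ?q2) = median ?z (P1 ?q1 ?q2) (P2 ?q1 ?q2)"
      using G zclamp_eq[OF less a] by simp
    have z1: "?z \<le> P1 ?q1 ?q2" if "s < P1 ?q1 ?q2"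
      using G' less that by (auto simp: median_def max_def min_def split: if_splits)
    have z2: "P2 ?q1 ?q2 \<le> ?z" if "P2 ?q1 ?q2 < s"
      using G' less that by (auto simp: median_def max_def min_def split: if_splits)
    have "F p = ps (?q1, ?q2, ?z)"
      using s(2) z1 z2 by (intro F_mid_dom[OF d]) (auto simp: mid_def)
    then show ?thesis using key[OF d] d by (simp add: ps_inv_ps)
  qed
  show "F p \<in> ps ` mid" if p: "p \<in> cz.dom" "trop (cz.to_torus p) \<in> ?\<kappa> ` mid" for p
  proof -
    let ?q1 = "y_val p Y1" and ?q2 = "y_val p Y2"
    let ?z = "- ln (p (var Z0) / p (var Z1)) + min 0 ?q2"
    have m: "(?q1, ?q2, ?z) \<in> mid"
      using p(2) unfolding key[OF p(1)] by (simp only: shear_in_image simp_thms)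
    then have "F p = ps (?q1, ?q2, ?z)" by (intro F_mid_dom[OF p(1)]) (auto simp: mid_def)
    then show ?thesis using m by simp
  qed
qed

end


section \<open>Disks in the affine line\<close>

type_synonym line_alg = "nat nov_alg"

definition lineX :: line_alg
  where "lineX = single 1 1"

text \<open>Complex numbers as series of exponent 0: representatives of the residue field inside the
  Novikov field.\<close>

definition cst :: "complex \<Rightarrow> line_alg"
  where "cst a = const (nov_monom a 0)"

lemma nov_monom_0 [simp]: "nov_monom 0 l = 0"
  by (rule nov_eqI) (simp add: nov_coeff_monom)

lemma lineX_power: "lineX ^ i = single i 1"
  by (induction i) (simp_all add: lineX_def mult_single)

lemma cst_add: "cst (a + b) = cst a + cst b"
proof -
  have "nov_monom (a + b) 0 = nov_monom a 0 + nov_monom b 0"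
    by (rule nov_eqI) (simp add: nov_coeff_monom)
  then show ?thesis by (simp add: cst_def const_add)
qed

lemma cst_mult: "cst (a * b) = cst a * cst b"
proof -
  have "nov_monom (a * b) 0 = nov_monom a 0 * nov_monom b 0"
    by (rule nov_eqI) (simp add: nov_coeff_monom_times nov_coeff_monom)
  then show ?thesis by (simp add: cst_def const_mult)
qed

lemma cst_0 [simp]: "cst 0 = 0"
  by (simp add: cst_def)

text \<open>The trivial norm of \<complex>. Distinct complex centers have distance 1, so they index
  different residue disks of the closed unit disk.\<close>

definition nov_triv :: "complex \<Rightarrow> real"
  where "nov_triv a = (if a = 0 then 0 else 1)"

lemma ms_cst: "mult_seminorm q \<Longrightarrow> q (cst a) = nov_triv a"
  by (simp add: cst_def ms_const nov_norm_monom nov_triv_def)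

text \<open>The Gauss point of the disk of radius \<open>\<rho>\<close> around \<open>\<alpha>\<close>.\<close>

definition disc :: "complex \<Rightarrow> real \<Rightarrow> line_alg \<Rightarrow> real"
  where "disc \<alpha> \<rho> f = gauss (\<lambda>m. m) (\<lambda>f. nov_norm (heval (\<lambda>x. x) (\<lambda>_. 1) f)) \<rho>
    (heval const (\<lambda>m. (lineX + cst \<alpha>) ^ m) f)"

lemma mult_seminorm_disc:
  assumes "0 < \<rho>"
  shows "mult_seminorm (disc \<alpha> \<rho>)"
  unfolding disc_def
  by (intro mult_seminorm_heval mult_seminorm_gauss mult_seminorm_heval_norm assms) (simp_all add: power_add)

lemma gpart_nat: "gpart (\<lambda>m. m) d f = single d (lookup f d)"
  by (rule poly_mapping_eqI) (auto simp: lookup_gpart lookup_single when_def)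

lemma disc_0_coeff:
  assumes "0 < \<rho>"
  shows "\<rho> ^ d * nov_norm (lookup f d) \<le> disc 0 \<rho> f"
proof -
  have shift: "heval const (\<lambda>m. (lineX + cst 0) ^ m) f = f"
  proof -
    have "heval const (\<lambda>m. (lineX + cst 0) ^ m) f =
        (\<Sum>m\<in>keys f. single m (lookup f m))"
      by (simp add: heval_def const_def mult_single lineX_power)
    then show ?thesis by (simp only: nov_alg_sum_single[symmetric])
  qed
  have "\<rho> ^ d * nov_norm (heval (\<lambda>x. x) (\<lambda>_. 1) (gpart (\<lambda>m. m) d f)) \<le> disc 0 \<rho> f"
    unfolding disc_def shift
    by (intro gauss_ge mult_seminorm_heval_norm assms) simp_all
  then show ?thesis by (simp add: gpart_nat heval_single[OF nov_hom_id])
qed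

text \<open>Moving the center to 0 turns the polynomial into
  \<open>lineX + cst (\<alpha> + \<beta>)\<close>, whose Gauss norm is read off from its two
  coefficients.\<close>

lemma disc_linear:
  assumes "0 < \<rho>"
  shows "disc \<alpha> \<rho> (lineX + cst \<beta>) = max \<rho> (nov_triv (\<alpha> + \<beta>))"
proof (rule antisym)
  note ms = mult_seminorm_disc[OF assms]
  let ?N = "\<lambda>f :: line_alg. nov_norm (heval (\<lambda>x. x) (\<lambda>_. 1) f)"
  have shift: "heval const (\<lambda>m. (lineX + cst \<alpha>) ^ m) (lineX + cst \<beta>) = lineX + cst (\<alpha> + \<beta>)"
    unfolding heval_add[OF nov_hom_const]
    by (simp add: lineX_def heval_single[OF nov_hom_const]) (simp add: cst_def heval_const[OF nov_hom_const] cst_add[unfolded cst_def])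
  have N: "mult_seminorm ?N" by (rule mult_seminorm_heval_norm) simp_all
  have val: "\<rho> ^ d * ?N (gpart (\<lambda>m. m) d (lineX + cst (\<alpha> + \<beta>))) = (if d = 0 then nov_triv (\<alpha> + \<beta>) else if d = 1 then \<rho> else 0)" for d
    by (auto simp: gpart_nat heval_single[OF nov_hom_id] lookup_add lineX_def cst_def const_def lookup_single
        when_def nov_norm_monom nov_triv_def)
  show "disc \<alpha> \<rho> (lineX + cst \<beta>) \<le> max \<rho> (nov_triv (\<alpha> + \<beta>))"
    unfolding disc_def shift
  proof (rule gauss_le[OF _ N assms])
    fix d show "\<rho> ^ d * ?N (gpart (\<lambda>m. m) d (lineX + cst (\<alpha> + \<beta>))) \<le> max \<rho> (nov_triv (\<alpha> + \<beta>))"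
      unfolding val using assms by (auto simp: nov_triv_def)
  qed simp
  have "\<rho> ^ d * ?N (gpart (\<lambda>m. m) d (lineX + cst (\<alpha> + \<beta>))) \<le> disc \<alpha> \<rho> (lineX + cst \<beta>)" for d
    unfolding disc_def shift by (rule gauss_ge[OF _ N assms]) simp
  from this[of 0] this[of 1] show "max \<rho> (nov_triv (\<alpha> + \<beta>)) \<le> disc \<alpha> \<rho> (lineX + cst \<beta>)"
    unfolding val by simp
qed

lemma continuous_on_disc: "continuous_on {0<..} (\<lambda>\<rho>. disc \<alpha> \<rho> f)"
proof -
  let ?g = "heval const (\<lambda>m. (lineX + cst \<alpha>) ^ m) f"
  obtain K where "\<And>d. K < d \<Longrightarrow> gpart (\<lambda>m. m) d ?g = 0" by (rule gdegs_bound[of "\<lambda>m. m" ?g]) blast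
  then show ?thesis
    unfolding disc_def gauss_def
    by (intro continuous_on_SUP_eventually_zero[where K = K] continuous_intros) (simp add: heval_0[OF nov_hom_id])
qed

lemma disc_tendsto: "0 < \<rho> \<Longrightarrow> ((\<lambda>\<rho>. disc \<alpha> \<rho> f) \<longlongrightarrow> disc \<alpha> \<rho> f) (at \<rho>)"
  using continuous_on_disc[of \<alpha> f] by (auto simp: continuous_on_eq_continuous_at isCont_def)

section \<open>Norms of polynomials with complex coefficients\<close>

definition lift_poly :: "complex poly \<Rightarrow> line_alg"
  where "lift_poly c = poly (map_poly cst c) lineX"

lemma lift_poly_0 [simp]: "lift_poly 0 = 0"
  by (simp add: lift_poly_def)

lemma lift_poly_pCons: "lift_poly (pCons a c) = cst a + lineX * lift_poly c"
  by (simp add: lift_poly_def map_poly_pCons)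

lemma lift_poly_add: "lift_poly (c + d) = lift_poly c + lift_poly d"
  by (induction c d rule: poly_induct2) (simp_all add: lift_poly_pCons cst_add algebra_simps)

lemma lift_poly_smult: "lift_poly (smult a c) = cst a * lift_poly c"
  by (induction c) (simp_all add: lift_poly_pCons cst_mult algebra_simps)

lemma lift_poly_linear_mult: "lift_poly ([:- a, 1:] * c) = (lineX + cst (- a)) * lift_poly c"
proof -
  have "[:- a, 1:] * c = smult (- a) c + pCons 0 c" by simp
  then show ?thesis by (simp only: lift_poly_add lift_poly_smult lift_poly_pCons cst_0) (simp add: algebra_simps)
qed

lemma lift_poly_sum: "lift_poly (\<Sum>i\<in>I. c i) = (\<Sum>i\<in>I. lift_poly (c i))"
  by (induction I rule: infinite_finite_induct) (simp_all add: lift_poly_add)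

lemma cst_1: "cst 1 = 1"
  by (simp add: cst_def nov_monom_zero_one)

lemma lift_poly_monom: "lift_poly (monom a i) = single i (nov_monom a 0)"
  by (induction i) (simp_all add: monom_0 monom_Suc lift_poly_pCons lineX_def mult_single cst_def const_def)

text \<open>The polynomial splits over \<complex>, each linear factor is measured by
  \<open>disc_linear\<close>, and the leading coefficient has norm 1.\<close>

lemma disc_lift_poly:
  assumes "c \<noteq> 0" "0 < \<rho>"
  shows "disc \<alpha> \<rho> (lift_poly c) = (\<Prod>x\<in>#proots c. max \<rho> (nov_triv (\<alpha> - x)))"
proof -
  note ms = mult_seminorm_disc[OF assms(2), of \<alpha>]
  have "disc \<alpha> \<rho> (lift_poly (\<Prod>x\<in>#M. [:- x, 1:])) = (\<Prod>x\<in>#M. max \<rho> (nov_triv (\<alpha> - x)))" for M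
  proof (induction M)
    case empty
    have "lift_poly 1 = 1" using lift_poly_pCons[of 1 0] by (simp add: cst_1 one_pCons)
    then show ?case by (simp add: ms_1[OF ms])
  next
    case (add x M)
    then show ?case
      using disc_linear[OF assms(2), of \<alpha> "- x"]
      by (simp only: image_mset_add_mset prod_mset.add_mset lift_poly_linear_mult ms_mult[OF ms]) simp
  qed
  moreover have "c = smult (lead_coeff c) (\<Prod>x\<in>#proots c. [:- x, 1:])"
    by (rule complex_poly_decompose_multiset[symmetric])
  then have "lift_poly c = cst (lead_coeff c) * lift_poly (\<Prod>x\<in>#proots c. [:- x, 1:])"
    by (metis lift_poly_smult)
  ultimately show ?thesis using assms(1) by (simp add: ms_mult[OF ms] ms_cst[OF ms] nov_triv_def)
qed

text \<open>Inside the residue disk of \<open>\<alpha>\<close> every other root contributes the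
  factor 1, so the exponent is the multiplicity of \<open>\<alpha>\<close>.\<close>

lemma disc_lift_poly_inner:
  assumes "c \<noteq> 0" "0 < \<rho>" "\<rho> \<le> 1"
  shows "disc \<alpha> \<rho> (lift_poly c) = \<rho> ^ count (proots c) \<alpha>"
proof -
  have "(\<Prod>x\<in>#M. max \<rho> (nov_triv (\<alpha> - x))) = \<rho> ^ count M \<alpha>" for M
    using assms by (induction M) (auto simp: nov_triv_def max_def)
  then show ?thesis using disc_lift_poly[OF assms(1,2)] by simp
qed

text \<open>From radius 1 on all residue disks are swallowed, every root contributes
  \<open>\<rho>\<close>, and the exponent is the degree.\<close>

lemma disc_lift_poly_outer:
  assumes "c \<noteq> 0" "1 \<le> \<rho>"
  shows "disc \<alpha> \<rho> (lift_poly c) = \<rho> ^ size (proots c)"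
proof -
  have "(\<Prod>x\<in>#M. max \<rho> (nov_triv (\<alpha> - x))) = \<rho> ^ size M" for M
    using assms by (induction M) (auto simp: nov_triv_def max_def)
  then show ?thesis using disc_lift_poly[of c \<rho> \<alpha>] assms by simp
qed

text \<open>The coefficient at exponent 0 is the residue class; what remains has only positive
  exponents.\<close>

lemma nov_residue_less:
  assumes "nov_norm x \<le> 1"
  shows "nov_norm (x - nov_monom (nov_coeff x 0) 0) < 1"
proof (cases "x - nov_monom (nov_coeff x 0) 0 = 0")
  case False
  then obtain l where l: "nov_coeff (x - nov_monom (nov_coeff x 0) 0) l \<noteq> 0"
    "nov_norm (x - nov_monom (nov_coeff x 0) 0) = exp (- l)"
    by (rule nov_norm_nonzeroE)
  then have "l \<noteq> 0" "nov_coeff x l \<noteq> 0" by (auto simp: nov_coeff_monom split: if_splits)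
  moreover have "0 \<le> l" using assms nov_norm_le_iff[of x 0] \<open>nov_coeff x l \<noteq> 0\<close> by simp
  ultimately show ?thesis using l(2) by simp
qed simp

text \<open>Here \<open>c\<close> is the reduction modulo the maximal ideal of \<open>f\<close>, scaled to Gauss norm 1.\<close>

lemma disc_reduction:
  assumes f: "f \<noteq> 0"
  obtains k c where "k > 0" "c \<noteq> 0" "\<And>\<alpha>. disc \<alpha> 1 f = k"
    "\<And>\<alpha>. eventually (\<lambda>\<rho>. disc \<alpha> \<rho> f = k * disc \<alpha> \<rho> (lift_poly c)) (at 1)"
proof -
  have ms1: "mult_seminorm (disc \<alpha> 1)" for \<alpha> by (rule mult_seminorm_disc) simp
  let ?n = "\<lambda>i. nov_norm (lookup f i)"
  have K: "finite (?n ` keys f)" "?n ` keys f \<noteq> {}"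
    using f by (auto simp: keys_eq_empty)
  define k where "k = Max (?n ` keys f)"
  have le_k: "?n i \<le> k" if "i \<in> keys f" for i
    unfolding k_def using K that by (intro Max_ge) auto
  obtain j where j: "j \<in> keys f" "k = ?n j" using Max_in[OF K] unfolding k_def by auto
  have k: "k > 0" using j by (simp add: in_keys_iff less_le)
  \<comment> \<open>The inverse of a coefficient of greatest norm, so that
    \<open>const t * f\<close> has coefficients of norm at most 1 and one of norm exactly 1.\<close>
  define t where "t = inverse (lookup f j)"
  have t: "nov_norm t * k = 1"
    using j by (simp add: t_def in_keys_iff nov_norm_mult[symmetric])
  let ?x = "\<lambda>i. t * lookup f i"
  have x: "nov_norm (?x i) \<le> 1" if "i \<in> keys f" for i
  proof -
    have "nov_norm t * ?n i \<le> nov_norm t * k" using le_k[OF that] by (intro mult_left_mono) auto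
    then show ?thesis using t by (simp add: nov_norm_mult)
  qed
  define c where "c = (\<Sum>i\<in>keys f. monom (nov_coeff (?x i) 0) i)"
  define r where "r = const t * f - lift_poly c"
  have "const t * f = (\<Sum>i\<in>keys f. single i (?x i))"
    using arg_cong[OF nov_alg_sum_single[of f], of "\<lambda>f. const t * f"]
    by (simp add: sum_distrib_left const_def mult_single)
  then have r_eq: "r = (\<Sum>i\<in>keys f. single i (?x i - nov_monom (nov_coeff (?x i) 0) 0))"
    by (simp add: r_def c_def lift_poly_sum lift_poly_monom sum_subtractf[symmetric] single_diff)
  have X1: "disc \<alpha> 1 lineX = 1" for \<alpha>
    using disc_linear[of 1 \<alpha> 0] by (simp add: nov_triv_def)
  have r1: "disc \<alpha> 1 r < 1" for \<alpha>
    unfolding r_eq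
  proof (rule ms_sum_less[OF ms1])
    fix i assume i: "i \<in> keys f"
    have "single i a = const a * lineX ^ i" for a
      by (simp add: lineX_power const_def mult_single)
    then have "disc \<alpha> 1 (single i a) = nov_norm a" for a
      by (simp add: ms_mult[OF ms1] ms_power[OF ms1] ms_const[OF ms1] X1)
    then show "disc \<alpha> 1 (single i (?x i - nov_monom (nov_coeff (?x i) 0) 0)) < 1"
      using nov_residue_less[OF x[OF i]] by simp
  qed simp
  have c: "c \<noteq> 0"
  proof
    assume "c = 0"
    then have "disc 0 1 (const t * f) < 1" using r1[of 0] by (simp add: r_def)
    then have "nov_norm t * disc 0 1 f < 1" by (simp add: ms_mult[OF ms1] ms_const[OF ms1])
    moreover have "nov_norm t * k \<le> nov_norm t * disc 0 1 f"
      using disc_0_coeff[of 1 j f] j by (intro mult_left_mono) auto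
    ultimately show False using t by simp
  qed
  have lift1: "disc \<alpha> 1 (lift_poly c) = 1" for \<alpha>
    using disc_lift_poly_inner[OF c, of 1 \<alpha>] by simp
  have eq: "disc \<alpha> \<rho> f = k * disc \<alpha> \<rho> (lift_poly c)"
    if "0 < \<rho>" "disc \<alpha> \<rho> r < disc \<alpha> \<rho> (lift_poly c)" for \<alpha> \<rho>
  proof -
    note ms = mult_seminorm_disc[OF that(1)]
    have "disc \<alpha> \<rho> (const t * f) = disc \<alpha> \<rho> (lift_poly c)"
      using ms_add_eq(1)[OF ms that(2)] by (simp add: r_def)
    then have "nov_norm t * disc \<alpha> \<rho> f = disc \<alpha> \<rho> (lift_poly c)"
      by (simp add: ms_mult[OF ms] ms_const[OF ms])
    then have "k * (nov_norm t * disc \<alpha> \<rho> f) = k * disc \<alpha> \<rho> (lift_poly c)" by simp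
    then show ?thesis using t by (simp add: mult.assoc[symmetric] mult.commute[of k])
  qed
  show ?thesis
  proof (rule that[OF k c])
    show "disc \<alpha> 1 f = k" for \<alpha> using eq[of 1 \<alpha>] r1 lift1 by simp
    fix \<alpha>
    \<comment> \<open>At radius 1 the remainder \<open>r\<close> has norm below 1 and the lifted
      reduction has norm 1; continuity in the radius keeps the remainder dominated nearby.\<close>
    have "((\<lambda>\<rho>. disc \<alpha> \<rho> (lift_poly c) - disc \<alpha> \<rho> r) \<longlongrightarrow> disc \<alpha> 1 (lift_poly c) - disc \<alpha> 1 r) (at 1)"
      by (intro tendsto_diff disc_tendsto) simp_all
    then have "eventually (\<lambda>\<rho>. 0 < disc \<alpha> \<rho> (lift_poly c) - disc \<alpha> \<rho> r) (at 1)"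
      by (rule order_tendstoD) (simp add: r1 lift1)
    moreover have "eventually (\<lambda>\<rho>::real. 0 < \<rho>) (at 1)"
      by (rule order_tendstoD(1)[OF tendsto_ident_at]) simp
    ultimately show "eventually (\<lambda>\<rho>. disc \<alpha> \<rho> f = k * disc \<alpha> \<rho> (lift_poly c)) (at 1)"
      by eventually_elim (simp add: eq)
  qed
qed

text \<open>All complex centers lie in one closed unit disk and share its Gauss point; this is where
  the residue disks meet.\<close>

lemma disc_1_indep: "disc \<alpha> 1 f = disc 0 1 f"
proof (cases "f = 0")
  case True
  then show ?thesis by (simp add: ms_0[OF mult_seminorm_disc])
next
  case False
  then show ?thesis by (rule disc_reduction) metis
qed

text \<open>By the hypothesis on the residue disks, the reductions of \<open>P\<close> and \<open>D\<close> have the same roots in \<open>\<complex>\<close>,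
  hence the same degree, which governs the norm for \<open>\<rho> > 1\<close>.\<close>

lemma disc_quotient_constant:
  assumes P: "disc 0 1 P \<noteq> 0" and D: "disc 0 1 D \<noteq> 0"
    and inner: "\<And>\<alpha>. eventually (\<lambda>\<rho>. disc \<alpha> \<rho> P / disc \<alpha> \<rho> D = disc 0 1 P / disc 0 1 D) (at_left 1)"
  shows "eventually (\<lambda>\<rho>. disc 0 \<rho> P / disc 0 \<rho> D = disc 0 1 P / disc 0 1 D) (at_right 1)"
proof -
  have ms1: "mult_seminorm (disc \<alpha> 1)" for \<alpha> by (rule mult_seminorm_disc) simp
  have "P \<noteq> 0" "D \<noteq> 0" using P D ms_0[OF ms1] by auto
  obtain kP cP where cP: "kP > 0" "cP \<noteq> 0" "\<And>\<alpha>. disc \<alpha> 1 P = kP"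
    "\<And>\<alpha>. eventually (\<lambda>\<rho>. disc \<alpha> \<rho> P = kP * disc \<alpha> \<rho> (lift_poly cP)) (at 1)"
    using disc_reduction[OF \<open>P \<noteq> 0\<close>] by blast
  obtain kD cD where cD: "kD > 0" "cD \<noteq> 0" "\<And>\<alpha>. disc \<alpha> 1 D = kD"
    "\<And>\<alpha>. eventually (\<lambda>\<rho>. disc \<alpha> \<rho> D = kD * disc \<alpha> \<rho> (lift_poly cD)) (at 1)"
    using disc_reduction[OF \<open>D \<noteq> 0\<close>] by blast
  \<comment> \<open>For a radius just below 1 the quotient of the norms is a constant times a power
    of \<open>\<rho>\<close> whose exponent is the difference of the two multiplicities; constancy
    forces this to be 0.\<close>
  have "count (proots cP) \<alpha> = count (proots cD) \<alpha>" for \<alpha>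
  proof -
    have "eventually (\<lambda>\<rho>::real. 0 < \<rho>) (at_left 1)"
      by (rule order_tendstoD(1)[OF tendsto_ident_at]) simp
    moreover have "eventually (\<lambda>\<rho>::real. \<rho> < 1) (at_left 1)"
      by (simp add: eventually_at_filter)
    ultimately have "eventually (\<lambda>\<rho>::real. \<rho> ^ count (proots cP) \<alpha> = \<rho> ^ count (proots cD) \<alpha> \<and> 0 < \<rho> \<and> \<rho> < 1) (at_left 1)"
      using inner[of \<alpha>] filter_leD[OF at_le[OF subset_UNIV] cP(4)[of \<alpha>]] filter_leD[OF at_le[OF subset_UNIV] cD(4)[of \<alpha>]]
    proof eventually_elim
      case (elim \<rho>)
      then show ?case using cP(1) cD(1)
        by (simp add: disc_lift_poly_inner[OF cP(2)] disc_lift_poly_inner[OF cD(2)] cP(3) cD(3) field_simps)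
    qed
    then obtain \<rho> :: real where "\<rho> ^ count (proots cP) \<alpha> = \<rho> ^ count (proots cD) \<alpha>" "0 < \<rho>" "\<rho> < 1"
      using eventually_happens[of _ "at_left (1::real)"] by auto
    then show ?thesis using power_inject_exp'[of \<rho>] by simp
  qed
  then have eq: "proots cP = proots cD" by (intro multiset_eqI)
  have "eventually (\<lambda>\<rho>::real. 1 < \<rho>) (at_right 1)"
    by (simp add: eventually_at_filter)
  then show ?thesis
    using filter_leD[OF at_le[OF subset_UNIV] cP(4)[of 0]] filter_leD[OF at_le[OF subset_UNIV] cD(4)[of 0]]
  proof eventually_elim
    case (elim \<rho>)
    then show ?case
      by (simp add: disc_lift_poly_outer[OF cP(2)] disc_lift_poly_outer[OF cD(2)] cP(3) cD(3) eq)
  qed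
qed


section \<open>Singular points\<close>

text \<open>An affine line in \<open>Y\<close> on which z is 0 or infinite and y_1, y_2 are
  constants. Constancy of \<open>Z0\<close> and \<open>Z1\<close> makes the normalizing factor 1, so
  homogeneous forms restrict to polynomials without rescaling.\<close>

locale line_in_Y =
  fixes e :: "yvar \<Rightarrow> line_alg"
  assumes e_rel: "yrel e" and e_Z: "(e Z0 = 0 \<and> e Z1 = 1) \<or> (e Z0 = 1 \<and> e Z1 = 0)"
    and e_Y: "\<exists>a b. e Y1 = const a \<and> e Y2 = const b \<and> a \<noteq> 0 \<and> b \<noteq> 0"
begin

definition pt :: "complex \<Rightarrow> real \<Rightarrow> y_mon berk_pt"
  where "pt \<alpha> \<rho> = yan_pt (\<lambda>f. disc \<alpha> \<rho> (yeval const e f))"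

context
  fixes \<alpha> :: complex and \<rho> :: real
  assumes \<rho>: "0 < \<rho>"
begin

lemma mult_seminorm_line: "mult_seminorm (\<lambda>f. disc \<alpha> \<rho> (yeval const e f))"
  by (rule mult_seminorm_heval[OF mult_seminorm_disc[OF \<rho>]]) (simp_all add: ymon_add)

lemma line_var: "disc \<alpha> \<rho> (yeval const e (var v)) = disc \<alpha> \<rho> (e v)"
  by (simp add: yeval_var[OF nov_hom_const])

lemma line_scale: "max (disc \<alpha> \<rho> (e Z0)) (disc \<alpha> \<rho> (e Z1)) = 1"
  using e_Z by (auto simp: ms_0[OF mult_seminorm_disc[OF \<rho>]] ms_1[OF mult_seminorm_disc[OF \<rho>]])

lemma line_Z_nonzero: "disc \<alpha> \<rho> (yeval const e (var Z0)) \<noteq> 0 \<or> disc \<alpha> \<rho> (yeval const e (var Z1)) \<noteq> 0"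
  using line_scale unfolding line_var by auto

lemma pt_homog: "homog d f \<Longrightarrow> pt \<alpha> \<rho> f = disc \<alpha> \<rho> (yeval const e f)"
  unfolding pt_def using yan_pt_homog[OF mult_seminorm_line line_Z_nonzero, of d f]
  by (simp add: line_var line_scale)

lemma pt_var: "pt \<alpha> \<rho> (var v) = disc \<alpha> \<rho> (e v)"
  by (simp add: pt_homog[OF homog_var] line_var)

lemma pt_in_Yan: "pt \<alpha> \<rho> \<in> Yan"
  unfolding pt_def
proof (rule yan_pt_in_Yan[OF mult_seminorm_line line_Z_nonzero])
  show "disc \<alpha> \<rho> (yeval const e (var Y1)) \<noteq> 0" "disc \<alpha> \<rho> (yeval const e (var Y2)) \<noteq> 0"
    unfolding line_var using e_Y by (auto simp: ms_const[OF mult_seminorm_disc[OF \<rho>]])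
  show "disc \<alpha> \<rho> (yeval const e (var X1 * var Z0 - (1 + var Y1) * var Z1)) = 0"
    "disc \<alpha> \<rho> (yeval const e (var X2 * var Z1 - (1 + var Y2) * var Z0)) = 0"
    by (simp_all only: yeval_rel[OF nov_hom_const e_rel] ms_0[OF mult_seminorm_disc[OF \<rho>]])
qed

end

lemma pt_1_indep: "pt \<alpha> 1 = pt 0 1"
  unfolding pt_def by (simp add: disc_1_indep[of \<alpha>])

lemma continuous_on_pt: "continuous_on {0<..} (pt \<alpha>)"
proof (rule continuous_on_coordinatewise_then_product[of _ "pt \<alpha>"])
  fix f
  obtain K where K: "\<And>d. K < d \<Longrightarrow> gpart zdeg d f = 0" by (rule gdegs_bound[of zdeg f]) blast
  have "continuous_on {0<..} (\<lambda>\<rho>. SUP d. disc \<alpha> \<rho> (yeval const e (gpart zdeg d f)))"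
    using K by (intro continuous_on_SUP_eventually_zero[where K = K] continuous_on_disc)
      (simp add: heval_0[OF nov_hom_const] ms_0[OF mult_seminorm_disc])
  moreover have "(SUP d. disc \<alpha> \<rho> (yeval const e (gpart zdeg d f))) = pt \<alpha> \<rho> f" if "\<rho> \<in> {0<..}" for \<rho>
    unfolding pt_def yan_pt_def gauss_def using that by (simp add: line_var line_scale)
  ultimately show "continuous_on {0<..} (\<lambda>\<rho>. pt \<alpha> \<rho> f)" by (rule continuous_on_eq)
qed

text \<open>In a chart around \<open>b\<close> the torus coordinates would have constant norm on the closed unit disk,
  hence on slightly larger disks, and the chart could not separate \<open>b\<close> from their images.\<close>

lemma not_smooth_point:
  fixes F :: "y_mon berk_pt \<Rightarrow> 'b::topological_space"
  assumes F: "continuous_on Yan F" "F ` Yan \<subseteq> B"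
    and inner: "\<And>\<alpha> \<rho>. 0 < \<rho> \<Longrightarrow> \<rho> \<le> 1 \<Longrightarrow> F (pt \<alpha> \<rho>) = b" and outer: "\<And>\<rho>. 1 < \<rho> \<Longrightarrow> F (pt 0 \<rho>) \<noteq> b"
  shows "\<not> smooth_point TYPE(3) y_fracs Yan F B b"
proof
  assume "smooth_point TYPE(3) y_fracs Yan F B b"
  then obtain U and V :: "(real ^ 3) set" and h \<phi> where U: "openin (top_of_set B) U" "b \<in> U"
    and h: "homeomorphic_map (top_of_set U) (top_of_set V) h"
    and iso: "analytic_iso y_fracs {x\<in>Yan. F x \<in> U} UNIV {p\<in>torus_an. trop p \<in> V} \<phi>"
    and trop: "\<forall>x\<in>Yan. F x \<in> U \<longrightarrow> trop (\<phi> x) = h (F x)"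
    unfolding smooth_point_def by - (elim conjE exE, rule that, assumption+)
  let ?W = "{x\<in>Yan. F x \<in> U}" and ?W' = "{p\<in>torus_an. trop p \<in> V}"
  let ?x0 = "pt 0 1"
  have hom: "homeomorphic_map (top_of_set ?W) (top_of_set ?W') \<phi>"
    using iso by (simp add: analytic_iso_def)
  from iso obtain \<tau> where
    \<tau>1: "\<forall>x\<in>?W. \<tau> x \<in> ring_iso (residue_field UNIV (\<phi> x)) (residue_field y_fracs x) \<and>
        (\<forall>a\<in>carrier (residue_field UNIV (\<phi> x)). residue_norm x (\<tau> x a) = residue_norm (\<phi> x) a) \<and>
        (\<forall>c. \<tau> x (residue_frac UNIV (\<phi> x) (const c, 1)) = residue_frac y_fracs x (const c, 1))"
    and \<tau>2: "\<forall>U f. openin (top_of_set ?W') U \<and> (\<forall>y\<in>U. f y \<in> carrier (residue_field UNIV y)) \<longrightarrow>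
        (analytic_fun UNIV U f \<longleftrightarrow> analytic_fun y_fracs {x\<in>?W. \<phi> x \<in> U} (\<lambda>x. \<tau> x (f (\<phi> x))))"
    unfolding analytic_iso_def by - (elim conjE exE, rule that, assumption+)
  have isom: "residue_norm x (\<tau> x a) = residue_norm (\<phi> x) a"
    if "x \<in> ?W" "a \<in> carrier (residue_field UNIV (\<phi> x))" for x a
    using \<tau>1[rule_format, OF that(1)] that(2) by simp
  have sheaf: "analytic_fun y_fracs {x\<in>?W. \<phi> x \<in> U} (\<lambda>x. \<tau> x (f (\<phi> x)))"
    if "openin (top_of_set ?W') U" "\<forall>y\<in>U. f y \<in> carrier (residue_field UNIV y)" "analytic_fun UNIV U f" for U f
    using \<tau>2[rule_format, of U f] that by simp
  have \<phi>W: "\<phi> x \<in> ?W'" if "x \<in> ?W" for x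
    using homeomorphic_imp_surjective_map[OF hom] that by auto
  have ms\<phi>: "mult_seminorm (\<phi> x)" if "x \<in> ?W" for x
    using \<phi>W[OF that] by (simp add: torus_an_def)
  have opW: "openin (top_of_set Yan) ?W"
  proof -
    obtain O' where O': "open O'" "U = O' \<inter> B" using U(1) by (auto simp: openin_open)
    have "?W = Yan \<inter> F -` O'" using F(2) O'(2) by auto
    then show ?thesis using continuous_openin_preimage_gen[OF F(1) O'(1)] by simp
  qed
  have x0: "?x0 \<in> ?W" using pt_in_Yan[of 1 0] inner[of 1 0] U(2) by simp
  define G where "G i x = \<phi> x (tvar i)" for i x
  have G_pos: "0 < G i x" if "x \<in> ?W" for i x
    using tvar_nonzero[OF ms\<phi>[OF that], of i] ms_nonneg[OF ms\<phi>[OF that], of "tvar i"] by (simp add: G_def)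
  have G_trop: "h (F x) $ i = - ln (G i x)" if x: "x \<in> ?W" for i x
  proof -
    have "trop (\<phi> x) $ i = - ln (G i x)"
      using G_pos[OF x, of i] by (simp add: trop_def pt_val_def G_def)
    then show ?thesis using trop x by simp
  qed
  \<comment> \<open>The norms of the torus coordinates depend only on the image under
    \<open>F\<close>, because the chart covers the map \<open>h\<close> of the bases.\<close>
  have G_base: "G i x = G i y" if "x \<in> ?W" "y \<in> ?W" "F x = F y" for i x y
    using G_trop[OF that(1), of i] G_trop[OF that(2), of i] that(3) G_pos[OF that(1)] G_pos[OF that(2)]
    by (metis ln_inj_iff neg_equal_iff_equal)
  have G_cont: "continuous_on ?W (G i)" for i
  proof -
    have "continuous_on ?W \<phi>" using homeomorphic_imp_continuous_map[OF hom] by simp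
    then show ?thesis unfolding G_def by (rule continuous_on_product_then_coordinatewise)
  qed
  \<comment> \<open>A torus coordinate pulls back to an analytic function. One fraction
    approximating it to within half of its norm at \<open>?x0\<close> already has the same norm on a
    neighborhood.\<close>
  have quotient: "\<exists>N a. openin (top_of_set ?W) N \<and> ?x0 \<in> N \<and> a \<in> y_fracs \<and>
      (\<forall>y\<in>N. y (snd a) \<noteq> 0 \<and> frac_norm y a = G i y)" for i
  proof -
    let ?f = "\<lambda>y. residue_frac UNIV y (tvar i, 1)"
    have car: "?f y \<in> carrier (residue_field UNIV y)" if "y \<in> torus_an" for y :: "3 torus_mon berk_pt"
      using that by (intro residue_frac_in_carrier frac_closed_UNIV) (simp_all add: torus_an_def ms_1)
    have "analytic_fun UNIV ?W' ?f"
      unfolding analytic_fun_def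
    proof (intro conjI ballI)
      fix y assume y: "y \<in> ?W'"
      then show "?f y \<in> carrier (residue_field UNIV y)" by (intro car) simp
      have *: "residue_dist UNIV y (?f y) (tvar i, 1) = 0" if y: "y \<in> ?W'" for y
      proof -
        have msy: "mult_seminorm y" using y by (simp add: torus_an_def)
        have c: "(\<lambda>_. (tvar i, 1)) \<in> frac_cauchy UNIV y"
          by (intro frac_cauchy_const[OF msy frac_closed_UNIV]) (simp_all add: ms_1[OF msy])
        have "(\<lambda>n. frac_dist y (tvar i, 1) (tvar i, 1)) \<longlonglongrightarrow> residue_dist UNIV y (?f y) (tvar i, 1)"
          using residue_dist_lim[OF msy frac_closed_UNIV c, of "(tvar i, 1)"]
          by (simp add: residue_frac_def ms_1[OF msy])
        then show ?thesis by (simp add: frac_dist_self[OF msy] LIMSEQ_const_iff)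
      qed
      show "\<exists>N. openin (top_of_set ?W') N \<and> y \<in> N \<and> (\<forall>e>0. \<exists>a\<in>UNIV. \<forall>y\<in>N. y (snd a) \<noteq> 0 \<and>
          residue_dist UNIV y (?f y) a < e)"
      proof (intro exI[of _ ?W'] conjI allI impI bexI[of _ "(tvar i, 1)"] ballI)
        fix e :: real and y assume "e > 0" "y \<in> ?W'"
        then show "residue_dist UNIV y (?f y) (tvar i, 1) < e" "y (snd (tvar i, 1)) \<noteq> 0"
          using *[of y] by (simp_all add: torus_an_def ms_1)
      qed (use y in auto)
    qed
    from sheaf[OF _ _ this] car
    have an: "analytic_fun y_fracs {x\<in>?W. \<phi> x \<in> ?W'} (\<lambda>x. \<tau> x (?f (\<phi> x)))" by simp
    have "{x\<in>?W. \<phi> x \<in> ?W'} = ?W" using \<phi>W by blast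
    then have an: "analytic_fun y_fracs ?W (\<lambda>x. \<tau> x (?f (\<phi> x)))" using an by simp
    then obtain N where N: "openin (top_of_set ?W) N" "?x0 \<in> N"
      "\<forall>e>0. \<exists>a\<in>y_fracs. \<forall>y\<in>N. y (snd a) \<noteq> 0 \<and>
        residue_dist y_fracs y (\<tau> y (?f (\<phi> y))) a < e"
      using x0 unfolding analytic_fun_def by blast
    define \<epsilon> where "\<epsilon> = G i ?x0 / 2"
    have \<epsilon>: "0 < \<epsilon>" "\<epsilon> < G i ?x0" using G_pos[OF x0, of i] by (simp_all add: \<epsilon>_def)
    obtain a where a: "a \<in> y_fracs" "\<And>y. y \<in> N \<Longrightarrow> y (snd a) \<noteq> 0 \<and>
        residue_dist y_fracs y (\<tau> y (?f (\<phi> y))) a < \<epsilon>"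
      using N(3) \<epsilon>(1) by blast
    let ?N = "N \<inter> (?W \<inter> G i -` {\<epsilon><..})"
    have "openin (top_of_set ?W) (?W \<inter> G i -` {\<epsilon><..})"
      by (rule continuous_openin_preimage_gen[OF G_cont]) simp
    then have "openin (top_of_set ?W) ?N" using N(1) by (rule openin_Int[rotated])
    moreover have "?x0 \<in> ?N" using N(2) x0 \<epsilon>(2) by simp
    moreover have "y (snd a) \<noteq> 0 \<and> frac_norm y a = G i y" if y: "y \<in> ?N" for y
    proof -
      have yW: "y \<in> ?W" and yN: "y \<in> N" and yG: "\<epsilon> < G i y" using y by auto
      have msy: "mult_seminorm y" using yW YanD(1) by blast
      have norm: "residue_norm y (\<tau> y (?f (\<phi> y))) = G i y"
        using isom[OF yW car] \<phi>W[OF yW] residue_norm_frac[OF ms\<phi>[OF yW] frac_closed_UNIV, of "(tvar i, 1)"]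
        by (simp add: frac_norm_def ms_1[OF ms\<phi>[OF yW]] G_def)
      have g: "\<tau> y (?f (\<phi> y)) \<in> carrier (residue_field y_fracs y)"
        using an yW by (simp add: analytic_fun_def)
      have "residue_dist y_fracs y (\<tau> y (?f (\<phi> y))) a < residue_norm y (\<tau> y (?f (\<phi> y)))"
        using a(2)[OF yN] yG unfolding norm by linarith
      from residue_norm_approx[OF msy frac_closed_y_fracs g a(1) _ this] a(2)[OF yN]
      show ?thesis unfolding norm by simp
    qed
    ultimately show ?thesis using a(1) by blast
  qed
  \<comment> \<open>For every center \<open>\<alpha>\<close> the points
    \<open>pt \<alpha> \<rho>\<close> tend to the common point \<open>?x0\<close> as
    \<open>\<rho>\<close> tends to 1, so each residue disk enters every neighborhood of
    \<open>?x0\<close>.\<close>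
  have near: "eventually (\<lambda>\<rho>. pt \<alpha> \<rho> \<in> N) (at 1)" if N: "openin (top_of_set ?W) N" "?x0 \<in> N" for N \<alpha>
  proof -
    have "openin (top_of_set Yan) N" using N(1) opW by (rule openin_trans)
    then obtain O' where O': "open O'" "N = O' \<inter> Yan" by (auto simp: openin_open)
    have "(pt \<alpha> \<longlongrightarrow> pt \<alpha> 1) (at 1)"
      using continuous_on_pt[of \<alpha>] by (auto simp: continuous_on_eq_continuous_at isCont_def)
    moreover have "pt \<alpha> 1 \<in> O'" using N(2) O'(2) pt_1_indep[of \<alpha>] by auto
    ultimately have "eventually (\<lambda>\<rho>. pt \<alpha> \<rho> \<in> O') (at 1)"
      by (rule topological_tendstoD[OF _ O'(1)])
    moreover have "eventually (\<lambda>\<rho>::real. 0 < \<rho>) (at 1)"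
      by (rule order_tendstoD(1)[OF tendsto_ident_at]) simp
    ultimately show ?thesis by eventually_elim (simp add: O'(2) pt_in_Yan)
  qed
  \<comment> \<open>For \<open>\<rho> < 1\<close> near 1 the points of every residue disk lie over
    \<open>b\<close>, which gives constancy of the quotient of norms there;
    \<open>disc_quotient_constant\<close> carries it across to radii above 1.\<close>
  have const: "eventually (\<lambda>\<rho>. G i (pt 0 \<rho>) = G i ?x0 \<and> pt 0 \<rho> \<in> ?W) (at_right 1)" for i
  proof -
    obtain N a where N: "openin (top_of_set ?W) N" "?x0 \<in> N" and a: "a \<in> y_fracs"
      and Na: "\<And>y. y \<in> N \<Longrightarrow> y (snd a) \<noteq> 0 \<and> frac_norm y a = G i y"
      using quotient[of i] by blast
    have NW: "N \<subseteq> ?W" using N(1) by (rule openin_imp_subset)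
    obtain d where d: "homog d (fst a)" "homog d (snd a)"
      using a by (auto simp: y_fracs_def zpart_eq_gpart)
    let ?P = "yeval const e (fst a)" and ?D = "yeval const e (snd a)"
    have val: "G i (pt \<alpha> \<rho>) = disc \<alpha> \<rho> ?P / disc \<alpha> \<rho> ?D" if "0 < \<rho>" "pt \<alpha> \<rho> \<in> N" for \<alpha> \<rho>
      using Na[OF that(2)] by (simp add: frac_norm_def pt_homog[OF that(1) d(1)] pt_homog[OF that(1) d(2)])
    have x0_val: "G i ?x0 = disc 0 1 ?P / disc 0 1 ?D" using val[of 1 0] N(2) by simp
    have pos: "eventually (\<lambda>\<rho>::real. 0 < \<rho>) (at 1)"
      by (rule order_tendstoD(1)[OF tendsto_ident_at]) simp
    have "eventually (\<lambda>\<rho>. disc 0 \<rho> ?P / disc 0 \<rho> ?D = disc 0 1 ?P / disc 0 1 ?D) (at_right 1)"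
    proof (rule disc_quotient_constant)
      show "disc 0 1 ?P \<noteq> 0" "disc 0 1 ?D \<noteq> 0"
        using x0_val G_pos[OF x0, of i] by auto
      fix \<alpha>
      have "eventually (\<lambda>\<rho>::real. \<rho> < 1) (at_left 1)" by (simp add: eventually_at_filter)
      then show "eventually (\<lambda>\<rho>. disc \<alpha> \<rho> ?P / disc \<alpha> \<rho> ?D = disc 0 1 ?P / disc 0 1 ?D) (at_left 1)"
        using filter_leD[OF at_le[OF subset_UNIV] near[OF N, of \<alpha>]] filter_leD[OF at_le[OF subset_UNIV] pos]
      proof eventually_elim
        case (elim \<rho>)
        then have "G i (pt \<alpha> \<rho>) = G i ?x0"
          using NW x0 inner[of \<rho> \<alpha>] inner[of 1 0] by (intro G_base) auto
        then show ?case using val[of \<rho> \<alpha>] elim x0_val by simp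
      qed
    qed
    then show ?thesis
      using filter_leD[OF at_le[OF subset_UNIV] near[OF N, of 0]] filter_leD[OF at_le[OF subset_UNIV] pos]
    proof eventually_elim
      case (elim \<rho>)
      then show ?case using val[of \<rho> 0] x0_val NW by auto
    qed
  qed
  have "eventually (\<lambda>\<rho>::real. 1 < \<rho>) (at_right 1)" by (simp add: eventually_at_filter)
  moreover have "eventually (\<lambda>\<rho>. \<forall>i. G i (pt 0 \<rho>) = G i ?x0 \<and> pt 0 \<rho> \<in> ?W) (at_right 1)"
    using const by (rule eventually_all_finite)
  ultimately have "eventually (\<lambda>\<rho>. 1 < \<rho> \<and> (\<forall>i. G i (pt 0 \<rho>) = G i ?x0 \<and> pt 0 \<rho> \<in> ?W)) (at_right 1)"
    by eventually_elim simp
  then obtain \<rho> :: real where \<rho>: "1 < \<rho>" "\<And>i. G i (pt 0 \<rho>) = G i ?x0" "pt 0 \<rho> \<in> ?W"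
    using eventually_happens[of _ "at_right (1::real)"] by auto
  \<comment> \<open>All three torus valuations agree at the two points, and \<open>h\<close> is
    injective, so a point outside the unit disk would still lie over \<open>b\<close>.\<close>
  have "h (F (pt 0 \<rho>)) = h (F ?x0)"
    using G_trop[OF \<rho>(3)] G_trop[OF x0] \<rho>(2) by (simp add: vec_eq_iff)
  moreover have "inj_on h U" using homeomorphic_imp_injective_map[OF h] by simp
  ultimately have "F (pt 0 \<rho>) = F ?x0" using \<rho>(3) x0 by (auto dest: inj_onD)
  then show False using outer[OF \<rho>(1)] inner[of 1 0] by simp
qed

end

text \<open>The bound \<open>exp (- l)\<close> equals the norm of the scaled coordinate at radius 1,
  so the maximum starts to move only beyond the unit disk, whatever the center.\<close>

lemma disc_scaled:
  assumes "0 < \<rho>"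
  shows "max (disc \<alpha> \<rho> (const (nov_monom 1 l) * lineX)) (exp (- l)) = exp (- l) * max \<rho> 1"
proof -
  note ms = mult_seminorm_disc[OF assms, of \<alpha>]
  have "disc \<alpha> \<rho> (const (nov_monom 1 l) * lineX) = exp (- l) * max \<rho> (nov_triv \<alpha>)"
    using disc_linear[OF assms, of \<alpha> 0] by (simp add: ms_mult[OF ms] ms_const[OF ms] nov_norm_monom)
  moreover have "max (max \<rho> (nov_triv \<alpha>)) 1 = max \<rho> 1" by (auto simp: nov_triv_def max_def)
  ultimately show ?thesis by (metis exp_ge_zero max_mult_distrib_left mult_1_right)
qed

context psi
begin

lemma singular_1:
  assumes B: "F ` Yan \<subseteq> B"
  shows "\<not> smooth_point TYPE(3) y_fracs Yan F B (ps (0, q2, P1 0 q2))"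
proof -
  \<comment> \<open>Chosen so that at radius 1 the norm of x_1 is
    \<open>exp (P1 0 q2 - min 0 q2)\<close>, the level at which the first coordinate of
    \<open>F\<close> is bounded. As y_1 = -1 has norm 1, the line lies over
    \<open>q1 = 0\<close>.\<close>
  define l where "l = min 0 q2 - P1 0 q2"
  define e where "e = (\<lambda>v. case v of X1 \<Rightarrow> const (nov_monom 1 l) * lineX | X2 \<Rightarrow> 0 | Z0 \<Rightarrow> 0 | Z1 \<Rightarrow> 1
    | Y1 \<Rightarrow> const (- 1) | Y2 \<Rightarrow> const (nov_monom 1 q2))"
  interpret line_in_Y e
  proof
    show "yrel e" by (simp add: yrel_def e_def const_uminus)
    show "\<exists>a b. e Y1 = const a \<and> e Y2 = const b \<and> a \<noteq> 0 \<and> b \<noteq> 0"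
      by (intro exI[of _ "- 1"] exI[of _ "nov_monom 1 q2"]) (simp add: e_def nov_monom_nonzero)
  qed (simp add: e_def)
  have F_pt: "F (pt \<alpha> \<rho>) = ps (0, q2, P1 0 q2 + ln (max \<rho> 1))" if \<rho>: "0 < \<rho>" for \<alpha> \<rho>
  proof -
    note ms = mult_seminorm_disc[OF \<rho>, of \<alpha>] and p = pt_in_Yan[OF \<rho>, of \<alpha>]
    have v: "pt \<alpha> \<rho> (var X1) = disc \<alpha> \<rho> (const (nov_monom 1 l) * lineX)" "pt \<alpha> \<rho> (var X2) = 0"
      "pt \<alpha> \<rho> (var Z0) = 0" "pt \<alpha> \<rho> (var Z1) = 1" "pt \<alpha> \<rho> (var Y1) = 1" "pt \<alpha> \<rho> (var Y2) = exp (- q2)"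
      unfolding pt_var[OF \<rho>] by (simp_all add: e_def ms_0[OF ms] ms_1[OF ms] ms_const[OF ms] nov_norm_monom)
    have q: "y_val (pt \<alpha> \<rho>) Y1 = 0" "y_val (pt \<alpha> \<rho>) Y2 = q2" by (simp_all add: y_val_eq[OF p] v)
    define t where "t = ln (max \<rho> 1)"
    have "ln (exp (- l) * max \<rho> 1) = - l + t" "0 \<le> t" by (simp_all add: t_def ln_mult)
    then show ?thesis
      using F_eq[OF p] disc_scaled[OF \<rho>, of \<alpha> l] psi_at_less[of 0 q2] unfolding v q t_def[symmetric]
      by (simp add: zclamp_0[OF psi_at_less] PS_def l_def median_def max_def[of "_ + t"] min_def[of "_ + t"])
  qed
  from not_smooth_point[OF continuous_on_F B, of "ps (0, q2, P1 0 q2)"] show ?thesis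
    by (simp add: F_pt ps_inject max_def)
qed

lemma singular_2:
  assumes B: "F ` Yan \<subseteq> B"
  shows "\<not> smooth_point TYPE(3) y_fracs Yan F B (ps (q1, 0, P2 q1 0))"
proof -
  \<comment> \<open>The exponent \<open>P2 q1 0\<close> makes |x_2| at radius 1 equal to the level
    at which the second coordinate of \<open>F\<close> is bounded.\<close>
  define e where "e = (\<lambda>v. case v of X1 \<Rightarrow> 0 | X2 \<Rightarrow> const (nov_monom 1 (P2 q1 0)) * lineX | Z0 \<Rightarrow> 1 | Z1 \<Rightarrow> 0
    | Y1 \<Rightarrow> const (nov_monom 1 q1) | Y2 \<Rightarrow> const (- 1))"
  interpret line_in_Y e
  proof
    show "yrel e" by (simp add: yrel_def e_def const_uminus)
    show "\<exists>a b. e Y1 = const a \<and> e Y2 = const b \<and> a \<noteq> 0 \<and> b \<noteq> 0"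
      by (intro exI[of _ "nov_monom 1 q1"] exI[of _ "- 1"]) (simp add: e_def nov_monom_nonzero)
  qed (simp add: e_def)
  have F_pt: "F (pt \<alpha> \<rho>) = ps (q1, 0, P2 q1 0 - ln (max \<rho> 1))" if \<rho>: "0 < \<rho>" for \<alpha> \<rho>
  proof -
    note ms = mult_seminorm_disc[OF \<rho>, of \<alpha>] and p = pt_in_Yan[OF \<rho>, of \<alpha>]
    have v: "pt \<alpha> \<rho> (var X2) = disc \<alpha> \<rho> (const (nov_monom 1 (P2 q1 0)) * lineX)" "pt \<alpha> \<rho> (var X1) = 0"
      "pt \<alpha> \<rho> (var Z0) = 1" "pt \<alpha> \<rho> (var Z1) = 0" "pt \<alpha> \<rho> (var Y2) = 1" "pt \<alpha> \<rho> (var Y1) = exp (- q1)"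
      unfolding pt_var[OF \<rho>] by (simp_all add: e_def ms_0[OF ms] ms_1[OF ms] ms_const[OF ms] nov_norm_monom)
    have q: "y_val (pt \<alpha> \<rho>) Y1 = q1" "y_val (pt \<alpha> \<rho>) Y2 = 0" by (simp_all add: y_val_eq[OF p] v)
    define t where "t = ln (max \<rho> 1)"
    have "ln (exp (- P2 q1 0) * max \<rho> 1) = - P2 q1 0 + t" "0 \<le> t" by (simp_all add: t_def ln_mult)
    then show ?thesis
      using F_eq[OF p] disc_scaled[OF \<rho>, of \<alpha> "P2 q1 0"] psi_at_less[of q1 0] unfolding v q t_def[symmetric]
      by (simp add: zclamp_infinity PS_def median_def max_def[of "_ - t"] min_def[of "_ - t"])
  qed
  from not_smooth_point[OF continuous_on_F B, of "ps (q1, 0, P2 q1 0)"] show ?thesis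
    by (simp add: F_pt ps_inject max_def)
qed


section \<open>The singular locus and the image of \<open>j\<close>\<close>

abbreviation "crit \<equiv> {(q1, q2, s). q1 = 0 \<and> s = P1 q1 q2 \<or> q2 = 0 \<and> s = P2 q1 q2}"

text \<open>On the two lines the median is \<open>s\<close> itself, equal to \<open>P1\<close> on
  the first and to \<open>P2\<close> on the second; this is the third entry in which A' and A
  differ.\<close>

lemma Delta_hat_eq: "Delta_hat c1 c2 \<psi> = ps ` crit"
proof -
  have A': "(a, b, c) = A'_pt c1 c2 \<psi> 0 q2 \<longleftrightarrow> (a, b, c, 0, q2) = ps (0, q2, P1 0 q2)" for a b c q2
    using psi_at_less[of 0 q2] by (auto simp: A'_pt_def PS_def median_def)
  have A: "(a, b, c) = A_pt c1 c2 \<psi> q1 0 \<longleftrightarrow> (a, b, c, q1, 0) = ps (q1, 0, P2 q1 0)" for a b c q1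
    using psi_at_less[of q1 0] by (auto simp: A_pt_def PS_def median_def)
  have ps_form: "\<exists>a b c. ps (q1, q2, s) = (a, b, c, q1, q2)" for q1 q2 s by (simp add: PS_def)
  have "Delta_hat c1 c2 \<psi> = {ps (0, q2, P1 0 q2) | q2. True} \<union> {ps (q1, 0, P2 q1 0) | q1. True}"
    unfolding Delta_hat_def A' A using ps_form by (intro arg_cong2[of _ _ _ _ "(\<union>)"]) (safe; metis)+
  also have "\<dots> = ps ` crit" by auto
  finally show ?thesis .
qed

text \<open>Points beyond the walls are handled by the charts of x_1 and x_2. A remaining point
  outside \<open>crit\<close> satisfies the strict inequality of \<open>mid\<close> at each wall
  with \<open>q1 = 0\<close> or \<open>q2 = 0\<close>.\<close>

lemma smooth_outside:
  assumes B: "B \<subseteq> range ps" "ps ` (- crit) \<subseteq> B" and x: "x \<notin> crit"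
  shows "smooth_point TYPE(3) y_fracs {p\<in>Yan. F p \<in> B} F B (ps x)"
proof -
  obtain q1 q2 s where x_eq: "x = (q1, q2, s)" by (metis prod_cases3)
  have "x \<in> mid" if "\<not> P1 q1 q2 < s" "\<not> s < P2 q1 q2"
    using x that by (auto simp: x_eq mid_def)
  then consider "P1 q1 q2 < s" | "s < P2 q1 q2" | "x \<in> mid" by blast
  then show ?thesis
  proof cases
    case 1
    have "ps ` {(q1, q2, s). P1 q1 q2 < s} \<subseteq> B"
      by (intro order_trans[OF image_mono B(2)]) (auto simp: less_not_sym[OF psi_at_less])
    then show ?thesis unfolding x_eq using 1 by (intro smooth_x1 B)
  next
    case 2
    have "ps ` {(q1, q2, s). s < P2 q1 q2} \<subseteq> B"
      by (intro order_trans[OF image_mono B(2)]) (auto simp: less_not_sym[OF psi_at_less])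
    then show ?thesis unfolding x_eq using 2 by (intro smooth_x2 B)
  next
    case 3
    have "ps ` mid \<subseteq> B"
      by (intro order_trans[OF image_mono B(2)]) (auto simp: mid_def)
    then show ?thesis using 3 by (intro smooth_mid B)
  qed
qed

text \<open>Since \<open>min (- s) (- P1)\<close> is \<open>- max s P1\<close>, the map
  \<open>j\<close> is the parametrization of \<open>F(Y)\<close> with \<open>s\<close> equal to the
  value of \<open>\<psi>\<close>.\<close>

lemma j_eq: "j_map c1 c2 \<psi> (q1, q2, q3) = ps (q1, q2, \<psi> (q1, q2, q3))"
  by (auto simp: j_map_def PS_def Let_def min_def max_def)

lemma j_Delta: "j_map c1 c2 \<psi> ` Delta c1 c2 = Delta_hat c1 c2 \<psi>"
proof -
  have "j_map c1 c2 \<psi> ` Delta c1 c2 = ps ` ((\<lambda>(q1, q2, q3). (q1, q2, \<psi> (q1, q2, q3))) ` Delta c1 c2)"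
    unfolding image_image by (intro image_cong refl) (auto simp: j_eq)
  also have "(\<lambda>(q1, q2, q3). (q1, q2, \<psi> (q1, q2, q3))) ` Delta c1 c2 = crit"
    by (force simp: Delta_def psi_at_def)
  finally show ?thesis by (simp add: Delta_hat_eq)
qed

text \<open>The second coordinate of \<open>ps\<close> is \<open>min s P2\<close> with
  \<open>P2 > 0\<close>, so it is positive exactly when \<open>s\<close> is, and the positive
  numbers are exactly the values of \<open>\<psi>\<close> for fixed \<open>q1\<close>,
  \<open>q2\<close>.\<close>

lemma range_j: "range (j_map c1 c2 \<psi>) = {(u1, u2, v, q1, q2). (u1, u2, v, q1, q2) \<in> F ` Yan \<and> u2 > 0}"
proof (intro equalityI subsetI)
  fix u assume "u \<in> range (j_map c1 c2 \<psi>)"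
  then obtain q1 q2 q3 where "u = ps (q1, q2, \<psi> (q1, q2, q3))" by (metis j_eq prod_cases3 rangeE)
  then show "u \<in> {(u1, u2, v, q1, q2). (u1, u2, v, q1, q2) \<in> F ` Yan \<and> u2 > 0}"
    unfolding F_image using psi_pos psi_at_pos
    by (auto simp: PS_def intro!: image_eqI[of _ _ "(q1, q2, \<psi> (q1, q2, q3))"])
next
  fix u assume u: "u \<in> {(u1, u2, v, q1, q2). (u1, u2, v, q1, q2) \<in> F ` Yan \<and> u2 > 0}"
  then obtain q1 q2 s where s: "u = ps (q1, q2, s)" unfolding F_image by auto
  then have "0 < s" using u by (auto simp: PS_def)
  then have "s \<in> range (\<lambda>q3. \<psi> (q1, q2, q3))" using psi_range by simp
  then obtain q3 where "s = \<psi> (q1, q2, q3)" by blast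
  then have "u = j_map c1 c2 \<psi> (q1, q2, q3)" using s by (simp add: j_eq)
  then show "u \<in> range (j_map c1 c2 \<psi>)" by blast
qed

text \<open>The bound \<open>P2\<close> being positive, taking the minimum with it does not change
  the sign condition; where x_2 vanishes the coordinate is \<open>P2\<close> and the valuation is
  infinite.\<close>

lemma F_pos: "{(u1, u2, v, q1, q2). (u1, u2, v, q1, q2) \<in> F ` Yan \<and> u2 > 0} = F ` {p\<in>Yan. pt_val p (var X2) > 0}"
proof -
  have "fst (snd (F p)) > 0 \<longleftrightarrow> pt_val p (var X2) > 0" for p
  proof -
    have "0 < real_of_ereal (min (pt_val p f) (ereal a)) \<longleftrightarrow> 0 < pt_val p f" if "0 < a" for f a
      using that by (auto simp: pt_val_def min_def)
    from this[OF psi_at_pos] show ?thesis by (simp add: F_map_def Let_def)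
  qed
  moreover have "{(u1, u2, v, q1, q2). (u1, u2, v, q1, q2) \<in> F ` Yan \<and> u2 > 0} = F ` {p\<in>Yan. fst (snd (F p)) > 0}"
    unfolding case_prod_unfold prod.collapse by blast
  ultimately show ?thesis by simp
qed

end

theorem theorem4p2:
  fixes c1 c2 :: real and \<psi> :: "real \<times> real \<times> real \<Rightarrow> real"
  assumes "c1 > c2" and "c2 > 0"
    and psi: "is_psi c1 c2 \<psi>"
    and psi_increasing: "\<And>q1 q2. strict_mono (\<lambda>q3. \<psi> (q1, q2, q3))"
    and psi_onto: "\<And>q1 q2. range (\<lambda>q3. \<psi> (q1, q2, q3)) = {0<..}"
  defines "F \<equiv> F_map c1 c2 \<psi>"
    and "j \<equiv> j_map c1 c2 \<psi>"
    and "\<Delta>hat \<equiv> Delta_hat c1 c2 \<psi>"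
    and "B0 \<equiv> F_map c1 c2 \<psi> ` Yan - Delta_hat c1 c2 \<psi>"
  shows "proper_continuous Yan F (F ` Yan)
    \<and> affinoid_torus_fibration TYPE(3) y_fracs {p \<in> Yan. F p \<in> B0} F B0
    \<and> singular_locus TYPE(3) y_fracs Yan F (F ` Yan) = \<Delta>hat
    \<and> j ` Delta c1 c2 = \<Delta>hat
    \<and> range j = {(u1, u2, v, q1, q2). (u1, u2, v, q1, q2) \<in> F ` Yan \<and> u2 > 0}
    \<and> range j = F ` {p \<in> Yan. pt_val p (var X2) > 0}"
proof -
  interpret psi c1 c2 \<psi>
    using assms(1,2) psi psi_increasing psi_onto by unfold_locales (auto simp: is_psi_def)
  have B0: "B0 = ps ` (- crit)"
    unfolding B0_def F_image Delta_hat_eq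
    by (subst image_set_diff[symmetric]) (auto simp: inj_on_def ps_inject Compl_eq_Diff_UNIV)
  have Y: "{p\<in>Yan. F p \<in> F ` Yan} = Yan" by auto
  have proper: "proper_continuous Yan F (F ` Yan)"
    using proper_continuous_F[of UNIV] by (simp add: F_def)
  have "proper_continuous {p\<in>Yan. F p \<in> B0} F (F ` Yan \<inter> B0)"
    using proper_continuous_F[of B0] by (simp add: F_def)
  moreover have "F ` Yan \<inter> B0 = B0" by (auto simp: B0_def F_def)
  moreover have "smooth_point TYPE(3) y_fracs {p\<in>Yan. F p \<in> B0} F B0 b" if "b \<in> B0" for b
    using that smooth_outside[of B0] unfolding F_def B0 by blast
  ultimately have fibration: "affinoid_torus_fibration TYPE(3) y_fracs {p\<in>Yan. F p \<in> B0} F B0"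
    by (simp add: affinoid_torus_fibration_def)
  have "singular_locus TYPE(3) y_fracs Yan F (F ` Yan) = ps ` crit"
  proof (intro equalityI subsetI)
    fix b assume "b \<in> singular_locus TYPE(3) y_fracs Yan F (F ` Yan)"
    then have b: "b \<in> range ps" "\<not> smooth_point TYPE(3) y_fracs Yan F (F ` Yan) b"
      by (simp_all add: singular_locus_def F_def F_image)
    then obtain x where x: "b = ps x" by blast
    have "x \<in> crit"
    proof (rule ccontr)
      assume "x \<notin> crit"
      then have "smooth_point TYPE(3) y_fracs {p\<in>Yan. F p \<in> F ` Yan} F (F ` Yan) (ps x)"
        unfolding F_def by (intro smooth_outside) (auto simp: F_image)
      then show False using b(2) x Y by simp
    qed
    then show "b \<in> ps ` crit" using x by blast
  next
    fix b assume b: "b \<in> ps ` crit"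
    then have "\<not> smooth_point TYPE(3) y_fracs Yan F (F ` Yan) b"
      using singular_1[OF order_refl] singular_2[OF order_refl] unfolding F_def by auto
    moreover have "b \<in> F ` Yan" using b F_image by (auto simp: F_def)
    ultimately show "b \<in> singular_locus TYPE(3) y_fracs Yan F (F ` Yan)"
      by (simp add: singular_locus_def)
  qed
  then have singular: "singular_locus TYPE(3) y_fracs Yan F (F ` Yan) = \<Delta>hat"
    by (simp add: \<Delta>hat_def Delta_hat_eq)
  show ?thesis
    using proper fibration singular j_Delta range_j F_pos unfolding j_def \<Delta>hat_def F_def by simp
qed

end
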